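(* Let $k$ be an algebraically closed field of characteristic not $2$, $P=k[x_1,\dots,x_n]$, and for quadratic forms $f_1,\dots,f_n\in P$ let $A=P/(f_1,\dots,f_n)$. (1) If $n\le4$ and $f_1,\dots,f_n$ is any regular sequence of quadratic forms in $P$, then $A$ contains a homogeneous linear exact zero-divisor. (2) If $n\ge5$ and $(f_1,\dots,f_n)\in\mathcal I$, then $A$ contains no exact zero-divisor.
   Context: Let $\mathbb A$ be the affine space of $n$-tuples $(f_1,\dots,f_n)$ of quadratic forms in $P$ (coordinates: the coefficients), and $\mathcal I\subseteq\mathbb A$ the set of tuples such that $f_1,\dots,f_n$ is a regular sequence and every nonzero element of the $k$-span of $f_1,\dots,f_n$ is irreducible in $P$ (for $n\ge5$ this is a nonempty open subset; its elements are called generic). An element $x$ of a commutative ring $R$ is an exact zero-divisor if $R\neq(0:_Rx)\cong R/(x)\neq0$. *)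

theory Defs
  imports "HOL-Computational_Algebra.Polynomial" "HOL-Library.Poly_Mapping"
          "HOL-Algebra.QuotRing" "HOL-Algebra.Ring_Divisibility"
begin

text \<open>Multivariate polynomials over k: finitely supported maps from monomials
  (exponent vectors, nat =>0 nat) to coefficients.  Variable x_(i+1) is index i.\<close>
type_synonym 'k mpoly = "(nat \<Rightarrow>\<^sub>0 nat) \<Rightarrow>\<^sub>0 'k"

definition polys :: "nat \<Rightarrow> 'k::comm_ring_1 mpoly set" where
  "polys n = {p. \<forall>m\<in>Poly_Mapping.keys p. \<forall>i\<in>Poly_Mapping.keys m. i < n}"

definition poly_ring :: "nat \<Rightarrow> 'k::comm_ring_1 mpoly ring" where
  "poly_ring n = \<lparr>carrier = polys n, mult = (*), one = 1, zero = 0, add = (+)\<rparr>"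

definition total_deg :: "(nat \<Rightarrow>\<^sub>0 nat) \<Rightarrow> nat" where
  "total_deg m = (\<Sum>i\<in>Poly_Mapping.keys m. Poly_Mapping.lookup m i)"

definition homogeneous :: "nat \<Rightarrow> 'k::zero mpoly \<Rightarrow> bool" where
  "homogeneous d p \<longleftrightarrow> (\<forall>m\<in>Poly_Mapping.keys p. total_deg m = d)"

definition quadratic_form :: "nat \<Rightarrow> 'k::comm_ring_1 mpoly \<Rightarrow> bool" where
  "quadratic_form n p \<longleftrightarrow> p \<in> polys n \<and> homogeneous 2 p"

definition linear_form :: "nat \<Rightarrow> 'k::comm_ring_1 mpoly \<Rightarrow> bool" where
  "linear_form n p \<longleftrightarrow> p \<in> polys n \<and> homogeneous 1 p"

definition regular_sequence :: "('a, 'b) ring_scheme \<Rightarrow> 'a list \<Rightarrow> bool" where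
  "regular_sequence R fs \<longleftrightarrow>
     (\<forall>i<length fs. fs ! i \<in> carrier R \<and>
        (\<forall>a\<in>carrier R. fs ! i \<otimes>\<^bsub>R\<^esub> a \<in> genideal R (set (take i fs))
            \<longrightarrow> a \<in> genideal R (set (take i fs))))
     \<and> genideal R (set fs) \<noteq> carrier R"

definition quot_alg :: "nat \<Rightarrow> 'k::comm_ring_1 mpoly list \<Rightarrow> 'k mpoly set ring" where
  "quot_alg n fs = poly_ring n Quot genideal (poly_ring n) (set fs)"

definition kspan :: "'k::comm_ring_1 mpoly list \<Rightarrow> 'k mpoly set" where
  "kspan fs = {\<Sum>i<length fs. Poly_Mapping.single 0 (c i) * fs ! i | c. True}"

definition generic :: "nat \<Rightarrow> 'k::comm_ring_1 mpoly list \<Rightarrow> bool" where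
  "generic n fs \<longleftrightarrow> length fs = n \<and> (\<forall>f\<in>set fs. quadratic_form n f)
     \<and> regular_sequence (poly_ring n) fs
     \<and> (\<forall>g\<in>kspan fs. g \<noteq> 0 \<longrightarrow> ring_irreducible\<^bsub>poly_ring n\<^esub> g)"

definition annihilator :: "('a, 'b) ring_scheme \<Rightarrow> 'a \<Rightarrow> 'a set" where
  "annihilator R x = {a\<in>carrier R. a \<otimes>\<^bsub>R\<^esub> x = \<zero>\<^bsub>R\<^esub>}"

text \<open>x is an exact zero-divisor: R \<noteq> (0:x) \<cong> R/(x) \<noteq> 0, the isomorphism being
  one of R-modules; (0:x) carries the module structure from R, and R/(x) the
  structure r.C = [r] C.\<close>
definition exact_zero_divisor :: "('a, 'b) ring_scheme \<Rightarrow> 'a \<Rightarrow> bool" where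
  "exact_zero_divisor R x \<longleftrightarrow> x \<in> carrier R
     \<and> annihilator R x \<noteq> carrier R
     \<and> carrier (R Quot cgenideal R x) \<noteq> {\<zero>\<^bsub>R Quot cgenideal R x\<^esub>}
     \<and> (\<exists>\<phi>. bij_betw \<phi> (annihilator R x) (carrier (R Quot cgenideal R x))
          \<and> (\<forall>a\<in>annihilator R x. \<forall>b\<in>annihilator R x.
               \<phi> (a \<oplus>\<^bsub>R\<^esub> b) = \<phi> a \<oplus>\<^bsub>R Quot cgenideal R x\<^esub> \<phi> b)
          \<and> (\<forall>r\<in>carrier R. \<forall>a\<in>annihilator R x.
               \<phi> (r \<otimes>\<^bsub>R\<^esub> a) = a_r_coset R (cgenideal R x) r \<otimes>\<^bsub>R Quot cgenideal R x\<^esub> \<phi> a))"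

end

theory Submission
  imports Defs
begin

text \<open>
  Let A be the quotient of P by the ideal of the quadrics f. An element x of A is an exact zero-divisor iff
  there is a nonzero y such that (x) and (y) are the annihilators of each other and x is nonzero.

  If x, y is such a pair, lift it to X, Y and write X Y as a combination of the f with coefficients g.
  The Koszul complex on f together with the periodic resolution of A/(x) over A then yields Tate's free
  resolution of A/(x) over P, whose differential has the f, the g, X and Y as entries. It is infinite,
  so it cannot be minimal: P has finite global dimension, seen here by killing the variables one at a time.
  Hence some g has a nonzero constant term, and the quadratic part of X Y, a product of two linear forms,
  is a nonzero element of the span of the f. This is impossible for generic f.

  Conversely, a nonzero product l r of linear forms in the span of a regular sequence of quadrics makes
  the classes of l and r an exact pair. Being in the span imposes at most n (n - 1) / 2 bilinear
  equations on (l, r), and for n at most 4 this does not exceed the dimension 2 n - 2 of the product of two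
  projective spaces, so there is a nonzero solution. The existence of the solution is a bihomogeneous
  Nullstellensatz: a dimension count shows that the equations generate an ideal that
  contains no power of the irrelevant ideal, and a maximal ideal of this kind is the ideal of a point.
\<close>

section \<open>Koszul and Tate complexes\<close>

text \<open>An exact zero-divisor of A need not be homogeneous and P is not local, so minimality is
  measured at the origin: an entry of the differential is harmless when its constant term vanishes.
  For X and Y this follows from the grading of A, in which an element with nonzero constant term
  annihilates nothing but 0. Finite global dimension enters as a count of degrees. Over P the
  complex is exact in positive degrees; factoring out a nonzerodivisor costs one degree, so modulo
  all n variables it is still exact from degree n + 1 on. If all entries vanish there, the
  differential is zero while the modules are not.

  For the converse, the obstacle is to find a zero of bilinear forms without a dimension theory of
  projective varieties. Ideals are handled through their bihomogeneous pieces, and growth is bounded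
  by counting monomials. Primality comes from maximality, and algebraic closure is used once, to
  split a binary form into linear factors.\<close>

primrec lin :: "'r::comm_ring_1 set \<Rightarrow> 'r list \<Rightarrow> 'r set" where
  "lin P [] = {0}"
| "lin P (f # fs) = {a + f * b | a b. a \<in> lin P fs \<and> b \<in> P}"

text \<open>Regular sequences are read from the end of the list: the head is the last element of the sequence.\<close>

primrec reg :: "'r::comm_ring_1 set \<Rightarrow> 'r list \<Rightarrow> bool" where
  "reg P [] \<longleftrightarrow> True"
| "reg P (f # fs) \<longleftrightarrow> reg P fs \<and> (\<forall>a\<in>P. f * a \<in> lin P fs \<longrightarrow> a \<in> lin P fs)"

text \<open>
  The basis of the exterior algebra on k generators is indexed by natural numbers: the binary digits of b,
  the lowest one belonging to the head of the list, say which generators occur. Digits beyond the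
  first k only produce copies of the complex. The functions \<open>koszul\<close> and \<open>wedge\<close> are contraction with f and
  exterior multiplication by the element with coordinates g, with the signs generated by the recursion.
\<close>

primrec koszul :: "'r::comm_ring_1 list \<Rightarrow> (nat \<Rightarrow> 'r) \<Rightarrow> nat \<Rightarrow> 'r" where
  "koszul [] u b = 0"
| "koszul (f # fs) u b =
     (if odd b then - koszul fs (\<lambda>c. u (2 * c + 1)) (b div 2)
      else koszul fs (\<lambda>c. u (2 * c)) (b div 2) + f * u (b + 1))"

primrec wedge :: "'r::comm_ring_1 list \<Rightarrow> (nat \<Rightarrow> 'r) \<Rightarrow> nat \<Rightarrow> 'r" where
  "wedge [] u b = 0"
| "wedge (g # gs) u b =
     (if odd b then g * u (b - 1) - wedge gs (\<lambda>c. u (2 * c + 1)) (b div 2)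
      else wedge gs (\<lambda>c. u (2 * c)) (b div 2))"

text \<open>This is the exterior degree of the basis element with index \<open>b\<close>. Digits
  beyond the lowest \<open>k\<close>, which only label copies of the complex, do not count.\<close>

primrec wt :: "nat \<Rightarrow> nat \<Rightarrow> nat" where
  "wt 0 b = 0"
| "wt (Suc k) b = b mod 2 + wt k (b div 2)"

definition pure :: "nat \<Rightarrow> nat \<Rightarrow> (nat \<Rightarrow> 'r::zero) \<Rightarrow> bool" where
  "pure k e u \<longleftrightarrow> (\<forall>b. wt k b \<noteq> e \<longrightarrow> u b = 0)"

section \<open>Contraction and exterior multiplication\<close>

lemma koszul_add: "koszul fs (\<lambda>b. u b + v b) b = koszul fs u b + koszul fs v b"
  by (induction fs arbitrary: u v b) (auto simp: algebra_simps)

lemma koszul_scale: "koszul fs (\<lambda>b. c * u b) b = c * koszul fs u b"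
  by (induction fs arbitrary: u b) (auto simp: algebra_simps)

lemma koszul_zero [simp]: "koszul fs (\<lambda>b. 0) b = 0"
  by (induction fs arbitrary: b) auto

lemma koszul_minus: "koszul fs (\<lambda>b. - u b) b = - koszul fs u b"
  using koszul_scale[of fs "-1" u b] by simp

lemma koszul_diff: "koszul fs (\<lambda>b. u b - v b) b = koszul fs u b - koszul fs v b"
  using koszul_add[of fs u "\<lambda>b. - v b" b] by (simp add: koszul_minus)

lemma wedge_add: "wedge fs (\<lambda>b. u b + v b) b = wedge fs u b + wedge fs v b"
  by (induction fs arbitrary: u v b) (auto simp: algebra_simps)

lemma wedge_scale: "wedge fs (\<lambda>b. c * u b) b = c * wedge fs u b"
  by (induction fs arbitrary: u b) (auto simp: algebra_simps)

lemma wedge_zero [simp]: "wedge fs (\<lambda>b. 0) b = 0"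
  by (induction fs arbitrary: b) auto

lemma wedge_minus: "wedge fs (\<lambda>b. - u b) b = - wedge fs u b"
  using wedge_scale[of fs "-1" u b] by simp

lemma wedge_diff: "wedge fs (\<lambda>b. u b - v b) b = wedge fs u b - wedge fs v b"
  using wedge_add[of fs u "\<lambda>b. - v b" b] by (simp add: wedge_minus)

lemma odd_div_2_eq: "odd b \<Longrightarrow> Suc (2 * (b div 2)) = b" for b :: nat
  by (metis Suc_eq_plus1 odd_two_times_div_two_succ)

lemma koszul_koszul: "koszul fs (koszul fs u) b = 0"
  by (induction fs arbitrary: u b)
     (auto simp: koszul_add koszul_minus koszul_scale)

lemma wedge_wedge: "wedge gs (wedge gs u) b = 0"
  by (induction gs arbitrary: u b)
     (auto simp: wedge_add wedge_minus wedge_scale wedge_diff elim!: oddE)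

text \<open>Contraction is an antiderivation, so its anticommutator with exterior multiplication by
  an element is multiplication by the pairing of the two. In the recursion the mixed terms of head
  and tail cancel by sign, and the head contributes \<open>f * g\<close> whether or not its
  generator occurs in \<open>b\<close>.\<close>

lemma koszul_wedge:
  "length gs = length fs \<Longrightarrow>
   koszul fs (wedge gs u) b + wedge gs (koszul fs u) b = (\<Sum>(f, g)\<leftarrow>zip fs gs. f * g) * u b"
proof (induction fs arbitrary: gs u b)
  case (Cons f fs)
  then obtain g gs' where gs: "gs = g # gs'" by (cases gs) auto
  have IH: "koszul fs (wedge gs' v) c + wedge gs' (koszul fs v) c = (\<Sum>(f, g)\<leftarrow>zip fs gs'. f * g) * v c" for v c
    using Cons gs by auto
  show ?case
  proof (cases "odd b")
    case True
    have "koszul fs (wedge gs' (\<lambda>c. u (2*c+1))) (b div 2) + wedge gs' (koszul fs (\<lambda>c. u (2*c+1))) (b div 2)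
        = (\<Sum>(f, g)\<leftarrow>zip fs gs'. f * g) * u b"
      using IH[of "\<lambda>c. u (2*c+1)" "b div 2"] odd_div_2_eq[OF True] by simp
    with True show ?thesis unfolding gs
      by (auto simp: koszul_diff koszul_scale wedge_minus wedge_add wedge_scale algebra_simps elim!: oddE)
  next
    case False
    have "koszul fs (wedge gs' (\<lambda>c. u (2*c))) (b div 2) + wedge gs' (koszul fs (\<lambda>c. u (2*c))) (b div 2)
        = (\<Sum>(f, g)\<leftarrow>zip fs gs'. f * g) * u b"
      using IH[of "\<lambda>c. u (2*c)" "b div 2"] False by simp
    with False show ?thesis unfolding gs
      by (auto simp: koszul_diff koszul_scale wedge_minus wedge_add wedge_scale algebra_simps elim!: evenE)
  qed
qed auto

text \<open>Contraction changes the exterior degree by one and hence anticommutes with the sign of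
  the degree. Together with the analogue for \<open>wedge\<close> this makes the cross terms in the
  square of \<open>dif\<close> cancel.\<close>

lemma koszul_sign:
  "koszul fs (\<lambda>c. (-1) ^ wt (length fs) c * u c) b = - ((-1) ^ wt (length fs) b * koszul fs u b)"
proof (induction fs arbitrary: u b)
  case (Cons f fs)
  show ?case
  proof (cases "odd b")
    case True
    have "koszul fs (\<lambda>c. (-1) ^ wt (length (f # fs)) (2*c+1) * u (2*c+1)) (b div 2)
        = - koszul fs (\<lambda>c. (-1) ^ wt (length fs) c * u (2*c+1)) (b div 2)"
      by (subst koszul_minus[symmetric]) simp
    with True show ?thesis
      using Cons[of "\<lambda>c. u (2*c+1)" "b div 2"] by (auto simp: mod2_eq_if)
  next
    case False
    then have "Suc b div 2 = b div 2" by simp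
    with False show ?thesis
      using Cons[of "\<lambda>c. u (2*c)" "b div 2"] by (simp add: mod2_eq_if algebra_simps)
  qed
qed auto

lemma wedge_sign:
  "wedge fs (\<lambda>c. (-1) ^ wt (length fs) c * u c) b = - ((-1) ^ wt (length fs) b * wedge fs u b)"
proof (induction fs arbitrary: u b)
  case (Cons f fs)
  show ?case
  proof (cases "odd b")
    case True
    have "wedge fs (\<lambda>c. (-1) ^ wt (length (f # fs)) (2*c+1) * u (2*c+1)) (b div 2)
        = - wedge fs (\<lambda>c. (-1) ^ wt (length fs) c * u (2*c+1)) (b div 2)"
      by (subst wedge_minus[symmetric]) simp
    moreover have "(b - Suc 0) div 2 = b div 2" "even (b - Suc 0)"
      using True by (auto elim!: oddE)
    ultimately show ?thesis
      using True Cons[of "\<lambda>c. u (2*c+1)" "b div 2"] by (auto simp: mod2_eq_if algebra_simps)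
  next
    case False
    with False show ?thesis
      using Cons[of "\<lambda>c. u (2*c)" "b div 2"] by (simp add: mod2_eq_if)
  qed
qed auto

lemma koszul_eq_0:
  "(\<And>c. wt (length fs) c = Suc (wt (length fs) b) \<Longrightarrow> u c = 0) \<Longrightarrow> koszul fs u b = 0"
proof (induction fs arbitrary: u b)
  case (Cons f fs)
  show ?case
  proof (cases "odd b")
    case True
    then have "koszul fs (\<lambda>c. u (2*c+1)) (b div 2) = 0"
      by (intro Cons.IH Cons.prems) (auto simp: mod2_eq_if)
    with True show ?thesis by simp
  next
    case False
    then have "koszul fs (\<lambda>c. u (2*c)) (b div 2) = 0"
      by (intro Cons.IH Cons.prems) (auto simp: mod2_eq_if)
    moreover have "u (b + 1) = 0"
      using False by (intro Cons.prems) (auto simp: mod2_eq_if)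
    ultimately show ?thesis using False by simp
  qed
qed auto

lemma wedge_eq_0:
  "(\<And>c. Suc (wt (length fs) c) = wt (length fs) b \<Longrightarrow> u c = 0) \<Longrightarrow> wedge fs u b = 0"
proof (induction fs arbitrary: u b)
  case (Cons f fs)
  show ?case
  proof (cases "odd b")
    case True
    then have "wedge fs (\<lambda>c. u (2*c+1)) (b div 2) = 0"
      by (intro Cons.IH Cons.prems) (auto simp: mod2_eq_if)
    moreover have "u (b - 1) = 0"
      using True by (intro Cons.prems) (auto simp: mod2_eq_if elim!: oddE)
    ultimately show ?thesis using True by simp
  next
    case False
    then have "wedge fs (\<lambda>c. u (2*c)) (b div 2) = 0"
      by (intro Cons.IH Cons.prems) (auto simp: mod2_eq_if)
    with False show ?thesis by simp
  qed
qed auto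

text \<open>The type of polynomials has infinitely many variables, and the polynomial ring in the
  first n of them is only a subset. With an explicit carrier \<open>P\<close>, arithmetic is that of
  the type, while ideals and exactness are relative to \<open>P\<close>.\<close>

locale subring_of =
  fixes P :: "'r::comm_ring_1 set"
  assumes zero_closed [simp, intro]: "0 \<in> P" and one_closed [simp, intro]: "1 \<in> P"
    and add_closed [simp, intro]: "a \<in> P \<Longrightarrow> b \<in> P \<Longrightarrow> a + b \<in> P"
    and minus_closed [simp, intro]: "a \<in> P \<Longrightarrow> - a \<in> P"
    and mult_closed [simp, intro]: "a \<in> P \<Longrightarrow> b \<in> P \<Longrightarrow> a * b \<in> P"
begin

lemma diff_closed [simp, intro]: "a \<in> P \<Longrightarrow> b \<in> P \<Longrightarrow> a - b \<in> P"
  using add_closed[of a "- b"] by simp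

lemma sum_closed: "(\<And>i. i \<in> I \<Longrightarrow> a i \<in> P) \<Longrightarrow> sum a I \<in> P"
  by (induction I rule: infinite_finite_induct) auto

lemma lin_zero [simp, intro]: "0 \<in> lin P fs"
  by (induction fs) (auto intro!: exI[of _ 0])

lemma lin_add: "a \<in> lin P fs \<Longrightarrow> b \<in> lin P fs \<Longrightarrow> a + b \<in> lin P fs"
proof (induction fs arbitrary: a b)
  case (Cons f fs)
  then obtain a1 a2 b1 b2 where "a = a1 + f * a2" "b = b1 + f * b2" "a1 \<in> lin P fs" "b1 \<in> lin P fs"
    "a2 \<in> P" "b2 \<in> P" by auto
  then have "a + b = (a1 + b1) + f * (a2 + b2)" "a1 + b1 \<in> lin P fs" "a2 + b2 \<in> P"
    using Cons.IH by (auto simp: algebra_simps)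
  then show ?case unfolding lin.simps by blast
qed auto

lemma lin_mult: "a \<in> lin P fs \<Longrightarrow> c \<in> P \<Longrightarrow> c * a \<in> lin P fs"
proof (induction fs arbitrary: a)
  case (Cons f fs)
  then obtain a1 a2 where "a = a1 + f * a2" "a1 \<in> lin P fs" "a2 \<in> P" by auto
  then have "c * a = c * a1 + f * (c * a2)" "c * a1 \<in> lin P fs" "c * a2 \<in> P"
    using Cons by (auto simp: algebra_simps)
  then show ?case unfolding lin.simps by blast
qed auto

lemma lin_minus: "a \<in> lin P fs \<Longrightarrow> - a \<in> lin P fs"
  using lin_mult[of a fs "-1"] by simp

lemma lin_diff: "a \<in> lin P fs \<Longrightarrow> b \<in> lin P fs \<Longrightarrow> a - b \<in> lin P fs"
  using lin_add[of a fs "- b"] lin_minus[of b] by simp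

lemma lin_sum: "(\<And>i. i \<in> I \<Longrightarrow> a i \<in> lin P fs) \<Longrightarrow> sum a I \<in> lin P fs"
  by (induction I rule: infinite_finite_induct) (auto intro: lin_add)

lemma lin_Cons: "a \<in> lin P fs \<Longrightarrow> a \<in> lin P (f # fs)"
  unfolding lin.simps by (intro CollectI exI[of _ a] exI[of _ 0]) simp

lemma lin_gen: "f \<in> set fs \<Longrightarrow> f \<in> lin P fs"
proof (induction fs)
  case (Cons g fs)
  have "g = 0 + g * 1" by simp
  then have "g \<in> lin P (g # fs)" unfolding lin.simps using lin_zero one_closed by blast
  with Cons show ?case by (auto intro: lin_Cons simp del: lin.simps)
qed auto

lemma lin_least:
  "set fs \<subseteq> J \<Longrightarrow> 0 \<in> J \<Longrightarrow> (\<And>a b. a \<in> J \<Longrightarrow> b \<in> J \<Longrightarrow> a + b \<in> J) \<Longrightarrow>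
   (\<And>a c. a \<in> J \<Longrightarrow> c \<in> P \<Longrightarrow> c * a \<in> J) \<Longrightarrow> lin P fs \<subseteq> J"
  by (induction fs) (auto simp: mult.commute)

lemma lin_subset: "set fs \<subseteq> P \<Longrightarrow> lin P fs \<subseteq> P"
  by (rule lin_least) auto

lemma lin_mono: "set fs \<subseteq> lin P gs \<Longrightarrow> lin P fs \<subseteq> lin P gs"
  by (rule lin_least) (auto intro: lin_add lin_mult)

section \<open>Exactness of the Koszul complex\<close>

lemma koszul_in:
  "set fs \<subseteq> P \<Longrightarrow> (\<And>c. u c \<in> P) \<Longrightarrow> koszul fs u b \<in> P"
  by (induction fs arbitrary: u b) auto

lemma wedge_in:
  "set fs \<subseteq> P \<Longrightarrow> (\<And>c. u c \<in> P) \<Longrightarrow> wedge fs u b \<in> P"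
  by (induction fs arbitrary: u b) auto

lemma koszul_in_lin:
  assumes "(\<And>c. u c \<in> P)" shows "koszul fs u b \<in> lin P fs"
  using assms
proof (induction fs arbitrary: u b)
  case (Cons f fs)
  have "f * u (b + 1) \<in> lin P (f # fs)"
    using lin_mult[OF lin_gen[of f "f # fs"], of "u (b+1)"] Cons.prems by (simp add: mult.commute)
  moreover have "koszul fs (\<lambda>c. u (2 * c + 1)) (b div 2) \<in> lin P (f # fs)"
      "koszul fs (\<lambda>c. u (2 * c)) (b div 2) \<in> lin P (f # fs)"
    using Cons by (auto intro!: lin_Cons simp del: lin.simps)
  ultimately show ?case
    by (auto intro: lin_add lin_minus simp del: lin.simps)
qed auto

lemma koszul_surj_lin:
  assumes "\<And>b. u b \<in> lin P fs" "pure (length fs) 0 u"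
  shows "\<exists>w. (\<forall>b. w b \<in> P) \<and> pure (length fs) 1 w \<and> koszul fs w = u"
  using assms
proof (induction fs arbitrary: u)
  case Nil
  then show ?case by (intro exI[of _ "\<lambda>_. 0"]) (auto simp: pure_def)
next
  case (Cons f fs)
  \<comment> \<open>The coefficients are required to vanish off exterior degree 0. Without this
    clause the choice made below need not be pure.\<close>
  have "\<exists>a c. u (2 * b) = a + f * c \<and> a \<in> lin P fs \<and> c \<in> P \<and>
          (wt (length fs) b \<noteq> 0 \<longrightarrow> a = 0 \<and> c = 0)" for b
  proof (cases "wt (length fs) b = 0")
    case True
    then show ?thesis using Cons.prems(1)[of "2 * b"] by auto
  next
    case False
    then have "wt (length (f # fs)) (2 * b) \<noteq> 0" by simp
    then have "u (2 * b) = 0" using Cons.prems(2) unfolding pure_def by blast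
    then show ?thesis using False by (intro exI[of _ 0]) auto
  qed
  then obtain a c where ac: "\<And>b. u (2 * b) = a b + f * c b" "\<And>b. a b \<in> lin P fs" "\<And>b. c b \<in> P"
    "\<And>b. wt (length fs) b \<noteq> 0 \<Longrightarrow> a b = 0 \<and> c b = 0"
    by metis
  from ac have "\<exists>w. (\<forall>b. w b \<in> P) \<and> pure (length fs) 1 w \<and> koszul fs w = a"
    by (intro Cons.IH) (auto simp: pure_def)
  then obtain w where w: "\<And>b. w b \<in> P" "pure (length fs) 1 w" "koszul fs w = a" by blast
  define v where "v b = (if odd b then c (b div 2) else w (b div 2))" for b
  have v: "v (2 * b) = w b" "v (Suc (2 * b)) = c b" for b by (auto simp: v_def)
  have k0: "koszul fs c b = 0" for b
    by (rule koszul_eq_0) (use ac(4) in auto)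
  have "koszul (f # fs) v b = u b" for b
  proof (cases "odd b")
    case True
    then have "wt (length (f # fs)) b \<noteq> 0" by (auto simp: mod2_eq_if)
    then have "u b = 0" using Cons.prems(2) unfolding pure_def by blast
    then show ?thesis using True k0 by (simp add: v)
  next
    case False
    then show ?thesis using w(3) ac(1)[of "b div 2"] by (simp add: v) (simp add: v_def)
  qed
  moreover have "pure (length (f # fs)) 1 v"
    using w(2) ac(4) unfolding pure_def v_def by (auto simp: mod2_eq_if)
  moreover have "v b \<in> P" for b using w(1) ac(3) by (simp add: v_def)
  ultimately show ?case by blast
qed

text \<open>The Koszul complex of \<open>f # fs\<close> is the mapping cone of multiplication by
  \<open>f\<close> on that of \<open>fs\<close>. Let \<open>u0\<close> and \<open>u1\<close> be the
  parts of a cycle without and with the head generator. Then \<open>u1\<close> is a cycle for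
  \<open>fs\<close>, hence the boundary of some \<open>w1\<close>; now \<open>u0\<close> plus
  \<open>f\<close> times \<open>w1\<close> is a cycle, hence the boundary of some \<open>w0\<close>;
  and \<open>w0\<close> and \<open>- w1\<close> are the two halves of a preimage of
  \<open>u\<close>.\<close>

lemma koszul_exact:
  assumes "reg P fs" "set fs \<subseteq> P" "\<And>b. u b \<in> P" "pure (length fs) (Suc e) u" "\<And>b. koszul fs u b = 0"
  shows "\<exists>w. (\<forall>b. w b \<in> P) \<and> pure (length fs) (Suc (Suc e)) w \<and> koszul fs w = u"
  using assms
proof (induction fs arbitrary: u e)
  case Nil
  then show ?case by (intro exI[of _ "\<lambda>_. 0"]) (auto simp: pure_def)
next
  case (Cons f fs)
  define u0 where "u0 b = u (2 * b)" for b
  define u1 where "u1 b = u (Suc (2 * b))" for b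
  have u0P: "u0 b \<in> P" and u1P: "u1 b \<in> P" for b using Cons.prems(3) by (auto simp: u0_def u1_def)
  have fP: "f \<in> P" using Cons.prems(2) by auto
  have p0: "pure (length fs) (Suc e) u0"
    unfolding pure_def u0_def
  proof (intro allI impI)
    fix b assume "wt (length fs) b \<noteq> Suc e"
    then have "wt (length (f # fs)) (2 * b) \<noteq> Suc e" by simp
    then show "u (2 * b) = 0" using Cons.prems(4) unfolding pure_def by blast
  qed
  have p1: "pure (length fs) e u1"
    unfolding pure_def u1_def
  proof (intro allI impI)
    fix b assume "wt (length fs) b \<noteq> e"
    then have "wt (length (f # fs)) (Suc (2 * b)) \<noteq> Suc e" by simp
    then show "u (Suc (2 * b)) = 0" using Cons.prems(4) unfolding pure_def by blast
  qed
  have c1: "koszul fs u1 b = 0" for b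
    using Cons.prems(5)[of "Suc (2 * b)"] by (simp add: u1_def[abs_def])
  have c0: "koszul fs u0 b + f * u1 b = 0" for b
    using Cons.prems(5)[of "2 * b"] by (simp add: u0_def[abs_def] u1_def)
  \<comment> \<open>In exterior degree 0 the cycle condition on \<open>u1\<close> is void. Instead,
    \<open>f\<close> times \<open>u1\<close> is minus a boundary, hence in the ideal of
    \<open>fs\<close>, and regularity allows \<open>f\<close> to be cancelled.\<close>
  have "\<exists>w. (\<forall>b. w b \<in> P) \<and> pure (length fs) (Suc e) w \<and> koszul fs w = u1"
  proof (cases e)
    case 0
    have "f * u1 b \<in> lin P fs" for b
      using lin_minus[OF koszul_in_lin[of u0 fs b]] u0P c0[of b]
      by (metis add.commute eq_neg_iff_add_eq_0)
    then have "u1 b \<in> lin P fs" for b using Cons.prems(1) u1P by auto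
    with koszul_surj_lin[of u1 fs] p1 0 show ?thesis by simp
  next
    case (Suc e')
    then show ?thesis using Cons.IH[of u1 e'] Cons.prems p1 c1 u1P by auto
  qed
  then obtain w1 where w1: "\<And>b. w1 b \<in> P" "pure (length fs) (Suc e) w1" "koszul fs w1 = u1" by blast
  have "koszul fs (\<lambda>b. u0 b + f * w1 b) b = 0" for b
    using c0 w1(3) by (simp add: koszul_add koszul_scale)
  moreover have "pure (length fs) (Suc e) (\<lambda>b. u0 b + f * w1 b)"
    using p0 w1(2) by (auto simp: pure_def)
  ultimately have "\<exists>w. (\<forall>b. w b \<in> P) \<and> pure (length fs) (Suc (Suc e)) w \<and> koszul fs w = (\<lambda>b. u0 b + f * w1 b)"
    using Cons.prems u0P w1(1) fP by (intro Cons.IH) auto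
  then obtain w0 where w0: "\<And>b. w0 b \<in> P" "pure (length fs) (Suc (Suc e)) w0"
      "koszul fs w0 = (\<lambda>b. u0 b + f * w1 b)"
    by blast
  define w where "w b = (if odd b then - w1 (b div 2) else w0 (b div 2))" for b
  have w: "w (2 * b) = w0 b" "w (Suc (2 * b)) = - w1 b" for b by (auto simp: w_def)
  have "koszul (f # fs) w b = u b" for b
  proof (cases "odd b")
    case True
    then show ?thesis using w1(3) by (simp add: w koszul_minus u1_def odd_div_2_eq)
  next
    case False
    then show ?thesis using w0(3) by (simp add: w koszul_minus u0_def) (simp add: w_def)
  qed
  moreover have "pure (length (f # fs)) (Suc (Suc e)) w"
    using w0(2) w1(2) unfolding pure_def w_def by (auto simp: mod2_eq_if)
  moreover have "w b \<in> P" for b using w0(1) w1(1) by (simp add: w_def)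
  ultimately show ?case by blast
qed

end

context subring_of begin

lemma koszul_lin:
  "set fs \<subseteq> P \<Longrightarrow> (\<And>c. u c \<in> lin P xs) \<Longrightarrow> koszul fs u b \<in> lin P xs"
  by (induction fs arbitrary: u b) (auto intro!: lin_add lin_minus lin_mult)

lemma wedge_lin:
  "set fs \<subseteq> P \<Longrightarrow> (\<And>c. u c \<in> lin P xs) \<Longrightarrow> wedge fs u b \<in> lin P xs"
  by (induction fs arbitrary: u b) (auto intro!: lin_diff lin_mult)

lemma wedge_in_lin:
  assumes "set fs \<subseteq> lin P xs" "\<And>c. u c \<in> P" shows "wedge fs u b \<in> lin P xs"
  using assms
proof (induction fs arbitrary: u b)
  case (Cons f fs)
  have "f * u (b - 1) \<in> lin P xs" using Cons.prems lin_mult[of f xs "u (b - 1)"] by (simp add: mult.commute)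
  with Cons show ?case by (auto intro: lin_diff)
qed auto

end

text \<open>
  The component of \<open>\<phi>\<close> with index p is the coefficient of the p-th generator of the periodic resolution in
  which multiplication by X 0, X 1, X 0, \<dots> alternate; p = 2 q stands for the divided power of exponent q of
  the Tate variable.
\<close>

locale tate = subring_of P for P :: "'r::comm_ring_1 set" +
  fixes fs gs :: "'r list" and X :: "nat \<Rightarrow> 'r"
  assumes reg_fs: "reg P fs" and fs_P: "set fs \<subseteq> P" and gs_P: "set gs \<subseteq> P"
    and length_gs: "length gs = length fs" and X_P: "X p \<in> P"
    and X_period: "X (Suc (Suc p)) = X p"
    and X_X: "X p * X (Suc p) = (\<Sum>(f, g)\<leftarrow>zip fs gs. f * g)"
    and X_exact: "a \<in> P \<Longrightarrow> X p * a \<in> lin P fs \<Longrightarrow> \<exists>l\<in>P. a - X (Suc p) * l \<in> lin P fs"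
begin

abbreviation "n \<equiv> length fs"

text \<open>Multiplication by the alternating \<open>X\<close> leads from index p + 1 to p, but over
  P its square is \<open>X p * X (Suc p)\<close>, which vanishes only modulo the ideal of
  \<open>fs\<close>. The term with \<open>wedge gs\<close>, leading from p + 2 to p, repairs this:
  its anticommutator with contraction is the same product, by \<open>koszul_wedge\<close> and
  \<open>X_X\<close>. The sign makes multiplication by \<open>X\<close> anticommute with the other
  two operators.\<close>

definition dif :: "(nat \<Rightarrow> nat \<Rightarrow> 'r) \<Rightarrow> nat \<Rightarrow> nat \<Rightarrow> 'r" where
  "dif \<phi> p b = koszul fs (\<phi> p) b + (-1) ^ wt n b * (X p * \<phi> (Suc p) b) - wedge gs (\<phi> (Suc (Suc p))) b"

definition bipure :: "nat \<Rightarrow> (nat \<Rightarrow> nat \<Rightarrow> 'r) \<Rightarrow> bool" where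
  "bipure e \<phi> \<longleftrightarrow> (\<forall>p b. wt n b + p \<noteq> e \<longrightarrow> \<phi> p b = 0)"

lemma dif_add: "dif (\<lambda>p b. \<phi> p b + \<psi> p b) p b = dif \<phi> p b + dif \<psi> p b"
  by (simp add: dif_def koszul_add wedge_add algebra_simps)

lemma dif_scale: "dif (\<lambda>p b. c * \<phi> p b) p b = c * dif \<phi> p b"
  by (simp add: dif_def koszul_scale wedge_scale algebra_simps)

lemma dif_diff: "dif (\<lambda>p b. \<phi> p b - \<psi> p b) p b = dif \<phi> p b - dif \<psi> p b"
  by (simp add: dif_def koszul_diff wedge_diff algebra_simps)

lemma dif_dif: "dif (dif \<phi>) p b = 0"
proof -
  have ws: "wedge gs (\<lambda>c. (-1) ^ wt n c * u c) b = - ((-1) ^ wt n b * wedge gs u b)" for u b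
    using wedge_sign[of gs u b] by (simp add: length_gs)
  have kw: "koszul fs (wedge gs u) b + wedge gs (koszul fs u) b = X p * X (Suc p) * u b" for u b p
    by (subst X_X) (rule koszul_wedge[OF length_gs])
  have s: "(-1) ^ wt n b * ((-1) ^ wt n b * y) = y" for y :: 'r
    by (metis left_minus_one_mult_self)
  have "dif (dif \<phi>) p b =
     (- ((-1) ^ wt n b * (X p * koszul fs (\<phi> (Suc p)) b)) - koszul fs (wedge gs (\<phi> (Suc (Suc p)))) b)
     + (-1) ^ wt n b * (X p * (koszul fs (\<phi> (Suc p)) b
         + (-1) ^ wt n b * (X (Suc p) * \<phi> (Suc (Suc p)) b) - wedge gs (\<phi> (Suc (Suc (Suc p)))) b))
     - (wedge gs (koszul fs (\<phi> (Suc (Suc p)))) b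
        - (-1) ^ wt n b * (X p * wedge gs (\<phi> (Suc (Suc (Suc p)))) b))"
    unfolding dif_def[abs_def]
    by (simp add: koszul_add koszul_diff koszul_koszul koszul_sign koszul_scale wedge_add wedge_diff wedge_wedge ws wedge_scale X_period)
  also have "\<dots> = (-1) ^ wt n b * ((-1) ^ wt n b * (X p * X (Suc p) * \<phi> (Suc (Suc p)) b))
      - (koszul fs (wedge gs (\<phi> (Suc (Suc p)))) b + wedge gs (koszul fs (\<phi> (Suc (Suc p)))) b)"
    by (simp add: algebra_simps)
  also have "\<dots> = 0"
    by (simp add: s kw[of _ _ p])
  finally show ?thesis .
qed

lemma dif_P: "(\<And>p b. \<phi> p b \<in> P) \<Longrightarrow> dif \<phi> p b \<in> P"
  unfolding dif_def using fs_P gs_P X_P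
  by (cases "even (wt n b)") (auto intro!: diff_closed add_closed koszul_in wedge_in)

lemma dif_bipure:
  assumes "bipure (Suc e) \<phi>" shows "bipure e (dif \<phi>)"
  unfolding bipure_def
proof (intro allI impI)
  fix p b assume *: "wt n b + p \<noteq> e"
  have z: "\<phi> q c = 0" if "wt n c + q \<noteq> Suc e" for q c
    using assms that by (auto simp: bipure_def)
  have "koszul fs (\<phi> p) b = 0" by (rule koszul_eq_0) (use * in \<open>auto intro!: z\<close>)
  moreover have "wedge gs (\<phi> (Suc (Suc p))) b = 0"
    by (rule wedge_eq_0) (use * in \<open>auto intro!: z simp: length_gs\<close>)
  moreover have "\<phi> (Suc p) b = 0" using * by (auto intro!: z)
  ultimately show "dif \<phi> p b = 0" by (simp add: dif_def)
qed

lemma dif_lin: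
  assumes "\<And>p b. \<phi> p b \<in> lin P xs" shows "dif \<phi> p b \<in> lin P xs"
proof -
  have "X p * \<phi> (Suc p) b \<in> lin P xs" using assms X_P by (auto intro: lin_mult)
  then have "(-1) ^ wt n b * (X p * \<phi> (Suc p) b) \<in> lin P xs"
    by (cases "even (wt n b)") (auto intro: lin_minus)
  then show ?thesis unfolding dif_def using assms fs_P gs_P
    by (auto intro!: lin_add lin_diff koszul_lin wedge_lin)
qed

text \<open>The complex is filtered by the index p, and the induction is on a bound \<open>q\<close>
  for the indices that occur. The top component of a cycle is a Koszul cycle. A boundary with the
  same top component is subtracted, which produces only terms of smaller index.\<close>

lemma tate_exact_aux:
  assumes "\<And>p b. \<phi> p b \<in> P" "bipure (Suc e) \<phi>" "\<And>p b. dif \<phi> p b = 0" "\<And>p b. p \<ge> q \<Longrightarrow> \<phi> p b = 0"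
  shows "\<exists>\<psi>. (\<forall>p b. \<psi> p b \<in> P) \<and> bipure (Suc (Suc e)) \<psi> \<and> (\<forall>p b. dif \<psi> p b = \<phi> p b)"
  using assms
proof (induction q arbitrary: \<phi>)
  case 0
  then show ?case by (intro exI[of _ "\<lambda>_ _. 0"]) (auto simp: bipure_def)
next
  case (Suc q)
  have z: "\<phi> r c = 0" if "wt n c + r \<noteq> Suc e" for r c
    using Suc.prems(2) that by (auto simp: bipure_def)
  show ?case
  proof (cases "q \<le> Suc e")
    case False
    then have "\<phi> p b = 0" if "p \<ge> q" for p b
      using that by (intro z) auto
    with Suc.IH Suc.prems show ?thesis by blast
  next
    case True
    have kq: "koszul fs (\<phi> q) b = 0" for b
    proof -
      have "\<phi> (Suc q) = (\<lambda>_. 0)" "\<phi> (Suc (Suc q)) = (\<lambda>_. 0)" using Suc.prems(4) by auto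
      then show ?thesis using Suc.prems(3)[of q b] by (simp add: dif_def)
    qed
    have pq: "pure n (Suc e - q) (\<phi> q)"
      unfolding pure_def using True by (auto intro!: z)
    have "\<exists>m l. (\<forall>b. m b \<in> P) \<and> (\<forall>b. l b \<in> P) \<and> pure n (Suc (Suc e) - q) m \<and> pure n (Suc e - q) l
        \<and> (\<forall>b. koszul fs l b = 0) \<and> (\<forall>b. koszul fs m b + (-1) ^ wt n b * (X q * l b) = \<phi> q b)"
    proof (cases "q = Suc e")
      case q: False
      then obtain i where i: "Suc e - q = Suc i" using True by (metis Suc_diff_Suc le_neq_implies_less)
      obtain w where "\<forall>b. w b \<in> P" "pure n (Suc (Suc i)) w" "koszul fs w = \<phi> q"
        using koszul_exact[OF reg_fs fs_P, of "\<phi> q" i] pq i kq Suc.prems(1) by auto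
      moreover have "Suc (Suc e) - q = Suc (Suc i)" using i by auto
      ultimately show ?thesis by (intro exI[of _ w] exI[of _ "\<lambda>_. 0"]) (auto simp: pure_def)
    next
      case q: True
      \<comment> \<open>Here the top component has exterior degree 0, where the Koszul complex is
        not exact. The component of \<open>dif \<phi> = 0\<close> one index lower says that
        \<open>X e\<close> times the top component lies in the ideal of \<open>fs\<close>, so modulo
        this ideal it is a multiple of \<open>X (Suc e)\<close>, because the annihilators of x and y
        are generated by each other.\<close>
      have "\<exists>l. l \<in> P \<and> \<phi> q b - X q * l \<in> lin P fs \<and> (wt n b \<noteq> 0 \<longrightarrow> l = 0)" for b
      proof (cases "wt n b = 0")
        case True
        have "dif \<phi> e b = 0" by fact
        moreover have "\<phi> (Suc (Suc e)) = (\<lambda>_. 0)" using Suc.prems(4) q by auto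
        ultimately have "koszul fs (\<phi> e) b + X e * \<phi> q b = 0"
          using True q by (simp add: dif_def)
        moreover have "koszul fs (\<phi> e) b \<in> lin P fs" using Suc.prems(1) by (intro koszul_in_lin)
        ultimately have "X e * \<phi> q b \<in> lin P fs"
          by (metis lin_minus add.commute eq_neg_iff_add_eq_0)
        then obtain l where "l \<in> P" "\<phi> q b - X (Suc e) * l \<in> lin P fs"
          using X_exact Suc.prems(1) by blast
        then show ?thesis using q True by auto
      next
        case False
        then show ?thesis using q z[of b q] by (intro exI[of _ 0]) auto
      qed
      then obtain l where l: "\<And>b. l b \<in> P" "\<And>b. \<phi> q b - X q * l b \<in> lin P fs"
         "\<And>b. wt n b \<noteq> 0 \<Longrightarrow> l b = 0" by metis
      have "pure n 0 (\<lambda>b. \<phi> q b - X q * l b)"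
        using pq l(3) q by (auto simp: pure_def)
      from koszul_surj_lin[OF l(2) this] obtain m where m: "\<forall>b. m b \<in> P" "pure n 1 m"
         "koszul fs m = (\<lambda>b. \<phi> q b - X q * l b)" by blast
      have "(-1) ^ wt n b * (X q * l b) = X q * l b" for b
        using l(3)[of b] by (cases "wt n b = 0") auto
      moreover have "koszul fs l b = 0" for b
        by (rule koszul_eq_0) (auto intro: l(3))
      ultimately show ?thesis using m l q by (intro exI[of _ m] exI[of _ l]) (auto simp: pure_def)
    qed
    then obtain m l where ml: "\<And>b. m b \<in> P" "\<And>b. l b \<in> P" "pure n (Suc (Suc e) - q) m" "pure n (Suc e - q) l"
        "\<And>b. koszul fs l b = 0" "\<And>b. koszul fs m b + (-1) ^ wt n b * (X q * l b) = \<phi> q b"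
      by metis
    \<comment> \<open>With \<open>m\<close> at index \<open>q\<close> and \<open>l\<close> at the
      next one, \<open>dif \<psi>\<close> agrees with \<open>\<phi>\<close> at \<open>q\<close> and
      vanishes above, since \<open>l\<close> is a Koszul cycle. What it adds below \<open>q\<close>
      is left to the induction hypothesis.\<close>
    define \<psi> where "\<psi> p = (if p = q then m else if p = Suc q then l else (\<lambda>_. 0))" for p
    have \<psi>P: "\<psi> p b \<in> P" for p b using ml by (auto simp: \<psi>_def)
    have \<psi>pure: "bipure (Suc (Suc e)) \<psi>"
      unfolding bipure_def
    proof (intro allI impI)
      fix p b assume *: "wt n b + p \<noteq> Suc (Suc e)"
      have "m b = 0" if "p = q"
      proof -
        have "wt n b \<noteq> Suc (Suc e) - q" using * that True by arith
        then show ?thesis using ml(3) unfolding pure_def by blast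
      qed
      moreover have "l b = 0" if "p = Suc q"
      proof -
        have "wt n b \<noteq> Suc e - q" using * that True by arith
        then show ?thesis using ml(4) unfolding pure_def by blast
      qed
      ultimately show "\<psi> p b = 0" by (auto simp: \<psi>_def)
    qed
    have d: "dif \<psi> p b = (if p = q then \<phi> q b else 0)" if "p \<ge> q" for p b
      using that ml(5,6) unfolding dif_def \<psi>_def by auto
    define \<phi>' where "\<phi>' p b = \<phi> p b - dif \<psi> p b" for p b
    have "\<exists>\<psi>. (\<forall>p b. \<psi> p b \<in> P) \<and> bipure (Suc (Suc e)) \<psi> \<and> (\<forall>p b. dif \<psi> p b = \<phi>' p b)"
    proof (rule Suc.IH)
      show "\<phi>' p b \<in> P" for p b using Suc.prems(1) \<psi>P by (auto simp: \<phi>'_def dif_P)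
      show "bipure (Suc e) \<phi>'"
        using dif_bipure[OF \<psi>pure] Suc.prems(2) by (auto simp: bipure_def \<phi>'_def)
      show "dif \<phi>' p b = 0" for p b
        unfolding \<phi>'_def[abs_def] by (simp add: dif_diff dif_dif Suc.prems(3))
      show "\<phi>' p b = 0" if "q \<le> p" for p b
        using that d[of p b] Suc.prems(4)[of p b] by (auto simp: \<phi>'_def)
    qed
    then obtain \<psi>' where \<psi>': "\<And>p b. \<psi>' p b \<in> P" "bipure (Suc (Suc e)) \<psi>'" "\<And>p b. dif \<psi>' p b = \<phi>' p b"
      by blast
    have "dif (\<lambda>p b. \<psi> p b + \<psi>' p b) p b = \<phi> p b" for p b
      by (simp add: dif_add \<psi>'(3) \<phi>'_def)
    moreover have "bipure (Suc (Suc e)) (\<lambda>p b. \<psi> p b + \<psi>' p b)"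
      using \<psi>pure \<psi>'(2) by (auto simp: bipure_def)
    ultimately show ?thesis using \<psi>P \<psi>'(1) by (intro exI[of _ "\<lambda>p b. \<psi> p b + \<psi>' p b"]) auto
  qed
qed

lemma tate_exact:
  assumes "\<And>p b. \<phi> p b \<in> P" "bipure (Suc e) \<phi>" "\<And>p b. dif \<phi> p b = 0"
  shows "\<exists>\<psi>. (\<forall>p b. \<psi> p b \<in> P) \<and> bipure (Suc (Suc e)) \<psi> \<and> (\<forall>p b. dif \<psi> p b = \<phi> p b)"
  by (rule tate_exact_aux[where q = "Suc (Suc e)", OF assms]) (use assms(2) in \<open>auto simp: bipure_def\<close>)

text \<open>Each killed element costs one degree, as in the long exact sequence of multiplication by
  \<open>x\<close>. If \<open>\<phi>\<close> is a cycle modulo \<open>x # xs\<close>, its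
  differential is \<open>x\<close> times some \<open>w\<close> modulo \<open>xs\<close>, and
  \<open>w\<close> is a cycle modulo \<open>xs\<close> because \<open>x\<close> is a nonzerodivisor
  there. Writing \<open>w\<close> as a boundary of \<open>\<psi>1\<close>, the difference of
  \<open>\<phi>\<close> and \<open>x\<close> times \<open>\<psi>1\<close> is a cycle modulo
  \<open>xs\<close>. Since \<open>w\<close> lives one degree below \<open>\<phi>\<close>, exactness
  is used in two consecutive degrees.\<close>

lemma tate_exact_mod:
  assumes "reg P xs" "set xs \<subseteq> P" "\<And>p b. \<phi> p b \<in> P" "bipure (Suc (length xs + e)) \<phi>"
    "\<And>p b. dif \<phi> p b \<in> lin P xs"
  shows "\<exists>\<psi>. (\<forall>p b. \<psi> p b \<in> P) \<and> bipure (Suc (Suc (length xs + e))) \<psi>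
    \<and> (\<forall>p b. \<phi> p b - dif \<psi> p b \<in> lin P xs)"
  using assms
proof (induction xs arbitrary: e \<phi>)
  case Nil
  then have "bipure (Suc e) \<phi>" "dif \<phi> p b = 0" for p b by simp_all
  from tate_exact[OF Nil(3) this] obtain \<psi> where
    "\<forall>p b. \<psi> p b \<in> P" "bipure (Suc (Suc e)) \<psi>" "\<forall>p b. dif \<psi> p b = \<phi> p b" by blast
  then show ?case by (intro exI[of _ \<psi>]) simp
next
  case (Cons x xs)
  have xP: "x \<in> P" and xs: "reg P xs" "set xs \<subseteq> P" using Cons.prems by auto
  have dpure: "bipure (Suc (length xs + e)) (dif \<phi>)"
    using dif_bipure Cons.prems(4) by simp
  have "\<exists>a w. dif \<phi> p b = a + x * w \<and> a \<in> lin P xs \<and> w \<in> P \<and>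
     (wt n b + p \<noteq> Suc (length xs + e) \<longrightarrow> w = 0)" for p b
  proof (cases "wt n b + p = Suc (length xs + e)")
    case True
    then show ?thesis using Cons.prems(5)[of p b] by auto
  next
    case False
    then have "dif \<phi> p b = 0" using dpure by (auto simp: bipure_def)
    then show ?thesis by (intro exI[of _ 0]) auto
  qed
  then obtain a w where aw: "\<And>p b. dif \<phi> p b = a p b + x * w p b" "\<And>p b. a p b \<in> lin P xs"
      "\<And>p b. w p b \<in> P" "\<And>p b. wt n b + p \<noteq> Suc (length xs + e) \<Longrightarrow> w p b = 0"
    by metis
  have dw: "dif w p b \<in> lin P xs" for p b
  proof -
    have "dif \<phi> = (\<lambda>p b. a p b + x * w p b)" using aw(1) by auto
    then have "0 = dif a p b + x * dif w p b"
      using dif_dif[of \<phi> p b] by (simp add: dif_add dif_scale)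
    then have "x * dif w p b = - dif a p b" by (simp add: eq_neg_iff_add_eq_0 add.commute)
    also have "\<dots> \<in> lin P xs" using aw(2) by (intro lin_minus dif_lin)
    finally show ?thesis using Cons.prems(1) dif_P[of w] aw(3) by auto
  qed
  obtain \<psi>1 where p1: "\<And>p b. \<psi>1 p b \<in> P" "bipure (Suc (Suc (length xs + e))) \<psi>1"
     "\<And>p b. w p b - dif \<psi>1 p b \<in> lin P xs"
    using Cons.IH[OF xs, of w e] aw(3,4) dw by (auto simp: bipure_def)
  define \<phi>' where "\<phi>' p b = \<phi> p b - x * \<psi>1 p b" for p b
  have "dif \<phi>' p b = a p b + x * (w p b - dif \<psi>1 p b)" for p b
    unfolding \<phi>'_def[abs_def] by (simp add: dif_diff dif_scale aw(1) algebra_simps)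
  then have d': "dif \<phi>' p b \<in> lin P xs" for p b
    using aw(2) p1(3) xP by (auto intro!: lin_add lin_mult)
  have "\<phi>' p b \<in> P" for p b using p1(1) xP Cons.prems(3) by (auto simp: \<phi>'_def)
  moreover have "bipure (Suc (length xs + Suc e)) \<phi>'"
    using p1(2) Cons.prems(4) by (auto simp: \<phi>'_def bipure_def)
  ultimately obtain \<psi>2 where p2: "\<And>p b. \<psi>2 p b \<in> P" "bipure (Suc (Suc (length xs + Suc e))) \<psi>2"
     "\<And>p b. \<phi>' p b - dif \<psi>2 p b \<in> lin P xs"
    using Cons.IH[OF xs, of \<phi>' "Suc e"] d' by auto
  have "\<phi> p b - dif \<psi>2 p b = (\<phi>' p b - dif \<psi>2 p b) + x * \<psi>1 p b" for p b
    by (simp add: \<phi>'_def)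
  then have "\<phi> p b - dif \<psi>2 p b \<in> lin P (x # xs)" for p b
    using p1(1) p2(3) unfolding lin.simps by blast
  moreover have "bipure (Suc (Suc (length (x # xs) + e))) \<psi>2" using p2(2) by simp
  ultimately show ?case using p2(1) by blast
qed

lemma dif_in_lin:
  assumes "set fs \<subseteq> lin P xs" "set gs \<subseteq> lin P xs" "\<And>p. X p \<in> lin P xs" "\<And>p b. \<phi> p b \<in> P"
  shows "dif \<phi> p b \<in> lin P xs"
proof -
  have "\<phi> (Suc p) b * X p \<in> lin P xs" using assms by (intro lin_mult)
  then have "(-1) ^ wt n b * (X p * \<phi> (Suc p) b) \<in> lin P xs"
    by (cases "even (wt n b)") (auto intro: lin_minus simp: mult.commute)
  moreover have "koszul fs (\<phi> p) b \<in> lin P xs"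
    using koszul_in_lin[of "\<phi> p" fs b] lin_mono[OF assms(1)] assms(4) by blast
  ultimately show ?thesis unfolding dif_def using assms
    by (auto intro!: lin_add lin_diff wedge_in_lin)
qed

text \<open>The complex would be an infinite minimal free resolution over a ring of finite global dimension.\<close>

theorem tate_not_minimal:
  assumes "reg P xs" "set xs \<subseteq> P" "1 \<notin> lin P xs"
    and "set fs \<subseteq> lin P xs" "set gs \<subseteq> lin P xs" "\<And>p. X p \<in> lin P xs"
  shows False
proof -
  have w0: "wt k 0 = 0" for k by (induction k) auto
  \<comment> \<open>A basis element in total degree \<open>Suc (length xs)\<close>, the first one in
    which exactness modulo \<open>xs\<close> is known. It is a cycle modulo \<open>xs\<close>
    because every differential lies in the ideal of \<open>xs\<close>; as a boundary it would itself
    lie there, and so would 1.\<close>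
  define \<phi> :: "nat \<Rightarrow> nat \<Rightarrow> 'r" where "\<phi> p b = (if p = Suc (length xs) \<and> b = 0 then 1 else 0)" for p b
  have \<phi>P: "\<phi> p b \<in> P" for p b by (simp add: \<phi>_def)
  note d = dif_in_lin[OF assms(4-6)]
  have "bipure (Suc (length xs + 0)) \<phi>" by (auto simp: bipure_def \<phi>_def w0)
  then obtain \<psi> where "\<And>p b. \<psi> p b \<in> P" "\<And>p b. \<phi> p b - dif \<psi> p b \<in> lin P xs"
    using tate_exact_mod[OF assms(1,2), of \<phi> 0] \<phi>P d[of \<phi>] by blast
  then have "(\<phi> p b - dif \<psi> p b) + dif \<psi> p b \<in> lin P xs" for p b
    using d by (intro lin_add) auto
  from this[of "Suc (length xs)" 0] assms(3) show False by (simp add: \<phi>_def)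
qed

end

section \<open>Exact zero-divisors in quotient rings\<close>

lemma FactRing_zero: "\<zero>\<^bsub>R Quot I\<^esub> = I"
  by (simp add: FactRing_def)

lemma FactRing_carrier: "carrier (R Quot I) = a_r_coset R I ` carrier R"
  unfolding FactRing_def A_RCOSETS_def' by auto

text \<open>An isomorphism from (0 : x) to R/(x) shows that (0 : x) is generated by the preimage y
  of the class of 1 and that the annihilator of y is (x). Conversely, if the annihilator of y is
  (x), then sending r y to the class of r is well defined and bijective on (y).\<close>

lemma (in cring) exact_zero_divisor_iff:
  "exact_zero_divisor R x \<longleftrightarrow> x \<in> carrier R \<and> x \<noteq> \<zero> \<and>
     (\<exists>y\<in>carrier R. y \<noteq> \<zero> \<and> annihilator R x = PIdl y \<and> annihilator R y = PIdl x)"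
  (is "?l \<longleftrightarrow> ?r")
proof
  assume l: ?l
  then have x: "x \<in> carrier R" and ann: "annihilator R x \<noteq> carrier R"
    and quot: "carrier (R Quot PIdl x) \<noteq> {\<zero>\<^bsub>R Quot PIdl x\<^esub>}"
    by (auto simp: exact_zero_divisor_def)
  interpret I: ideal "PIdl x" R using x by (rule cgenideal_ideal)
  interpret Q: cring "R Quot PIdl x" by (rule I.quotient_is_cring) (rule is_cring)
  interpret h: ring_hom_cring R "R Quot PIdl x" "(+>) (PIdl x)"
    by (rule I.rcos_ring_hom_cring) (rule is_cring)
  obtain \<phi> where bij: "bij_betw \<phi> (annihilator R x) (carrier (R Quot PIdl x))"
    and add: "\<forall>a\<in>annihilator R x. \<forall>b\<in>annihilator R x. \<phi> (a \<oplus> b) = \<phi> a \<oplus>\<^bsub>R Quot PIdl x\<^esub> \<phi> b"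
    and scale: "\<forall>r\<in>carrier R. \<forall>a\<in>annihilator R x. \<phi> (r \<otimes> a) = (PIdl x +> r) \<otimes>\<^bsub>R Quot PIdl x\<^esub> \<phi> a"
    using l by (auto simp: exact_zero_divisor_def)
  have "\<one>\<^bsub>R Quot PIdl x\<^esub> \<in> \<phi> ` annihilator R x" using bij by (simp add: bij_betw_def)
  then obtain y where y: "y \<in> annihilator R x" "\<phi> y = \<one>\<^bsub>R Quot PIdl x\<^esub>" by auto
  have yc: "y \<in> carrier R" "y \<otimes> x = \<zero>" using y by (auto simp: annihilator_def)
  have ry: "r \<otimes> y \<in> annihilator R x" if "r \<in> carrier R" for r
    using that yc x by (simp add: annihilator_def m_assoc)
  have phi_ry: "\<phi> (r \<otimes> y) = PIdl x +> r" if "r \<in> carrier R" for r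
    using scale[rule_format, OF that y(1)] y(2) h.hom_closed[OF that] by simp
  have inj: "a = b" if "a \<in> annihilator R x" "b \<in> annihilator R x" "\<phi> a = \<phi> b" for a b
    using inj_onD[OF bij_betw_imp_inj_on[OF bij]] that by blast
  have surj: "\<exists>r\<in>carrier R. A = PIdl x +> r" if "A \<in> carrier (R Quot PIdl x)" for A
    using that unfolding FactRing_carrier by blast
  have 1: "annihilator R x = PIdl y"
  proof
    show "annihilator R x \<subseteq> PIdl y"
    proof
      fix a assume a: "a \<in> annihilator R x"
      then have "\<phi> a \<in> carrier (R Quot PIdl x)" using bij by (auto simp: bij_betw_def)
      then obtain r where r: "r \<in> carrier R" "\<phi> a = PIdl x +> r" using surj by blast
      have "a = r \<otimes> y" by (rule inj[OF a ry[OF r(1)] trans[OF r(2) phi_ry[OF r(1), symmetric]]])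
      with r(1) show "a \<in> PIdl y" unfolding cgenideal_def by blast
    qed
    show "PIdl y \<subseteq> annihilator R x" using ry unfolding cgenideal_def by blast
  qed
  have y0: "\<phi> \<zero> = \<zero>\<^bsub>R Quot PIdl x\<^esub>"
    using phi_ry[of \<zero>] yc h.hom_zero by simp
  have 2: "annihilator R y = PIdl x"
  proof
    show "annihilator R y \<subseteq> PIdl x"
    proof
      fix r assume "r \<in> annihilator R y"
      then have r: "r \<in> carrier R" "r \<otimes> y = \<zero>" by (auto simp: annihilator_def)
      then have "PIdl x +> r = \<zero>\<^bsub>R Quot PIdl x\<^esub>" using phi_ry y0 by metis
      then have "PIdl x +> r = PIdl x" unfolding FactRing_zero .
      then show "r \<in> PIdl x" using I.a_rcos_self r by metis
    qed
    show "PIdl x \<subseteq> annihilator R y"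
    proof -
      have "x \<otimes> y = \<zero>" using yc x m_comm by metis
      then have "(r \<otimes> x) \<otimes> y = \<zero>" if "r \<in> carrier R" for r
        using that x yc(1) by (simp add: m_assoc)
      then show ?thesis using x unfolding cgenideal_def annihilator_def by auto
    qed
  qed
  have "x \<noteq> \<zero>" using ann by (auto simp: annihilator_def)
  moreover have "y \<noteq> \<zero>"
  proof
    assume "y = \<zero>"
    then have "annihilator R x \<subseteq> {\<zero>}" unfolding 1 cgenideal_def by auto
    moreover have "y \<in> annihilator R x" by fact
    ultimately have "annihilator R x = {\<zero>}" by blast
    then have "carrier (R Quot PIdl x) = {\<phi> \<zero>}" using bij_betw_imp_surj_on[OF bij] by simp
    with quot y0 show False by simp
  qed
  ultimately show ?r using x yc 1 2 by blast
next
  assume r: ?r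
  then obtain y where x: "x \<in> carrier R" "x \<noteq> \<zero>" and y: "y \<in> carrier R" "y \<noteq> \<zero>"
    and 1: "annihilator R x = PIdl y" and 2: "annihilator R y = PIdl x" by blast
  interpret I: ideal "PIdl x" R using x(1) by (rule cgenideal_ideal)
  interpret Q: cring "R Quot PIdl x" by (rule I.quotient_is_cring) (rule is_cring)
  interpret h: ring_hom_cring R "R Quot PIdl x" "(+>) (PIdl x)"
    by (rule I.rcos_ring_hom_cring) (rule is_cring)
  \<comment> \<open>The choice of \<open>r\<close> is harmless: two choices differ by an element
    annihilating \<open>y\<close>, hence by an element of the ideal of \<open>x\<close>.\<close>
  define \<phi> where "\<phi> a = PIdl x +> (SOME r. r \<in> carrier R \<and> a = r \<otimes> y)" for a
  have eqI: "PIdl x +> r = PIdl x +> s" if "r \<in> carrier R" "s \<in> carrier R" "r \<ominus> s \<in> PIdl x" for r s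
    using quotient_eq_iff_same_a_r_cos[OF I.ideal_axioms that(1,2)] that(3) by blast
  have eqD: "r \<ominus> s \<in> PIdl x" if "r \<in> carrier R" "s \<in> carrier R" "PIdl x +> r = PIdl x +> s" for r s
    using quotient_eq_iff_same_a_r_cos[OF I.ideal_axioms that(1,2)] that(3) by blast
  have phi: "\<phi> (r \<otimes> y) = PIdl x +> r" if r: "r \<in> carrier R" for r
  proof -
    define s where "s = (SOME s. s \<in> carrier R \<and> r \<otimes> y = s \<otimes> y)"
    have "s \<in> carrier R \<and> r \<otimes> y = s \<otimes> y" unfolding s_def by (rule someI[of _ r]) (use r in auto)
    then have s: "s \<in> carrier R" "r \<otimes> y = s \<otimes> y" by auto
    then have "(s \<ominus> r) \<otimes> y = \<zero>" using r y by (simp add: a_minus_def l_distr l_minus r_neg)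
    then have "s \<ominus> r \<in> annihilator R y" using s r by (simp add: annihilator_def)
    then have "s \<ominus> r \<in> PIdl x" using 2 by simp
    then show ?thesis unfolding \<phi>_def s_def[symmetric] using eqI s r by blast
  qed
  have "bij_betw \<phi> (annihilator R x) (carrier (R Quot PIdl x))"
    unfolding bij_betw_def
  proof
    show "inj_on \<phi> (annihilator R x)"
    proof (rule inj_onI)
      fix a b assume ab: "a \<in> annihilator R x" "b \<in> annihilator R x" "\<phi> a = \<phi> b"
      then obtain r s where rs: "r \<in> carrier R" "s \<in> carrier R" "a = r \<otimes> y" "b = s \<otimes> y"
        unfolding 1 cgenideal_def by auto
      then have "r \<ominus> s \<in> PIdl x" using ab(3) phi eqD by metis
      then have "(r \<ominus> s) \<otimes> y = \<zero>" unfolding 2[symmetric] by (simp add: annihilator_def)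
      then show "a = b" using rs y by (simp add: a_minus_def l_distr l_minus minus_equality r_right_minus_eq)
          (metis a_minus_def m_closed r_right_minus_eq)
    qed
    show "\<phi> ` annihilator R x = carrier (R Quot PIdl x)"
    proof
      show "\<phi> ` annihilator R x \<subseteq> carrier (R Quot PIdl x)"
        unfolding 1 using phi h.hom_closed unfolding cgenideal_def by auto
      show "carrier (R Quot PIdl x) \<subseteq> \<phi> ` annihilator R x"
      proof
        fix A assume "A \<in> carrier (R Quot PIdl x)"
        then obtain r where "r \<in> carrier R" "A = PIdl x +> r" unfolding FactRing_carrier by blast
        then have "A = \<phi> (r \<otimes> y)" "r \<otimes> y \<in> annihilator R x"
            using phi unfolding 1 cgenideal_def by auto
        then show "A \<in> \<phi> ` annihilator R x" by blast
      qed
    qed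
  qed
  moreover have "\<phi> (a \<oplus> b) = \<phi> a \<oplus>\<^bsub>R Quot PIdl x\<^esub> \<phi> b"
    if ab: "a \<in> annihilator R x" "b \<in> annihilator R x" for a b
  proof -
    obtain r s where rs: "r \<in> carrier R" "s \<in> carrier R" "a = r \<otimes> y" "b = s \<otimes> y"
      using ab unfolding 1 cgenideal_def by auto
    then have "a \<oplus> b = (r \<oplus> s) \<otimes> y" using y by (simp add: l_distr)
    then show ?thesis using rs phi h.hom_add by simp
  qed
  moreover have "\<phi> (r \<otimes> a) = (PIdl x +> r) \<otimes>\<^bsub>R Quot PIdl x\<^esub> \<phi> a"
    if r: "r \<in> carrier R" and a: "a \<in> annihilator R x" for r a
  proof -
    obtain s where s: "s \<in> carrier R" "a = s \<otimes> y"
      using a unfolding 1 cgenideal_def by auto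
    then have "r \<otimes> a = (r \<otimes> s) \<otimes> y" using y r by (simp add: m_assoc)
    then show ?thesis using r s phi h.hom_mult by simp
  qed
  moreover have "annihilator R x \<noteq> carrier R"
  proof
    assume "annihilator R x = carrier R"
    then have "\<one> \<in> annihilator R x" by simp
    with x show False by (simp add: annihilator_def)
  qed
  moreover have "carrier (R Quot PIdl x) \<noteq> {\<zero>\<^bsub>R Quot PIdl x\<^esub>}"
  proof
    assume "carrier (R Quot PIdl x) = {\<zero>\<^bsub>R Quot PIdl x\<^esub>}"
    then have "PIdl x +> \<one> = PIdl x" using h.hom_closed[OF one_closed] unfolding FactRing_zero by blast
    then have "\<one> \<in> PIdl x" using I.a_rcos_self[OF one_closed] by simp
    then show False using y unfolding 2[symmetric] by (simp add: annihilator_def)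
  qed
  ultimately show ?l unfolding exact_zero_divisor_def using x(1) by blast
qed

text \<open>This pulls the criterion by pairs back to representatives, so that the arguments about A
  become membership statements in P and no cosets remain.\<close>

lemma exact_zero_divisor_coset_iff:
  fixes R (structure)
  assumes "cring R" "ideal I R" "X \<in> carrier R"
  shows "exact_zero_divisor (R Quot I) (I +> X) \<longleftrightarrow> X \<notin> I \<and>
    (\<exists>Y\<in>carrier R. Y \<notin> I \<and>
      (\<forall>a\<in>carrier R. a \<otimes> X \<in> I \<longleftrightarrow> (\<exists>l\<in>carrier R. a \<ominus> l \<otimes> Y \<in> I)) \<and>
      (\<forall>a\<in>carrier R. a \<otimes> Y \<in> I \<longleftrightarrow> (\<exists>l\<in>carrier R. a \<ominus> l \<otimes> X \<in> I)))"
proof -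
  interpret cring R by fact
  interpret I: ideal I R by fact
  interpret Q: cring "R Quot I" by (rule I.quotient_is_cring) (rule is_cring)
  interpret h: ring_hom_cring R "R Quot I" "(+>) I"
    by (rule I.rcos_ring_hom_cring) (rule is_cring)
  note carr = FactRing_carrier[of R I]
  have eq: "I +> r = I +> s \<longleftrightarrow> r \<ominus> s \<in> I" if "r \<in> carrier R" "s \<in> carrier R" for r s
    using quotient_eq_iff_same_a_r_cos[OF I.ideal_axioms that] by blast
  have zero: "I +> r = \<zero>\<^bsub>R Quot I\<^esub> \<longleftrightarrow> r \<in> I" if "r \<in> carrier R" for r
  proof -
    show ?thesis unfolding FactRing_zero using I.a_rcos_self[OF that] I.a_rcos_const[of r] by metis
  qed
  have ann: "annihilator (R Quot I) (I +> r) = cgenideal (R Quot I) (I +> s) \<longleftrightarrow>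
      (\<forall>a\<in>carrier R. a \<otimes> r \<in> I \<longleftrightarrow> (\<exists>l\<in>carrier R. a \<ominus> l \<otimes> s \<in> I))"
    if rs: "r \<in> carrier R" "s \<in> carrier R" for r s
  proof -
    have A: "I +> a \<in> annihilator (R Quot I) (I +> r) \<longleftrightarrow> a \<otimes> r \<in> I" if "a \<in> carrier R" for a
      using that rs zero[of "a \<otimes> r"] h.hom_mult[of a r] h.hom_closed[of a] by (simp add: annihilator_def)
    have B: "I +> a \<in> cgenideal (R Quot I) (I +> s) \<longleftrightarrow> (\<exists>l\<in>carrier R. a \<ominus> l \<otimes> s \<in> I)"
      if a: "a \<in> carrier R" for a
    proof -
      have "I +> a \<in> cgenideal (R Quot I) (I +> s) \<longleftrightarrow> (\<exists>l\<in>carrier R. I +> a = I +> (l \<otimes> s))"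
        unfolding cgenideal_def carr using h.hom_mult rs by auto
      also have "\<dots> \<longleftrightarrow> (\<exists>l\<in>carrier R. a \<ominus> l \<otimes> s \<in> I)"
        by (intro bex_cong refl eq) (use a rs in auto)
      finally show ?thesis .
    qed
    have sub: "annihilator (R Quot I) (I +> r) \<subseteq> carrier (R Quot I)"
        "cgenideal (R Quot I) (I +> s) \<subseteq> carrier (R Quot I)"
      using h.hom_closed rs by (auto simp: annihilator_def cgenideal_def)
    show ?thesis
    proof
      assume "annihilator (R Quot I) (I +> r) = cgenideal (R Quot I) (I +> s)"
      then show "\<forall>a\<in>carrier R. a \<otimes> r \<in> I \<longleftrightarrow> (\<exists>l\<in>carrier R. a \<ominus> l \<otimes> s \<in> I)"
        using A B by blast
    next
      assume *: "\<forall>a\<in>carrier R. a \<otimes> r \<in> I \<longleftrightarrow> (\<exists>l\<in>carrier R. a \<ominus> l \<otimes> s \<in> I)"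
      have "A \<in> annihilator (R Quot I) (I +> r) \<longleftrightarrow> A \<in> cgenideal (R Quot I) (I +> s)"
        if "A \<in> carrier (R Quot I)" for A
        using that A B * unfolding carr by blast
      then show "annihilator (R Quot I) (I +> r) = cgenideal (R Quot I) (I +> s)"
        using sub by blast
    qed
  qed
  show ?thesis
    unfolding Q.exact_zero_divisor_iff
    using assms(3) h.hom_closed[OF assms(3)] ann zero by (simp add: carr)
qed

section \<open>Polynomials graded by total degree\<close>

definition part :: "nat \<Rightarrow> 'k::zero mpoly \<Rightarrow> 'k mpoly" where
  "part d p = Abs_poly_mapping (\<lambda>m. Poly_Mapping.lookup p m when total_deg m = d)"

abbreviation const :: "'k::zero \<Rightarrow> 'k mpoly" where
  "const c \<equiv> Poly_Mapping.single 0 c"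

definition var :: "nat \<Rightarrow> 'k::comm_ring_1 mpoly" where
  "var i = Poly_Mapping.single (Poly_Mapping.single i 1) 1"

lemma total_deg_superset:
  assumes "finite A" "Poly_Mapping.keys m \<subseteq> A"
  shows "total_deg m = (\<Sum>i\<in>A. Poly_Mapping.lookup m i)"
  unfolding total_deg_def using assms
  by (intro sum.mono_neutral_left) (auto simp: in_keys_iff)

lemma total_deg_add: "total_deg (a + b) = total_deg a + total_deg b"
proof -
  let ?A = "Poly_Mapping.keys a \<union> Poly_Mapping.keys b"
  have "total_deg (a + b) = (\<Sum>i\<in>?A. Poly_Mapping.lookup (a + b) i)"
    by (rule total_deg_superset) (use keys_add[of a b] in auto)
  also have "\<dots> = (\<Sum>i\<in>?A. Poly_Mapping.lookup a i) + (\<Sum>i\<in>?A. Poly_Mapping.lookup b i)"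
    by (simp add: lookup_add sum.distrib)
  finally show ?thesis by (simp add: total_deg_superset[of ?A a] total_deg_superset[of ?A b])
qed

lemma total_deg_zero [simp]: "total_deg 0 = 0" by (simp add: total_deg_def)

lemma total_deg_eq_0_iff: "total_deg m = 0 \<longleftrightarrow> m = 0"
proof
  assume "total_deg m = 0"
  then have "Poly_Mapping.lookup m i = 0" for i
    by (cases "i \<in> Poly_Mapping.keys m") (auto simp: total_deg_def in_keys_iff)
  then show "m = 0" by (intro poly_mapping_eqI) simp
qed simp

lemma total_deg_single [simp]: "total_deg (Poly_Mapping.single i e) = e"
  by (auto simp: total_deg_def)

lemma poly_mapping_sum_single:
  "(\<Sum>m\<in>Poly_Mapping.keys p. Poly_Mapping.single m (Poly_Mapping.lookup p m)) = p"
proof (rule poly_mapping_eqI)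
  fix k
  have "Poly_Mapping.lookup (\<Sum>m\<in>Poly_Mapping.keys p. Poly_Mapping.single m (Poly_Mapping.lookup p m)) k
     = (\<Sum>m\<in>Poly_Mapping.keys p. Poly_Mapping.lookup p m when m = k)"
    by (simp add: lookup_sum lookup_single)
  also have "\<dots> = (\<Sum>m\<in>Poly_Mapping.keys p. if m = k then Poly_Mapping.lookup p k else 0)"
    by (intro sum.cong) auto
  also have "\<dots> = Poly_Mapping.lookup p k"
    by (auto simp: in_keys_iff)
  finally show "Poly_Mapping.lookup (\<Sum>m\<in>Poly_Mapping.keys p. Poly_Mapping.single m (Poly_Mapping.lookup p m)) k
     = Poly_Mapping.lookup p k" .
qed

lemma single_mult_expand:
  fixes p :: "'a::comm_monoid_add \<Rightarrow>\<^sub>0 'k::comm_semiring_1"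
  shows "Poly_Mapping.single a c * p =
     (\<Sum>m\<in>Poly_Mapping.keys p. Poly_Mapping.single (a + m) (c * Poly_Mapping.lookup p m))"
  by (subst (1) poly_mapping_sum_single[of p, symmetric]) (simp add: sum_distrib_left mult_single)

lemma lookup_single_mult:
  fixes p :: "'a::cancel_comm_monoid_add \<Rightarrow>\<^sub>0 'k::comm_semiring_1"
  shows "Poly_Mapping.lookup (Poly_Mapping.single a c * p) (a + m) = c * Poly_Mapping.lookup p m"
proof -
  have "Poly_Mapping.lookup (Poly_Mapping.single a c * p) (a + m)
     = (\<Sum>k\<in>Poly_Mapping.keys p. c * Poly_Mapping.lookup p k when k = m)"
    unfolding single_mult_expand by (simp add: lookup_sum lookup_single)
  also have "\<dots> = (\<Sum>k\<in>Poly_Mapping.keys p. if k = m then c * Poly_Mapping.lookup p m else 0)"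
    by (intro sum.cong) auto
  also have "\<dots> = c * Poly_Mapping.lookup p m"
    by (auto simp: in_keys_iff)
  finally show ?thesis .
qed

lemma lookup_const_mult:
  "Poly_Mapping.lookup (const c * p) m = c * Poly_Mapping.lookup p (m :: nat \<Rightarrow>\<^sub>0 nat)"
  for c :: "'k::comm_ring_1"
  using lookup_single_mult[of 0 c p m] by simp

lemma const_mult: "const a * const b = const (a * b)" for a b :: "'k::comm_ring_1"
  by (simp add: mult_single)

lemma lookup_part: "Poly_Mapping.lookup (part d p) m = (Poly_Mapping.lookup p m when total_deg m = d)"
proof -
  have "finite {m. (Poly_Mapping.lookup p m when total_deg m = d) \<noteq> 0}"
    by (rule finite_subset[OF _ finite_lookup[of p]]) (auto simp: when_def)
  then show ?thesis unfolding part_def by (simp add: lookup_Abs_poly_mapping)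
qed

lemma keys_part: "Poly_Mapping.keys (part d p) = {m\<in>Poly_Mapping.keys p. total_deg m = d}"
  by (auto simp: in_keys_iff lookup_part)

lemma part_add: "part d (p + q) = part d p + part d q"
  by (rule poly_mapping_eqI) (simp add: lookup_part lookup_add when_def)

lemma part_zero [simp]: "part d 0 = 0"
  by (rule poly_mapping_eqI) (simp add: lookup_part)

lemma part_homogeneous: "homogeneous d p \<Longrightarrow> part e p = (if e = d then p else 0)"
  by (rule poly_mapping_eqI) (auto simp: lookup_part homogeneous_def in_keys_iff when_def)

lemma homogeneous_part: "homogeneous d (part d p)"
  by (auto simp: homogeneous_def keys_part)

lemma homogeneous_mult:
  "homogeneous d p \<Longrightarrow> homogeneous e q \<Longrightarrow> homogeneous (d + e) (p * q)"
  for p q :: "'k::comm_ring_1 mpoly"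
  unfolding homogeneous_def
proof
  fix m assume *: "\<forall>m\<in>Poly_Mapping.keys p. total_deg m = d" "\<forall>m\<in>Poly_Mapping.keys q. total_deg m = e"
    and "m \<in> Poly_Mapping.keys (p * q)"
  then obtain a b where "m = a + b" "a \<in> Poly_Mapping.keys p" "b \<in> Poly_Mapping.keys q"
    using keys_mult by blast
  with * show "total_deg m = d + e" by (simp add: total_deg_add)
qed

lemma homogeneous_add:
  "homogeneous d p \<Longrightarrow> homogeneous d q \<Longrightarrow> homogeneous d (p + q)"
  using keys_add[of p q] by (auto simp: homogeneous_def)

lemma homogeneous_zero [simp]: "homogeneous d 0" by (simp add: homogeneous_def)

lemma homogeneous_const [simp]: "homogeneous 0 (const c)"
  by (auto simp: homogeneous_def)

lemma homogeneous_sum: "(\<And>i. i \<in> A \<Longrightarrow> homogeneous d (f i)) \<Longrightarrow> homogeneous d (sum f A)"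
  by (induction A rule: infinite_finite_induct) (auto intro: homogeneous_add)

lemma part_eq_0: "(\<And>m. m \<in> Poly_Mapping.keys p \<Longrightarrow> total_deg m \<noteq> d) \<Longrightarrow> part d p = 0"
  by (rule poly_mapping_eqI) (auto simp: lookup_part in_keys_iff when_def)

lemma part_mult_homogeneous:
  fixes p q :: "'k::comm_ring_1 mpoly"
  assumes "homogeneous e p"
  shows "part d (p * q) = (if e \<le> d then p * part (d - e) q else 0)"
proof (cases "e \<le> d")
  case True
  have "part d (p * q) = part d (p * part (d - e) q) + part d (p * (q - part (d - e) q))"
    by (simp add: algebra_simps flip: part_add)
  also have "part d (p * (q - part (d - e) q)) = 0"
  proof (rule part_eq_0)
    fix m assume "m \<in> Poly_Mapping.keys (p * (q - part (d - e) q))"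
    then obtain a b where ab: "m = a + b" "a \<in> Poly_Mapping.keys p" "b \<in> Poly_Mapping.keys (q - part (d - e) q)"
      using keys_mult by blast
    then have "total_deg b \<noteq> d - e"
      by (auto simp: in_keys_iff lookup_minus lookup_part when_def)
    then show "total_deg m \<noteq> d" using ab assms True by (auto simp: total_deg_add homogeneous_def)
  qed
  also have "part d (p * part (d - e) q) = p * part (d - e) q"
    using part_homogeneous[OF homogeneous_mult[OF assms homogeneous_part], of d "d - e" q] True by simp
  finally show ?thesis using True by simp
next
  case False
  have "part d (p * q) = 0"
    by (rule part_eq_0) (use False assms keys_mult[of p q] in \<open>auto simp: total_deg_add homogeneous_def\<close>)
  with False show ?thesis by simp
qed

lemma sum_part: "(\<And>m. m \<in> Poly_Mapping.keys p \<Longrightarrow> total_deg m < N) \<Longrightarrow> (\<Sum>d<N. part d p) = p"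
  by (rule poly_mapping_eqI) (auto simp: lookup_sum lookup_part when_def in_keys_iff)

lemma part_0: "part 0 p = const (Poly_Mapping.lookup p 0)"
  by (rule poly_mapping_eqI) (auto simp: lookup_part lookup_single when_def total_deg_eq_0_iff)

lemma part_mult_low:
  fixes p q :: "'k::comm_ring_1 mpoly"
  assumes "\<And>m. m \<in> Poly_Mapping.keys p \<Longrightarrow> d \<le> total_deg m"
    and "\<And>m. m \<in> Poly_Mapping.keys q \<Longrightarrow> e \<le> total_deg m"
  shows "part (d + e) (p * q) = part d p * part e q"
proof -
  have "part (d + e) (p * q) = part (d + e) (part d p * q) + part (d + e) ((p - part d p) * q)"
    by (simp add: algebra_simps flip: part_add)
  also have "part (d + e) ((p - part d p) * q) = 0"
  proof (rule part_eq_0)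
    fix m assume "m \<in> Poly_Mapping.keys ((p - part d p) * q)"
    then obtain a b where ab: "m = a + b" "a \<in> Poly_Mapping.keys (p - part d p)" "b \<in> Poly_Mapping.keys q"
      using keys_mult by blast
    then have "a \<in> Poly_Mapping.keys p" "total_deg a \<noteq> d"
      by (auto simp: in_keys_iff lookup_minus lookup_part when_def split: if_splits)
    then have "d < total_deg a" using assms(1)[of a] by simp
    then show "total_deg m \<noteq> d + e" using ab(1) assms(2)[OF ab(3)] by (simp add: total_deg_add)
  qed
  also have "part (d + e) (part d p * q) = part d p * part e q"
    using part_mult_homogeneous[OF homogeneous_part, of "d + e" d p q] by simp
  finally show ?thesis by simp
qed

section \<open>The polynomial ring in n variables and its ideals\<close>

lemma polys_iff: "p \<in> polys n \<longleftrightarrow> (\<forall>m\<in>Poly_Mapping.keys p. Poly_Mapping.keys m \<subseteq> {..<n})"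
  by (auto simp: polys_def)

interpretation polys: subring_of "polys n :: 'k::comm_ring_1 mpoly set" for n
proof
  fix a b :: "'k mpoly"
  show "0 \<in> (polys n :: 'k mpoly set)" "1 \<in> (polys n :: 'k mpoly set)"
    by (auto simp: polys_iff)
  show "a + b \<in> polys n" if "a \<in> polys n" "b \<in> polys n"
    using that keys_add[of a b] by (auto simp: polys_iff)
  show "- a \<in> polys n" if "a \<in> polys n"
    using that by (auto simp: polys_iff in_keys_iff)
  show "a * b \<in> polys n" if ab: "a \<in> polys n" "b \<in> polys n"
    unfolding polys_iff
  proof
    fix m assume "m \<in> Poly_Mapping.keys (a * b)"
    then obtain k l where "m = k + l" "k \<in> Poly_Mapping.keys a" "l \<in> Poly_Mapping.keys b"
      using keys_mult by blast
    then show "Poly_Mapping.keys m \<subseteq> {..<n}"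
      using ab keys_add[of k l] unfolding polys_iff by blast
  qed
qed

lemma part_polys: "p \<in> polys n \<Longrightarrow> part d p \<in> polys n"
  by (auto simp: polys_iff keys_part)

lemma const_polys [simp]: "const c \<in> polys n"
  by (auto simp: polys_iff)

lemma var_polys: "i < n \<Longrightarrow> var i \<in> polys n"
  by (auto simp: polys_iff var_def)

lemma homogeneous_var: "homogeneous 1 (var i)"
  by (auto simp: homogeneous_def var_def)

lemma cring_poly_ring: "cring (poly_ring n :: 'k::comm_ring_1 mpoly ring)"
proof (rule cringI)
  show "abelian_group (poly_ring n :: 'k mpoly ring)"
  proof (rule abelian_groupI)
    fix x assume "x \<in> carrier (poly_ring n :: 'k mpoly ring)"
    then show "\<exists>y\<in>carrier (poly_ring n). y \<oplus>\<^bsub>poly_ring n\<^esub> x = \<zero>\<^bsub>poly_ring n\<^esub>"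
      by (intro bexI[of _ "- x"]) (auto simp: poly_ring_def)
  qed (auto simp: poly_ring_def algebra_simps)
  show "comm_monoid (poly_ring n :: 'k mpoly ring)"
    by (rule comm_monoidI) (auto simp: poly_ring_def algebra_simps)
qed (auto simp: poly_ring_def algebra_simps)

lemma poly_ring_simps [simp]:
  "carrier (poly_ring n) = polys n" "mult (poly_ring n) = (*)" "one (poly_ring n) = 1"
  "zero (poly_ring n) = 0" "add (poly_ring n) = (+)"
  by (auto simp: poly_ring_def)

lemma poly_ring_minus:
  assumes "a \<in> polys n" "b \<in> polys n"
  shows "a \<ominus>\<^bsub>poly_ring n\<^esub> b = a - (b :: 'k::comm_ring_1 mpoly)"
proof -
  interpret cring "poly_ring n :: 'k mpoly ring" by (rule cring_poly_ring)
  have "\<ominus>\<^bsub>poly_ring n\<^esub> b = - b"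
    using minus_equality[of "- b" b] assms(2) by simp
  then show ?thesis by (simp add: a_minus_def)
qed

lemma ideal_lin:
  assumes "set fs \<subseteq> polys n"
  shows "ideal (lin (polys n) fs) (poly_ring n :: 'k::comm_ring_1 mpoly ring)"
proof -
  interpret cring "poly_ring n :: 'k mpoly ring" by (rule cring_poly_ring)
  have sub: "lin (polys n) fs \<subseteq> polys n" by (rule polys.lin_subset) fact
  show ?thesis
  proof (rule idealI)
    show "ring (poly_ring n :: 'k mpoly ring)" by (rule ring_axioms)
    show "subgroup (lin (polys n) fs) (add_monoid (poly_ring n))"
    proof (rule add.subgroupI)
      fix a assume a: "a \<in> lin (polys n) fs"
      then have "\<ominus>\<^bsub>poly_ring n\<^esub> a = - a" using minus_equality[of "- a" a] sub by auto
      then show "\<ominus>\<^bsub>poly_ring n\<^esub> a \<in> lin (polys n) fs" using polys.lin_minus[OF a] by simp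
    qed (use sub polys.lin_zero polys.lin_add in \<open>auto simp del: lin.simps\<close>)
  qed (use polys.lin_mult in \<open>auto simp: mult.commute\<close>)
qed

lemma genideal_eq_lin:
  fixes fs :: "'k::comm_ring_1 mpoly list"
  assumes "set fs \<subseteq> polys n"
  shows "genideal (poly_ring n) (set fs) = lin (polys n) fs"
proof
  interpret cring "poly_ring n :: 'k mpoly ring" by (rule cring_poly_ring)
  show "genideal (poly_ring n) (set fs) \<subseteq> lin (polys n) fs"
    by (rule genideal_minimal[OF ideal_lin[OF assms]]) (auto intro: polys.lin_gen)
  interpret I: ideal "genideal (poly_ring n) (set fs)" "poly_ring n :: 'k mpoly ring"
    by (rule genideal_ideal) (use assms in simp)
  show "lin (polys n) fs \<subseteq> genideal (poly_ring n) (set fs)"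
  proof (rule polys.lin_least)
    show "set fs \<subseteq> genideal (poly_ring n) (set fs)" using genideal_self[of "set fs"] assms by simp
    show "0 \<in> genideal (poly_ring n) (set fs)" using I.zero_closed by simp
    show "a + b \<in> genideal (poly_ring n) (set fs)"
      if "a \<in> genideal (poly_ring n) (set fs)" "b \<in> genideal (poly_ring n) (set fs)" for a b
      using I.a_closed[OF that] by simp
    show "c * a \<in> genideal (poly_ring n) (set fs)"
      if "a \<in> genideal (poly_ring n) (set fs)" "c \<in> polys n" for a c
      using I.I_l_closed[of a c] that by simp
  qed
qed

lemma lin_cong_set: "set fs = set gs \<Longrightarrow> lin (polys n) fs = lin (polys n) gs"
  by (intro subset_antisym polys.lin_mono) (auto intro: polys.lin_gen)

text \<open>The list is reversed in the second fact because \<open>reg\<close> takes the head as the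
  last member of the sequence. The last fact keeps the original order for arguments that exchange
  members.\<close>

lemma regular_sequenceD:
  fixes fs :: "'k::comm_ring_1 mpoly list"
  assumes "regular_sequence (poly_ring n) fs"
  shows "set fs \<subseteq> polys n" "reg (polys n) (rev fs)" "1 \<notin> lin (polys n) fs"
    and "\<And>i a. i < length fs \<Longrightarrow> a \<in> polys n \<Longrightarrow> fs ! i * a \<in> lin (polys n) (take i fs) \<Longrightarrow> a \<in> lin (polys n) (take i fs)"
proof -
  interpret cring "poly_ring n :: 'k mpoly ring" by (rule cring_poly_ring)
  show fs: "set fs \<subseteq> polys n" using assms by (auto simp: regular_sequence_def in_set_conv_nth)
  have take: "set (take i fs) \<subseteq> polys n" for i using fs set_take_subset by fastforce
  show nzd: "a \<in> lin (polys n) (take i fs)"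
    if "i < length fs" "a \<in> polys n" "fs ! i * a \<in> lin (polys n) (take i fs)" for i a
    using assms that unfolding regular_sequence_def genideal_eq_lin[OF take] by auto
  have "reg (polys n) (rev (take i fs))" if "i \<le> length fs" for i
    using that
  proof (induction i)
    case (Suc i)
    then have "rev (take (Suc i) fs) = fs ! i # rev (take i fs)"
      by (simp add: take_Suc_conv_app_nth)
    moreover have "lin (polys n) (rev (take i fs)) = lin (polys n) (take i fs)"
      by (rule lin_cong_set) simp
    ultimately show ?case using Suc nzd[of i] by simp
  qed simp
  from this[of "length fs"] show "reg (polys n) (rev fs)" by simp
  show "1 \<notin> lin (polys n) fs"
  proof
    assume one: "1 \<in> lin (polys n) fs"
    have "p \<in> lin (polys n) fs" if "p \<in> polys n" for p
      using polys.lin_mult[OF one that] by simp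
    then have "lin (polys n) fs = polys n" using polys.lin_subset[OF fs] by blast
    moreover have "genideal (poly_ring n) (set fs) \<noteq> polys n"
      using assms unfolding regular_sequence_def by simp
    ultimately show False unfolding genideal_eq_lin[OF fs] by simp
  qed
qed

lemma lin_vars_iff:
  fixes p :: "'k::comm_ring_1 mpoly"
  assumes "set is \<subseteq> {..<n}"
  shows "p \<in> lin (polys n) (map var is) \<longleftrightarrow> p \<in> polys n \<and>
    (\<forall>m\<in>Poly_Mapping.keys p. \<exists>i\<in>set is. Poly_Mapping.lookup m i > 0)" (is "?l \<longleftrightarrow> ?r")
proof
  define J :: "'k mpoly set" where "J = {p \<in> polys n. \<forall>m\<in>Poly_Mapping.keys p. \<exists>i\<in>set is. Poly_Mapping.lookup m i > 0}"
  have "lin (polys n) (map var is) \<subseteq> J"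
  proof (rule polys.lin_least)
    show "set (map var is) \<subseteq> J" 
      using assms by (auto simp: J_def var_polys) (force simp: var_def split: if_splits)
    show "a + b \<in> J" if "a \<in> J" "b \<in> J" for a b
      using that keys_add[of a b] by (auto simp: J_def)
    show "c * a \<in> J" if "a \<in> J" "c \<in> polys n" for a c
    proof -
      have "\<exists>i\<in>set is. Poly_Mapping.lookup m i > 0" if m: "m \<in> Poly_Mapping.keys (c * a)" for m
      proof -
        obtain k l where "m = k + l" "l \<in> Poly_Mapping.keys a" using keys_mult m by blast
        then show ?thesis using \<open>a \<in> J\<close> by (auto simp: J_def lookup_add)
      qed
      then show ?thesis using that by (auto simp: J_def)
    qed
  qed (auto simp: J_def)
  then show "?l \<Longrightarrow> ?r" unfolding J_def by blast
next
  assume r: ?r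
  have "Poly_Mapping.single m (Poly_Mapping.lookup p m) \<in> lin (polys n) (map var is)"
    if m: "m \<in> Poly_Mapping.keys p" for m
  proof -
    obtain i where i: "i \<in> set is" "Poly_Mapping.lookup m i > 0" using r m by blast
    define m' where "m' = m - Poly_Mapping.single i 1"
    have mm: "m = m' + Poly_Mapping.single i 1"
      by (rule poly_mapping_eqI) (use i in \<open>auto simp: m'_def lookup_add lookup_minus lookup_single when_def\<close>)
    have "Poly_Mapping.keys m' \<subseteq> Poly_Mapping.keys m"
      by (auto simp: m'_def in_keys_iff lookup_minus)
    then have "Poly_Mapping.single m' (Poly_Mapping.lookup p m) \<in> polys n"
      using r m by (auto simp: polys_iff)
    moreover have "var i \<in> lin (polys n) (map var is)" using i by (intro polys.lin_gen) auto
    ultimately have "Poly_Mapping.single m' (Poly_Mapping.lookup p m) * var i \<in> lin (polys n) (map var is)"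
      by (intro polys.lin_mult)
    then show ?thesis by (simp only: var_def mult_single mm[symmetric] mult_1_right)
  qed
  then have "(\<Sum>m\<in>Poly_Mapping.keys p. Poly_Mapping.single m (Poly_Mapping.lookup p m)) \<in> lin (polys n) (map var is)"
    by (intro polys.lin_sum)
  then show ?l by (simp add: poly_mapping_sum_single)
qed

text \<open>Multiplication by \<open>var i\<close> shifts exponents at \<open>i\<close> only. A
  monomial of the product that is divisible by another variable therefore comes from one that
  already was.\<close>

lemma reg_vars:
  assumes "set is \<subseteq> {..<n}" "distinct is"
  shows "reg (polys n :: 'k::comm_ring_1 mpoly set) (map var is)"
  using assms
proof (induction "is")
  case (Cons i "is")
  have "a \<in> lin (polys n) (map var is)" if a: "a \<in> polys n" "var i * a \<in> lin (polys n) (map var is)"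
    for a :: "'k mpoly"
  proof -
    have "\<exists>j\<in>set is. Poly_Mapping.lookup m j > 0" if m: "m \<in> Poly_Mapping.keys a" for m
    proof -
      have "Poly_Mapping.lookup (var i * a) (Poly_Mapping.single i 1 + m) = Poly_Mapping.lookup a m"
        unfolding var_def lookup_single_mult by simp
      then have "Poly_Mapping.single i 1 + m \<in> Poly_Mapping.keys (var i * a)"
        using m by (simp add: in_keys_iff)
      then obtain j where "j \<in> set is" "Poly_Mapping.lookup (Poly_Mapping.single i 1 + m) j > 0"
        using a(2) Cons.prems lin_vars_iff[of "is" n "var i * a"] by auto
      moreover from this have "i \<noteq> j" using Cons.prems by auto
      ultimately show ?thesis by (intro bexI[of _ j]) (auto simp: lookup_add lookup_single when_def)
    qed
    then show ?thesis using a(1) Cons.prems lin_vars_iff[of "is" n a] by auto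
  qed
  then show ?case using Cons by auto
qed simp

lemma lin_all_vars_iff:
  "p \<in> lin (polys n) (map var [0..<n]) \<longleftrightarrow> p \<in> polys n \<and> Poly_Mapping.lookup p 0 = 0"
proof -
  have "(\<exists>i\<in>set [0..<n]. Poly_Mapping.lookup m i > 0) \<longleftrightarrow> m \<noteq> 0"
    if "Poly_Mapping.keys m \<subseteq> {..<n}" for m :: "nat \<Rightarrow>\<^sub>0 nat"
  proof
    assume "\<exists>i\<in>set [0..<n]. Poly_Mapping.lookup m i > 0"
    then show "m \<noteq> 0" by auto
  next
    assume "m \<noteq> 0"
    then obtain i where "Poly_Mapping.lookup m i \<noteq> 0" by (auto simp: poly_mapping_eq_iff fun_eq_iff)
    moreover from this have "i \<in> {..<n}" using that by (auto simp: in_keys_iff subset_iff)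
    ultimately show "\<exists>i\<in>set [0..<n]. Poly_Mapping.lookup m i > 0" by auto
  qed
  then show ?thesis
    by (subst lin_vars_iff) (auto simp: polys_iff, auto simp: in_keys_iff)
qed

section \<open>Generic quadrics\<close>

lemma part_lin:
  fixes fs :: "'k::comm_ring_1 mpoly list"
  assumes "\<forall>f\<in>set fs. homogeneous e f" "p \<in> lin (polys n) fs"
  shows "part d p \<in> lin (polys n) fs"
  using assms
proof (induction fs arbitrary: p)
  case (Cons f fs)
  then obtain a b where p: "p = a + f * b" "a \<in> lin (polys n) fs" "b \<in> polys n" by auto
  have "part d p = part d a + f * (if e \<le> d then part (d - e) b else 0)"
    using part_mult_homogeneous[of e f d b] Cons.prems(1) by (simp add: p part_add)
  moreover have "part d a \<in> lin (polys n) fs" using Cons p by auto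
  moreover have "(if e \<le> d then part (d - e) b else 0) \<in> polys n" using p(3) by (simp add: part_polys)
  ultimately show ?case unfolding lin.simps by blast
qed simp

text \<open>The component of least degree of Y that is not in the ideal would be multiplied by a unit.\<close>

lemma graded_unit_cancel:
  fixes X Y :: "'k::field mpoly"
  assumes fs: "\<forall>f\<in>set fs. homogeneous e f" and X: "X \<in> polys n" "Poly_Mapping.lookup X 0 \<noteq> 0"
    and Y: "Y \<in> polys n" and XY: "X * Y \<in> lin (polys n) fs"
  shows "Y \<in> lin (polys n) fs"
proof -
  let ?I = "lin (polys n) fs"
  have "part d Y \<in> ?I" for d
  proof (induction d rule: less_induct)
    case (less d)
    \<comment> \<open>\<open>Z\<close> is \<open>Y\<close> without its components of degree below
      \<open>d\<close>, which lie in the ideal by induction. The lowest part of \<open>X * Z\<close>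
      is then the constant term of \<open>X\<close> times the component of \<open>Y\<close> in
      degree \<open>d\<close>.\<close>
    define Z where "Z = Y - (\<Sum>i<d. part i Y)"
    have low: "(\<Sum>i<d. part i Y) \<in> ?I" using less by (intro polys.lin_sum) auto
    have lookup_Z: "Poly_Mapping.lookup Z m = (if total_deg m < d then 0 else Poly_Mapping.lookup Y m)" for m
      by (auto simp: Z_def lookup_minus lookup_sum lookup_part when_def)
    have "X * Z = X * Y - X * (\<Sum>i<d. part i Y)" by (simp add: Z_def algebra_simps)
    then have "X * Z \<in> ?I" using XY low X(1) by (auto intro: polys.lin_diff polys.lin_mult)
    then have "part (0 + d) (X * Z) \<in> ?I" using fs by (intro part_lin)
    also have "part (0 + d) (X * Z) = part 0 X * part d Z"
      by (rule part_mult_low) (auto simp: in_keys_iff lookup_Z split: if_splits)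
    also have "part d Z = part d Y"
      by (rule poly_mapping_eqI) (simp add: lookup_part lookup_Z when_def)
    finally have "const (1 / Poly_Mapping.lookup X 0) * (part 0 X * part d Y) \<in> ?I"
      by (rule polys.lin_mult) simp
    moreover have "const (1 / Poly_Mapping.lookup X 0) * (part 0 X * part d Y) = part d Y"
      using X(2) by (simp add: part_0 const_mult flip: mult.assoc)
    ultimately show ?case by simp
  qed
  moreover define N where "N = Suc (Max (insert 0 (total_deg ` Poly_Mapping.keys Y)))"
  have "(\<Sum>d<N. part d Y) = Y"
    by (rule sum_part) (auto simp: N_def less_Suc_eq_le intro!: Max_ge)
  ultimately show ?thesis using polys.lin_sum[of "{..<N}" "\<lambda>d. part d Y" n fs] by simp
qed

lemma lin_combination:
  assumes "p \<in> lin P fs"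
  shows "\<exists>gs. length gs = length fs \<and> set gs \<subseteq> P \<and> p = (\<Sum>(f, g)\<leftarrow>zip fs gs. f * g)"
  using assms
proof (induction fs arbitrary: p)
  case (Cons f fs)
  then obtain a b where p: "p = a + f * b" "a \<in> lin P fs" "b \<in> P" by auto
  then obtain gs where "length gs = length fs" "set gs \<subseteq> P" "a = (\<Sum>(f, g)\<leftarrow>zip fs gs. f * g)"
    using Cons.IH by blast
  then show ?case using p by (intro exI[of _ "b # gs"]) auto
qed simp

lemma combination_lin:
  "set gs \<subseteq> polys n \<Longrightarrow> length gs = length fs \<Longrightarrow>
   (\<Sum>(f, g)\<leftarrow>zip fs gs. f * g) \<in> lin (polys n) fs"
proof (induction fs arbitrary: gs)
  case (Cons f fs)
  then obtain g gs' where "gs = g # gs'" by (cases gs) auto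
  with Cons show ?case by (force simp: add.commute)
qed simp

text \<open>In a relation with constant coefficients, regularity puts the coefficient of the head
  into the ideal of the tail. If it were nonzero, this ideal would contain a unit.\<close>

lemma reg_independent:
  fixes fs :: "'k::field mpoly list"
  assumes "reg (polys n) fs" "1 \<notin> lin (polys n) fs" "length cs = length fs"
    "(\<Sum>(f, c)\<leftarrow>zip fs cs. f * const c) = 0" "c \<in> set cs"
  shows "c = 0"
  using assms
proof (induction fs arbitrary: cs)
  case (Cons f fs)
  then obtain d ds where cs: "cs = d # ds" by (cases cs) auto
  have one: "1 \<notin> lin (polys n) fs" using Cons.prems(2) polys.lin_Cons by blast
  have "(\<Sum>(f, g)\<leftarrow>zip fs (map const ds). f * g) \<in> lin (polys n) fs"
    using Cons.prems(3) cs by (intro combination_lin) auto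
  then have mem: "(\<Sum>(f, c)\<leftarrow>zip fs ds. f * const c) \<in> lin (polys n) fs"
    by (simp add: zip_map2 case_prod_unfold o_def)
  have eq: "f * const d + (\<Sum>(f, c)\<leftarrow>zip fs ds. f * const c) = 0" using Cons.prems(4) cs by simp
  then have "f * const d = - (\<Sum>(f, c)\<leftarrow>zip fs ds. f * const c)" by (simp add: eq_neg_iff_add_eq_0)
  then have "f * const d \<in> lin (polys n) fs" using mem polys.lin_minus by metis
  then have "const d \<in> lin (polys n) fs" using Cons.prems(1) by simp
  then have "const (1 / d) * const d \<in> lin (polys n) fs" by (intro polys.lin_mult) auto
  then have d: "d = 0" using one by (cases "d = 0") (auto simp: const_mult)
  with eq Cons.IH[of ds] Cons.prems cs one show ?case by auto
qed simp

lemma part_combination: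
  fixes fs :: "'k::comm_ring_1 mpoly list"
  assumes "\<forall>f\<in>set fs. homogeneous 2 f"
  shows "part 2 (\<Sum>(f, g)\<leftarrow>zip fs gs. f * g)
    = (\<Sum>(f, c)\<leftarrow>zip fs (map (\<lambda>g. Poly_Mapping.lookup g 0) gs). f * const c)"
  using assms
proof (induction fs arbitrary: gs)
  case (Cons f fs)
  then show ?case by (cases gs) (auto simp: part_add part_mult_homogeneous part_0)
qed simp

lemma combination_kspan:
  fixes fs :: "'k::comm_ring_1 mpoly list"
  assumes "length cs = length fs"
  shows "(\<Sum>(f, c)\<leftarrow>zip (rev fs) cs. f * const c) \<in> kspan fs"
proof -
  have "(\<Sum>(f, c)\<leftarrow>zip (rev fs) cs. f * const c) = (\<Sum>(f, c)\<leftarrow>rev (zip fs (rev cs)). f * const c)"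
    using assms by (simp add: zip_rev[symmetric])
  also have "\<dots> = (\<Sum>(f, c)\<leftarrow>zip fs (rev cs). f * const c)"
    by (subst rev_map[symmetric]) (rule sum_list_rev)
  also have "\<dots> = (\<Sum>i<length fs. const (rev cs ! i) * fs ! i)"
    using assms by (simp add: sum_list_sum_nth atLeast0LessThan mult.commute)
  finally show ?thesis unfolding kspan_def by auto
qed

text \<open>By degrees, a linear form is not a unit, and a nonzero one is not a multiple of a
  quadratic form. Hence \<open>u\<close> is a proper factor that is not a unit.\<close>

lemma product_not_irreducible:
  fixes u v :: "'k::comm_ring_1 mpoly"
  assumes "u \<in> polys n" "v \<in> polys n" "homogeneous 1 u" "homogeneous 1 v" "u * v \<noteq> 0"
  shows "\<not> ring_irreducible\<^bsub>poly_ring n\<^esub> (u * v)"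
proof
  assume "ring_irreducible\<^bsub>poly_ring n\<^esub> (u * v)"
  then have irr: "properfactor (poly_ring n) u (u * v) \<Longrightarrow> u \<in> Units (poly_ring n)"
    using assms(1) by (auto simp: ring_irreducible_def irreducible_def)
  have "u \<notin> Units (poly_ring n)"
  proof
    assume "u \<in> Units (poly_ring n)"
    then obtain w where "u * w = 1" by (auto simp: Units_def)
    then have "part 0 (u * w) = part 0 1" by simp
    then have "0 = part 0 (1 :: 'k mpoly)" using assms(3) by (simp add: part_mult_homogeneous)
    then show False by (simp add: part_0 lookup_one)
  qed
  moreover have "properfactor (poly_ring n) u (u * v)"
    unfolding properfactor_def factor_def
  proof (intro conjI notI)
    assume "\<exists>c\<in>carrier (poly_ring n). u = u * v \<otimes>\<^bsub>poly_ring n\<^esub> c"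
    then obtain c where c: "u = (u * v) * c" by auto
    have "homogeneous 2 (u * v)" using homogeneous_mult[OF assms(3,4)] by (simp add: numeral_2_eq_2)
    then have "part 1 ((u * v) * c) = 0" by (simp add: part_mult_homogeneous)
    with c have "u = 0" using part_homogeneous[OF assms(3), of 1] by simp
    with assms(5) show False by simp
  qed (use assms in auto)
  ultimately show False using irr by blast
qed

theorem generic_no_exact_zero_divisor:
  fixes fs :: "'k::field mpoly list"
  assumes "generic n fs" "x \<in> carrier (quot_alg n fs)"
  shows "\<not> exact_zero_divisor (quot_alg n fs) x"
proof
  assume ex: "exact_zero_divisor (quot_alg n fs) x"
  have hom: "\<forall>f\<in>set fs. homogeneous 2 f" and rseq: "regular_sequence (poly_ring n) fs"
    and irr: "\<And>g. g \<in> kspan fs \<Longrightarrow> g \<noteq> 0 \<Longrightarrow> ring_irreducible\<^bsub>poly_ring n\<^esub> g"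
    using assms(1) by (auto simp: generic_def quadratic_form_def)
  note rs = regular_sequenceD[OF rseq]
  define rf where "rf = rev fs"
  let ?I = "lin (polys n) rf"
  have rf: "set rf \<subseteq> polys n" "set rf = set fs" "length rf = length fs" and hom_rf: "\<forall>f\<in>set rf. homogeneous 2 f"
    using rs(1) hom by (auto simp: rf_def)
  have I_fs: "?I = lin (polys n) fs" using rf by (intro lin_cong_set) simp
  have I: "genideal (poly_ring n) (set fs) = ?I" using genideal_eq_lin[OF rs(1)] I_fs by simp
  have reg: "reg (polys n) rf" "1 \<notin> ?I" using rs(2,3) I_fs by (auto simp: rf_def)
  obtain X where X: "X \<in> polys n" "x = a_r_coset (poly_ring n) ?I X"
    using assms(2) unfolding quot_alg_def FactRing_carrier I by auto
  have "exact_zero_divisor (poly_ring n Quot ?I) (a_r_coset (poly_ring n) ?I X)"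
    using ex unfolding quot_alg_def I X(2) .
  then obtain Y where XI: "X \<notin> ?I" and Y: "Y \<in> polys n" "Y \<notin> ?I"
    and annX: "\<And>a. a \<in> polys n \<Longrightarrow> a * X \<in> ?I \<longleftrightarrow> (\<exists>l\<in>polys n. a - l * Y \<in> ?I)"
    and annY: "\<And>a. a \<in> polys n \<Longrightarrow> a * Y \<in> ?I \<longleftrightarrow> (\<exists>l\<in>polys n. a - l * X \<in> ?I)"
    using exact_zero_divisor_coset_iff[OF cring_poly_ring ideal_lin[OF rf(1)], of X] X(1)
    by (auto simp: poly_ring_minus)
  have "X * Y \<in> ?I" using annY[OF X(1)] by (auto intro: bexI[of _ 1])
  \<comment> \<open>If one of the two had a nonzero constant term, it could be cancelled from
    \<open>X * Y\<close>, and the other one would lie in the ideal.\<close>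
  have X0: "Poly_Mapping.lookup X 0 = 0" and Y0: "Poly_Mapping.lookup Y 0 = 0"
    using graded_unit_cancel[OF hom_rf X(1) _ Y(1) \<open>X * Y \<in> ?I\<close>]
      graded_unit_cancel[OF hom_rf Y(1) _ X(1)] \<open>X * Y \<in> ?I\<close> XI Y(2) by (auto simp: mult.commute)
  obtain gs where gs: "length gs = length rf" "set gs \<subseteq> polys n"
     "X * Y = (\<Sum>(f, g)\<leftarrow>zip rf gs. f * g)"
    using lin_combination[OF \<open>X * Y \<in> ?I\<close>] by blast
  define cs where "cs = map (\<lambda>g. Poly_Mapping.lookup g 0) gs"
  \<comment> \<open>Without constant terms, the quadratic part of the product is the product of the
    linear parts. On the other side only the constant terms of \<open>gs\<close> survive in degree
    2, because the generators are quadratic.\<close>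
  have "part (1 + 1) (X * Y) = part 1 X * part 1 Y"
    by (rule part_mult_low) (use X0 Y0 in \<open>auto simp: Suc_le_eq neq0_conv[symmetric] total_deg_eq_0_iff\<close>)
  then have prod: "part 1 X * part 1 Y = (\<Sum>(f, c)\<leftarrow>zip rf cs. f * const c)"
    using part_combination[OF hom_rf, of gs] gs(3) by (simp add: cs_def numeral_2_eq_2)
  have "part 1 X * part 1 Y = 0"
  proof (rule ccontr)
    assume "part 1 X * part 1 Y \<noteq> 0"
    moreover have "part 1 X * part 1 Y \<in> kspan fs"
      unfolding prod rf_def by (rule combination_kspan) (use gs rf in \<open>simp add: cs_def\<close>)
    ultimately show False
      using irr product_not_irreducible[OF part_polys part_polys homogeneous_part homogeneous_part] X(1) Y(1)
      by blast
  qed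
  \<comment> \<open>The product of linear forms is zero, so the constant terms of \<open>gs\<close>
    give a linear relation between the generators, and independence makes it trivial. Now every
    entry of the Tate differential vanishes at the origin.\<close>
  then have "c = 0" if "c \<in> set cs" for c
    using reg_independent[OF reg, of cs] gs(1) that unfolding prod by (simp add: cs_def)
  then have gs0: "Poly_Mapping.lookup g 0 = 0" if "g \<in> set gs" for g
    using that by (auto simp: cs_def)
  \<comment> \<open>Over A, the resolution of A/(x) alternates between multiplication by x and by
    y.\<close>
  define Z where "Z p = (if even p then X else Y)" for p :: nat
  interpret tate "polys n" rf gs Z
  proof
    show "reg (polys n) rf" "set rf \<subseteq> polys n" "set gs \<subseteq> polys n" "length gs = length rf"
      using reg rf gs by auto
    show "Z p \<in> polys n" "Z (Suc (Suc p)) = Z p" for p using X Y by (auto simp: Z_def)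
    show "Z p * Z (Suc p) = (\<Sum>(f, g)\<leftarrow>zip rf gs. f * g)" for p
      using gs(3) by (auto simp: Z_def mult.commute)
    show "\<exists>l\<in>polys n. a - Z (Suc p) * l \<in> ?I" if "a \<in> polys n" "Z p * a \<in> ?I" for a p
      using that annX[of a] annY[of a] by (auto simp: Z_def mult.commute)
  qed
  let ?xs = "map var [0..<n] :: 'k mpoly list"
  have low: "Poly_Mapping.lookup f 0 = 0" if "f \<in> set rf" for f
    using hom_rf that by (force simp: homogeneous_def in_keys_iff)
  show False
  proof (rule tate_not_minimal[of ?xs])
    show "reg (polys n) ?xs" by (rule reg_vars) auto
    show "set ?xs \<subseteq> polys n" by (auto intro: var_polys)
    show "1 \<notin> lin (polys n) ?xs" by (simp add: lin_all_vars_iff lookup_one)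
    show "set rf \<subseteq> lin (polys n) ?xs" using rf(1) low by (auto simp: lin_all_vars_iff)
    show "set gs \<subseteq> lin (polys n) ?xs" using gs(2) gs0 by (auto simp: lin_all_vars_iff)
    show "Z p \<in> lin (polys n) ?xs" for p using X Y X0 Y0 by (auto simp: lin_all_vars_iff Z_def)
  qed
qed

section \<open>Products of linear forms as exact zero-divisors\<close>

lemma part_lin_low:
  fixes fs :: "'k::comm_ring_1 mpoly list"
  assumes "\<forall>f\<in>set fs. homogeneous e f" "p \<in> lin (polys n) fs" "d < e"
  shows "part d p = 0"
  using assms
proof (induction fs arbitrary: p)
  case (Cons f fs)
  then obtain a b where p: "p = a + f * b" "a \<in> lin (polys n) fs" "b \<in> polys n" by auto
  show ?case
    using part_mult_homogeneous[of e f d b] Cons p by (simp add: part_add)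
qed simp

text \<open>If a, b is regular modulo J then a is a nonzerodivisor modulo (J, b); this half of the exchange
  property needs neither grading nor locality.\<close>

lemma regular_sequence_nzd_others:
  fixes fs :: "'k::comm_ring_1 mpoly list"
  assumes rs: "regular_sequence (poly_ring n) fs" and j: "j < m" "m \<le> length fs"
    and a: "a \<in> polys n" "fs ! j * a \<in> lin (polys n) (map ((!) fs) (filter (\<lambda>i. i \<noteq> j) [0..<m]))"
  shows "a \<in> lin (polys n) (map ((!) fs) (filter (\<lambda>i. i \<noteq> j) [0..<m]))"
proof -
  define G where "G m = map ((!) fs) (filter (\<lambda>i. i \<noteq> j) [0..<m])" for m
  note rsD = regular_sequenceD[OF rs]
  have "\<forall>a\<in>polys n. fs ! j * a \<in> lin (polys n) (G m) \<longrightarrow> a \<in> lin (polys n) (G m)"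
    if "Suc j \<le> m" "m \<le> length fs" for m
    using that
  proof (induction m rule: dec_induct)
    case base
    have "filter (\<lambda>i. i \<noteq> j) [0..<j] = [0..<j]" by (rule filter_True) auto
    then have "G (Suc j) = take j fs"
      using base by (simp add: G_def take_map[symmetric] map_nth take_upt flip: take_all[OF order_refl])
        (metis Suc_leD add_0 map_nth take_map take_upt)
    then show ?case using rsD(4)[of j] base by auto
  next
    case (step m)
    have GS: "lin (polys n) (G (Suc m)) = lin (polys n) (fs ! m # G m)"
      using step by (intro lin_cong_set) (auto simp: G_def)
    have "set (take m fs) = (!) fs ` {0..<m}"
      using step(4) nth_image[of m fs] by simp
    \<comment> \<open>The first \<open>m\<close> members are \<open>fs ! j\<close> and the list
      \<open>G m\<close>. Hence \<open>fs ! m\<close> is a nonzerodivisor modulo the two together,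
      which is the only information available about it.\<close>
    then have take: "lin (polys n) (take m fs) = lin (polys n) (fs ! j # G m)"
      using step by (intro lin_cong_set) (auto simp: G_def)
    have fP: "fs ! m \<in> polys n" "fs ! j \<in> polys n" using rsD(1) step nth_mem[of _ fs] by auto
    show ?case
    proof (intro ballI impI)
      fix a assume a: "a \<in> polys n" "fs ! j * a \<in> lin (polys n) (G (Suc m))"
      then obtain g b where gb: "fs ! j * a = g + fs ! m * b" "g \<in> lin (polys n) (G m)" "b \<in> polys n"
        unfolding GS by auto
      have "fs ! m * b = - g + fs ! j * a" using gb(1) by simp
      then have "fs ! m * b \<in> lin (polys n) (take m fs)"
        unfolding take lin.simps using polys.lin_minus[OF gb(2)] a(1) by blast
      then have "b \<in> lin (polys n) (take m fs)" using rsD(4)[of m b] gb(3) step by auto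
      \<comment> \<open>The part of \<open>b\<close> divisible by \<open>fs ! j\<close> can be moved
        to the left side. This leaves \<open>fs ! j\<close> times a corrected \<open>a\<close> in
        the ideal of \<open>G m\<close>, to which the induction hypothesis applies.\<close>
      then obtain g' b' where gb': "b = g' + fs ! j * b'" "g' \<in> lin (polys n) (G m)" "b' \<in> polys n"
        unfolding take by auto
      have "fs ! j * (a - fs ! m * b') = g + fs ! m * g'"
        using gb(1) gb'(1) by (simp add: algebra_simps)
      also have "\<dots> \<in> lin (polys n) (G m)"
        using gb(2) gb'(2) fP by (intro polys.lin_add polys.lin_mult)
      finally have "a - fs ! m * b' \<in> lin (polys n) (G m)"
        using step a(1) fP gb'(3) by auto
      moreover have "a = (a - fs ! m * b') + fs ! m * b'" by simp
      ultimately show "a \<in> lin (polys n) (G (Suc m))" unfolding GS lin.simps using gb'(3) by blast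
    qed
  qed
  then show ?thesis using a j unfolding G_def by auto
qed

lemma exact_zero_divisor_lin_iff:
  fixes X :: "'k::comm_ring_1 mpoly"
  assumes "set fs \<subseteq> polys n" "X \<in> polys n"
  defines "I \<equiv> lin (polys n) fs"
  shows "exact_zero_divisor (poly_ring n Quot I) (a_r_coset (poly_ring n) I X) \<longleftrightarrow> X \<notin> I \<and>
    (\<exists>Y\<in>polys n. Y \<notin> I \<and>
      (\<forall>a\<in>polys n. a * X \<in> I \<longleftrightarrow> (\<exists>l\<in>polys n. a - l * Y \<in> I)) \<and>
      (\<forall>a\<in>polys n. a * Y \<in> I \<longleftrightarrow> (\<exists>l\<in>polys n. a - l * X \<in> I)))"
proof -
  have "ideal I (poly_ring n)" unfolding I_def by (rule ideal_lin) fact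
  from exact_zero_divisor_coset_iff[OF cring_poly_ring this] assms(2) show ?thesis
    by (simp add: poly_ring_minus cong: bex_cong ball_cong conj_cong)
qed

text \<open>Some \<open>fs ! j\<close> occurs in \<open>l * r\<close> with nonzero coefficient and
  may be replaced by \<open>l * r\<close> without changing the ideal. Modulo the remaining members
  \<open>l * r\<close> is still a nonzerodivisor. If \<open>a * l\<close> is a multiple of
  \<open>l * r\<close> modulo them, cancellation makes \<open>a\<close> a multiple of
  \<open>r\<close>, so the annihilator of the class of \<open>l\<close> is generated by that of
  \<open>r\<close>, and symmetrically.\<close>

theorem exact_zero_divisor_of_product:
  fixes fs :: "'k::field mpoly list"
  assumes rs: "regular_sequence (poly_ring n) fs" and hom: "\<forall>f\<in>set fs. homogeneous 2 f"
    and l: "linear_form n l" "l \<noteq> 0" and r: "linear_form n r" "r \<noteq> 0"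
    and span: "l * r \<in> kspan fs"
  shows "exact_zero_divisor (quot_alg n fs)
           (a_r_coset (poly_ring n) (genideal (poly_ring n) (set fs)) l)"
proof -
  note rsD = regular_sequenceD[OF rs]
  have lP: "l \<in> polys n" "r \<in> polys n" and lh: "homogeneous 1 l" "homogeneous 1 r"
    using l r by (auto simp: linear_form_def)
  obtain c where c: "l * r = (\<Sum>i<length fs. const (c i) * fs ! i)"
    using span by (auto simp: kspan_def)
  have "l * r \<noteq> 0" using l r by simp
  then have "\<exists>j<length fs. c j \<noteq> 0"
    unfolding c by (metis (no_types, lifting) lessThan_iff mult_zero_left single_zero sum.neutral)
  then obtain j where j: "j < length fs" "c j \<noteq> 0" by blast
  define S where "S = map ((!) fs) (filter (\<lambda>i. i \<noteq> j) [0..<length fs])"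
  define s where "s = (\<Sum>i\<in>{..<length fs} - {j}. const (c i) * fs ! i)"
  have lr: "l * r = const (c j) * fs ! j + s"
    unfolding c s_def using j by (subst sum.remove[of _ j]) auto
  have s: "s \<in> lin (polys n) S"
    unfolding s_def by (intro polys.lin_sum polys.lin_mult polys.lin_gen) (auto simp: S_def)
  have fjP: "fs ! j \<in> polys n" using rsD(1) j by auto
  have cc: "const (1 / c j) * const (c j) = (1 :: 'k mpoly)" using j by (simp add: const_mult)
  have fj: "fs ! j = const (1 / c j) * (l * r - s)"
    using cc by (simp add: lr flip: mult.assoc)
  have set_fs: "set fs = insert (fs ! j) (set S)"
  proof -
    have "set fs = (!) fs ` {0..<length fs}" using nth_image[of "length fs" fs] by simp
    then show ?thesis using j by (auto simp: S_def)
  qed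
  let ?I = "lin (polys n) (l * r # S)"
  have "lin (polys n) fs = lin (polys n) (fs ! j # S)"
    by (rule lin_cong_set) (simp add: set_fs)
  also have "\<dots> = ?I"
  proof (intro subset_antisym polys.lin_mono)
    have "l * r - s \<in> ?I"
      using polys.lin_gen[of "l * r" "l * r # S" n] polys.lin_Cons[OF s] by (intro polys.lin_diff) auto
    then have "fs ! j \<in> ?I" unfolding fj by (rule polys.lin_mult) simp
    then show "set (fs ! j # S) \<subseteq> ?I"
      using polys.lin_gen[of _ "l * r # S" n] by (auto simp del: lin.simps)
    have "const (c j) * fs ! j \<in> lin (polys n) (fs ! j # S)"
      by (intro polys.lin_mult polys.lin_gen) auto
    then have "l * r \<in> lin (polys n) (fs ! j # S)"
      unfolding lr by (intro polys.lin_add polys.lin_Cons[OF s])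
    then show "set (l * r # S) \<subseteq> lin (polys n) (fs ! j # S)"
      using polys.lin_gen[of _ "fs ! j # S" n] by (auto simp del: lin.simps)
  qed
  finally have I_eq: "lin (polys n) fs = ?I" .
  have nzd: "a \<in> lin (polys n) S" if a: "a \<in> polys n" "l * r * a \<in> lin (polys n) S" for a
  proof -
    have "fs ! j * a = const (1 / c j) * (l * r * a - a * s)"
      by (simp add: fj algebra_simps)
    also have "\<dots> \<in> lin (polys n) S"
      by (rule polys.lin_mult[OF polys.lin_diff[OF a(2) polys.lin_mult[OF s a(1)]]]) simp
    finally show ?thesis
      unfolding S_def using regular_sequence_nzd_others[OF rs j(1) order_refl a(1)] by simp
  qed
  have lr_I: "l * r \<in> ?I" by (rule polys.lin_gen) simp
  have ann: "a * u \<in> ?I \<longleftrightarrow> (\<exists>b\<in>polys n. a - b * v \<in> ?I)"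
    if a: "a \<in> polys n" and uv: "u * v = l * r" "u \<in> polys n" "v \<in> polys n" for a u v
  proof
    assume "a * u \<in> ?I"
    then obtain t b where tb: "a * u = t + l * r * b" "t \<in> lin (polys n) S" "b \<in> polys n" by auto
    \<comment> \<open>It is \<open>l * r\<close>, not \<open>u\<close> itself, that is known to be a
      nonzerodivisor modulo \<open>S\<close>; hence the relation is multiplied by \<open>v\<close>
      before cancelling.\<close>
    have "l * r * (a - b * v) = v * (a * u - l * r * b)"
      unfolding uv(1)[symmetric] by (simp add: algebra_simps)
    then have "l * r * (a - b * v) = v * t" using tb(1) by simp
    also have "\<dots> \<in> lin (polys n) S" using tb(2) uv(3) by (rule polys.lin_mult)
    finally have "l * r * (a - b * v) \<in> lin (polys n) S" .
    moreover have "a - b * v \<in> polys n" using a tb(3) uv(3) by simp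
    ultimately have "a - b * v \<in> lin (polys n) S" using nzd by blast
    then show "\<exists>b\<in>polys n. a - b * v \<in> ?I" using tb(3) polys.lin_Cons by blast
  next
    assume "\<exists>b\<in>polys n. a - b * v \<in> ?I"
    then obtain b where b: "b \<in> polys n" "a - b * v \<in> ?I" by blast
    have "a * u = u * (a - b * v) + b * (l * r)" unfolding uv(1)[symmetric] by (simp add: algebra_simps)
    also have "\<dots> \<in> ?I"
      by (rule polys.lin_add[OF polys.lin_mult[OF b(2) uv(2)] polys.lin_mult[OF lr_I b(1)]])
    finally show "a * u \<in> ?I" .
  qed
  \<comment> \<open>The ideal has no elements with a nonzero part of degree 1, being generated by
    quadratic forms.\<close>
  have notin: "u \<notin> ?I" if "homogeneous 1 u" "u \<noteq> 0" for u
    using part_lin_low[OF hom, of u n 1] part_homogeneous[OF that(1), of 1] that(2) unfolding I_eq by auto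
  have SP: "set (l * r # S) \<subseteq> polys n" using lP rsD(1) by (auto simp: set_fs)
  have "exact_zero_divisor (poly_ring n Quot ?I) (a_r_coset (poly_ring n) ?I l)"
    unfolding exact_zero_divisor_lin_iff[OF SP lP(1)]
  proof (intro conjI bexI ballI)
    show "l \<notin> ?I" "r \<notin> ?I" using notin lh l(2) r(2) by blast+
    show "a * l \<in> ?I \<longleftrightarrow> (\<exists>b\<in>polys n. a - b * r \<in> ?I)" if "a \<in> polys n" for a
      by (rule ann[OF that refl lP])
    show "a * r \<in> ?I \<longleftrightarrow> (\<exists>b\<in>polys n. a - b * l \<in> ?I)" if "a \<in> polys n" for a
      by (rule ann[OF that mult.commute lP(2,1)])
  qed (rule lP(2))
  then show ?thesis unfolding quot_alg_def genideal_eq_lin[OF rsD(1)] I_eq .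
qed

section \<open>Bihomogeneous ideals\<close>

text \<open>Gaussian elimination: an equation with a nonzero entry at \<open>i0\<close> is solved
  for the unknown \<open>i0\<close>, which is substituted into the others.\<close>

lemma nontrivial_solution:
  fixes m :: "'i \<Rightarrow> 'j \<Rightarrow> 'k::field"
  assumes "finite J" "finite I" "card J < card I"
  shows "\<exists>c. (\<exists>i\<in>I. c i \<noteq> 0) \<and> (\<forall>j\<in>J. (\<Sum>i\<in>I. c i * m i j) = 0)"
  using assms
proof (induction J arbitrary: I m rule: finite_induct)
  case empty
  then obtain i where "i \<in> I" by fastforce
  then show ?case by (intro exI[of _ "\<lambda>_. 1"]) auto
next
  case (insert j J)
  show ?case
  proof (cases "\<forall>i\<in>I. m i j = 0")
    case True
    with insert.IH[of I m] insert show ?thesis by auto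
  next
    case False
    then obtain i0 where i0: "i0 \<in> I" "m i0 j \<noteq> 0" by blast
    define m' where "m' i j' = m i j' - m i j / m i0 j * m i0 j'" for i j'
    have "finite (I - {i0})" "card J < card (I - {i0})" using insert i0 by auto
    then obtain c where c: "\<exists>i\<in>I - {i0}. c i \<noteq> 0" "\<forall>j'\<in>J. (\<Sum>i\<in>I - {i0}. c i * m' i j') = 0"
      using insert.IH[of "I - {i0}" m'] by blast
    define s where "s = (\<Sum>i\<in>I - {i0}. c i * m i j)"
    define c' where "c' i = (if i = i0 then - s / m i0 j else c i)" for i
    have eq: "(\<Sum>i\<in>I. c' i * m i j') = (\<Sum>i\<in>I - {i0}. c i * m i j') - s / m i0 j * m i0 j'" for j'
    proof -
      have "(\<Sum>i\<in>I. c' i * m i j') = c' i0 * m i0 j' + (\<Sum>i\<in>I - {i0}. c' i * m i j')"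
        using insert i0 by (intro sum.remove) auto
      also have "(\<Sum>i\<in>I - {i0}. c' i * m i j') = (\<Sum>i\<in>I - {i0}. c i * m i j')"
        by (intro sum.cong) (auto simp: c'_def)
      finally show ?thesis by (simp add: c'_def)
    qed
    have "(\<Sum>i\<in>I. c' i * m i j') = 0" if "j' \<in> insert j J" for j'
    proof (cases "j' = j")
      case True
      then show ?thesis using i0 by (simp add: eq s_def)
    next
      case False
      then have "0 = (\<Sum>i\<in>I - {i0}. c i * m' i j')" using c(2) that by auto
      also have "\<dots> = (\<Sum>i\<in>I - {i0}. c i * m i j') - (\<Sum>i\<in>I - {i0}. c i * m i j / m i0 j * m i0 j')"
        by (simp add: m'_def algebra_simps sum_subtractf)
      also have "(\<Sum>i\<in>I - {i0}. c i * m i j / m i0 j * m i0 j') = s / m i0 j * m i0 j'"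
        by (simp add: s_def sum_divide_distrib sum_distrib_right)
      finally show ?thesis by (simp add: eq)
    qed
    moreover have "\<exists>i\<in>I. c' i \<noteq> 0" using c(1) by (auto simp: c'_def)
    ultimately show ?thesis by blast
  qed
qed

section \<open>Bidegrees with respect to two blocks of variables\<close>

definition deg_on :: "nat set \<Rightarrow> (nat \<Rightarrow>\<^sub>0 nat) \<Rightarrow> nat" where
  "deg_on S m = (\<Sum>i\<in>S. Poly_Mapping.lookup m i)"

lemma deg_on_add: "deg_on S (a + b) = deg_on S a + deg_on S b"
  by (simp add: deg_on_def lookup_add sum.distrib)

lemma deg_on_zero [simp]: "deg_on S 0 = 0"
  by (simp add: deg_on_def)

definition mons :: "nat set \<Rightarrow> nat set \<Rightarrow> nat \<Rightarrow> nat \<Rightarrow> (nat \<Rightarrow>\<^sub>0 nat) set" where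
  "mons A B d e = {m. Poly_Mapping.keys m \<subseteq> A \<union> B \<and> deg_on A m = d \<and> deg_on B m = e}"

definition bih :: "nat set \<Rightarrow> nat set \<Rightarrow> nat \<Rightarrow> nat \<Rightarrow> 'k::comm_ring_1 mpoly set" where
  "bih A B d e = {p. Poly_Mapping.keys p \<subseteq> mons A B d e}"

lemma mons_swap: "mons A B d e = mons B A e d"
  by (auto simp: mons_def)

lemma bih_swap: "bih A B d e = bih B A e d"
  by (simp add: bih_def mons_swap[of A])

lemma mons_add: "a \<in> mons A B d e \<Longrightarrow> b \<in> mons A B d' e' \<Longrightarrow> a + b \<in> mons A B (d + d') (e + e')"
  using keys_add[of a b] by (auto simp: mons_def deg_on_add)

lemma bih_zero [simp]: "0 \<in> bih A B d e" by (simp add: bih_def)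

lemma bih_add: "p \<in> bih A B d e \<Longrightarrow> q \<in> bih A B d e \<Longrightarrow> p + q \<in> bih A B d e"
  using keys_add[of p q] by (auto simp: bih_def)

lemma bih_mult:
  assumes "p \<in> bih A B d e" "q \<in> bih A B d' e'" shows "p * q \<in> bih A B (d + d') (e + e')"
  unfolding bih_def
proof safe
  fix m assume "m \<in> Poly_Mapping.keys (p * q)"
  then obtain a b where "m = a + b" "a \<in> Poly_Mapping.keys p" "b \<in> Poly_Mapping.keys q"
    using keys_mult by blast
  then show "m \<in> mons A B (d + d') (e + e')" using assms mons_add unfolding bih_def by blast
qed

lemma bih_single: "m \<in> mons A B d e \<Longrightarrow> Poly_Mapping.single m c \<in> bih A B d e"
  by (auto simp: bih_def)

lemma bih_const [simp]: "const c \<in> bih A B 0 0"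
  by (rule bih_single) (simp add: mons_def)

lemma bih_const_mult: "p \<in> bih A B d e \<Longrightarrow> const c * p \<in> bih A B d e"
  using bih_mult[OF bih_const, of p A B d e c] by simp

lemma bih_minus: "p \<in> bih A B d e \<Longrightarrow> - p \<in> bih A B d e"
  by (auto simp: bih_def in_keys_iff)

lemma bih_diff: "p \<in> bih A B d e \<Longrightarrow> q \<in> bih A B d e \<Longrightarrow> p - q \<in> bih A B d e"
  using bih_add[of p A B d e "- q"] bih_minus[of q A B d e] by simp

lemma bih_sum: "(\<And>i. i \<in> S \<Longrightarrow> f i \<in> bih A B d e) \<Longrightarrow> sum f S \<in> bih A B d e"
  by (induction S rule: infinite_finite_induct) (auto intro: bih_add)

lemma bih_power: "p \<in> bih A B d e \<Longrightarrow> p ^ k \<in> bih A B (k * d) (k * e)"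
proof (induction k)
  case 0
  then show ?case using bih_const[of 1 A B] by simp
next
  case (Suc k)
  then show ?case using bih_mult[of p A B d e "p ^ k"] by simp
qed

lemma deg_on_single: "finite S \<Longrightarrow> deg_on S (Poly_Mapping.single i k) = (if i \<in> S then k else 0)"
  by (simp add: deg_on_def lookup_single when_def)

lemma bih_var_left: "finite A \<Longrightarrow> finite B \<Longrightarrow> A \<inter> B = {} \<Longrightarrow> i \<in> A \<Longrightarrow> var i \<in> bih A B 1 0"
  unfolding var_def by (rule bih_single) (auto simp: mons_def deg_on_single)

lemma bih_var_right: "finite A \<Longrightarrow> finite B \<Longrightarrow> A \<inter> B = {} \<Longrightarrow> i \<in> B \<Longrightarrow> var i \<in> bih A B 0 1"
  unfolding var_def by (rule bih_single) (auto simp: mons_def deg_on_single)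

lemma mons_Suc_left:
  assumes "finite A" "finite B" "A \<inter> B = {}" "m \<in> mons A B (Suc d) e"
  shows "\<exists>i\<in>A. \<exists>m'\<in>mons A B d e. m = Poly_Mapping.single i 1 + m'"
proof -
  have "deg_on A m \<noteq> 0" using assms by (simp add: mons_def)
  then obtain i where i: "i \<in> A" "Poly_Mapping.lookup m i \<noteq> 0"
    unfolding deg_on_def by (meson sum.neutral)
  define m' where "m' = m - Poly_Mapping.single i 1"
  have mm: "m = Poly_Mapping.single i 1 + m'"
    by (rule poly_mapping_eqI) (use i in \<open>auto simp: m'_def lookup_add lookup_minus lookup_single when_def\<close>)
  have "Poly_Mapping.keys m' \<subseteq> Poly_Mapping.keys m"
    by (auto simp: m'_def in_keys_iff lookup_minus)
  moreover have "deg_on A m = 1 + deg_on A m'" "deg_on B m = deg_on B m'"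
    using assms i by (auto simp: mm deg_on_add deg_on_single)
  ultimately have "m' \<in> mons A B d e" using assms(4) by (auto simp: mons_def)
  with mm i show ?thesis by blast
qed

lemma mons_split_left:
  assumes "finite A" "finite B" "A \<inter> B = {}" "m \<in> mons A B (k + d) e"
  shows "\<exists>m1\<in>mons A B k 0. \<exists>m2\<in>mons A B d e. m = m1 + m2"
  using assms(4)
proof (induction k arbitrary: m)
  case 0
  then show ?case by (intro bexI[of _ 0] bexI[of _ m]) (auto simp: mons_def)
next
  case (Suc k)
  then obtain i m' where i: "i \<in> A" "m' \<in> mons A B (k + d) e" "m = Poly_Mapping.single i 1 + m'"
    using mons_Suc_left[OF assms(1-3), of m "k + d" e] by auto
  obtain m1 m2 where m: "m1 \<in> mons A B k 0" "m2 \<in> mons A B d e" "m' = m1 + m2"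
    using Suc.IH[OF i(2)] by blast
  have "Poly_Mapping.single i 1 \<in> mons A B 1 0"
    using assms i(1) by (auto simp: mons_def deg_on_single)
  then have "Poly_Mapping.single i 1 + m1 \<in> mons A B (Suc k) 0" using mons_add m(1) by fastforce
  then show ?case using m i(3) by (metis add.assoc)
qed

lemma mons_split:
  assumes "finite A" "finite B" "A \<inter> B = {}" "m \<in> mons A B (k + d) (l + e)"
  shows "\<exists>m1\<in>mons A B k l. \<exists>m2\<in>mons A B d e. m = m1 + m2"
proof -
  obtain m1 m2 where m: "m1 \<in> mons A B k 0" "m2 \<in> mons A B d (l + e)" "m = m1 + m2"
    using mons_split_left[OF assms(1-4)] by blast
  have "m2 \<in> mons B A (l + e) d" "B \<inter> A = {}" using m(2) assms mons_swap by auto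
  from mons_split_left[OF assms(2,1) this(2,1)]
  obtain m3 m4 where m': "m3 \<in> mons B A l 0" "m4 \<in> mons B A e d" "m2 = m3 + m4"
    by blast
  have "m1 + m3 \<in> mons A B k l" using mons_add[OF m(1), of m3 0 l] m'(1) mons_swap by auto
  then show ?thesis using m m' mons_swap by (metis add.assoc)
qed

lemma finite_mons:
  assumes "finite A" "finite B" shows "finite (mons A B d e)"
proof -
  let ?F = "{f. \<forall>x. (x \<in> A \<union> B \<longrightarrow> f x \<in> {..d + e}) \<and> (x \<notin> A \<union> B \<longrightarrow> f x = (0::nat))}"
  have "Poly_Mapping.lookup m \<in> ?F" if m: "m \<in> mons A B d e" for m
  proof -
    have "Poly_Mapping.lookup m x \<le> d + e" if "x \<in> A \<union> B" for x
    proof -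
      have "Poly_Mapping.lookup m x \<le> deg_on A m \<or> Poly_Mapping.lookup m x \<le> deg_on B m"
        using that assms unfolding deg_on_def by (auto intro!: member_le_sum)
      then show ?thesis using m by (auto simp: mons_def)
    qed
    moreover have "Poly_Mapping.lookup m x = 0" if "x \<notin> A \<union> B" for x
      using that m by (auto simp: mons_def in_keys_iff)
    ultimately show ?thesis by auto
  qed
  then have "Poly_Mapping.lookup ` mons A B d e \<subseteq> ?F" by (rule image_subsetI)
  moreover have "finite ?F" using assms by (intro finite_set_of_finite_funs) auto
  ultimately have "finite (Poly_Mapping.lookup ` mons A B d e)" by (rule finite_subset)
  then show ?thesis by (rule finite_imageD) (auto intro!: inj_onI poly_mapping_eqI)
qed

lemma bih_expand:
  "finite (mons A B d e) \<Longrightarrow> p \<in> bih A B d e \<Longrightarrow>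
   (\<Sum>m\<in>mons A B d e. Poly_Mapping.single m (Poly_Mapping.lookup p m)) = p"
  by (subst (2) poly_mapping_sum_single[of p, symmetric], rule sum.mono_neutral_right)
     (auto simp: bih_def in_keys_iff)

text \<open>A bihomogeneous ideal is given by its graded pieces: (d, e, p) stands for p in degree (d, e).\<close>

definition bideal :: "nat set \<Rightarrow> nat set \<Rightarrow> (nat \<times> nat \<times> 'k::comm_ring_1 mpoly) set \<Rightarrow> bool" where
  "bideal A B I \<longleftrightarrow>
     (\<forall>d e. (d, e, 0) \<in> I) \<and> (\<forall>d e p. (d, e, p) \<in> I \<longrightarrow> p \<in> bih A B d e) \<and>
     (\<forall>d e p q. (d, e, p) \<in> I \<longrightarrow> (d, e, q) \<in> I \<longrightarrow> (d, e, p + q) \<in> I) \<and>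
     (\<forall>d e d' e' p q. (d, e, p) \<in> I \<longrightarrow> q \<in> bih A B d' e' \<longrightarrow> (d' + d, e' + e, q * p) \<in> I)"

text \<open>The irrelevant ideal is generated by the products of a variable from A and one from B,
  and its power of exponent d contains exactly all forms in degree (d, d). So the condition says
  that no power of the irrelevant ideal is contained in I.\<close>

definition relevant :: "nat set \<Rightarrow> nat set \<Rightarrow> (nat \<times> nat \<times> 'k::comm_ring_1 mpoly) set \<Rightarrow> bool" where
  "relevant A B I \<longleftrightarrow> (\<forall>d. \<exists>p\<in>bih A B d d. (d, d, p) \<notin> I)"

locale two_blocks =
  fixes A B :: "nat set"
  assumes finA [simp]: "finite A" and finB [simp]: "finite B" and disj: "A \<inter> B = {}"
begin

lemma bidealD:
  assumes "bideal A B I"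
  shows "(d, e, 0) \<in> I" "(d, e, p) \<in> I \<Longrightarrow> p \<in> bih A B d e"
    "(d, e, p) \<in> I \<Longrightarrow> (d, e, q) \<in> I \<Longrightarrow> (d, e, p + q) \<in> I"
    "(d, e, p) \<in> I \<Longrightarrow> r \<in> bih A B d' e' \<Longrightarrow> (d' + d, e' + e, r * p) \<in> I"
    "(d, e, p) \<in> I \<Longrightarrow> (d, e, const c * p) \<in> I"
    "(d, e, p) \<in> I \<Longrightarrow> (d, e, q) \<in> I \<Longrightarrow> (d, e, p - q) \<in> I"
proof -
  show 1: "(d, e, 0) \<in> I" "(d, e, p) \<in> I \<Longrightarrow> p \<in> bih A B d e" for d e p
    using assms unfolding bideal_def by auto
  show 2: "(d, e, p) \<in> I \<Longrightarrow> (d, e, q) \<in> I \<Longrightarrow> (d, e, p + q) \<in> I" for d e p q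
    using assms unfolding bideal_def by blast
  show 3: "(d, e, p) \<in> I \<Longrightarrow> r \<in> bih A B d' e' \<Longrightarrow> (d' + d, e' + e, r * p) \<in> I" for d e p r d' e'
    using assms unfolding bideal_def by blast
  show 4: "(d, e, p) \<in> I \<Longrightarrow> (d, e, const c * p) \<in> I" for d e p c
    using 3[of d e p "const c" 0 0] by simp
  show "(d, e, p) \<in> I \<Longrightarrow> (d, e, q) \<in> I \<Longrightarrow> (d, e, p - q) \<in> I"
    using 2[of d e p "- q"] 4[of d e q "-1"] by (simp add: single_uminus)
qed

lemma bideal_sum:
  "bideal A B I \<Longrightarrow> (\<And>i. i \<in> S \<Longrightarrow> (d, e, f i) \<in> I) \<Longrightarrow> (d, e, sum f S) \<in> I"
  by (induction S rule: infinite_finite_induct) (auto intro: bidealD)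

lemma bideal_contains_bih:
  assumes "bideal A B I" "\<And>m. m \<in> mons A B d e \<Longrightarrow> (d, e, Poly_Mapping.single m 1) \<in> I" "p \<in> bih A B d e"
  shows "(d, e, p) \<in> I"
proof -
  have "(d, e, Poly_Mapping.single m (Poly_Mapping.lookup p m)) \<in> I" if "m \<in> mons A B d e" for m
    using bidealD(5)[OF assms(1) assms(2)[OF that], of "Poly_Mapping.lookup p m"] by (simp add: mult_single)
  then have "(d, e, \<Sum>m\<in>mons A B d e. Poly_Mapping.single m (Poly_Mapping.lookup p m)) \<in> I"
    using assms(1) by (intro bideal_sum)
  then show ?thesis using bih_expand[OF finite_mons assms(3)] by simp
qed

text \<open>Zorn's lemma applies because irrelevance is witnessed by finitely many elements: the
  monomials of one degree (d, d). If the union of a chain contains them all, so does a member of the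
  chain.\<close>

lemma ex_maximal:
  fixes J :: "(nat \<times> nat \<times> 'k::comm_ring_1 mpoly) set"
  assumes "bideal A B J" "relevant A B J"
  shows "\<exists>M. bideal A B M \<and> relevant A B M \<and> J \<subseteq> M \<and>
    (\<forall>I. bideal A B I \<longrightarrow> relevant A B I \<longrightarrow> M \<subseteq> I \<longrightarrow> I = M)"
proof -
  define \<A> where "\<A> = {I. bideal A B I \<and> relevant A B I \<and> J \<subseteq> I}"
  have "\<exists>M\<in>\<A>. \<forall>X\<in>\<A>. M \<subseteq> X \<longrightarrow> X = M"
  proof (rule subset_Zorn_nonempty)
    show "\<A> \<noteq> {}" using assms by (auto simp: \<A>_def)
    fix \<C> assume \<C>: "\<C> \<noteq> {}" "subset.chain \<A> \<C>"
    then have sub: "bideal A B I" "relevant A B I" "J \<subseteq> I" if "I \<in> \<C>" for I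
      using that by (auto simp: \<A>_def subset_chain_def)
    have bid: "bideal A B (\<Union>\<C>)"
      unfolding bideal_def
    proof (intro conjI allI impI)
      show "(d, e, 0) \<in> \<Union>\<C>" for d e using \<C>(1) sub(1) bidealD(1) by blast
      show "p \<in> bih A B d e" if "(d, e, p) \<in> \<Union>\<C>" for d e p using that sub(1) bidealD(2) by blast
      show "(d, e, p + q) \<in> \<Union>\<C>" if pq: "(d, e, p) \<in> \<Union>\<C>" "(d, e, q) \<in> \<Union>\<C>" for d e p q
      proof -
        obtain I1 I2 where "(d, e, p) \<in> I1" "(d, e, q) \<in> I2" "I1 \<in> \<C>" "I2 \<in> \<C>" using pq by blast
        moreover from this have "I1 \<subseteq> I2 \<or> I2 \<subseteq> I1" using \<C>(2) unfolding subset.chain_def by blast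
        ultimately obtain I where "I \<in> \<C>" "(d, e, p) \<in> I" "(d, e, q) \<in> I" by blast
        then show ?thesis using sub(1) bidealD(3) by blast
      qed
      show "(d' + d, e' + e, q * p) \<in> \<Union>\<C>" if "(d, e, p) \<in> \<Union>\<C>" "q \<in> bih A B d' e'" for d e d' e' p q
        using that sub(1) bidealD(4) by blast
    qed
    have "relevant A B (\<Union>\<C>)"
    proof (rule ccontr)
      assume "\<not> relevant A B (\<Union>\<C>)"
      then obtain d where d: "\<And>p. p \<in> bih A B d d \<Longrightarrow> (d, d, p) \<in> \<Union>\<C>"
        unfolding relevant_def by blast
      define F :: "(nat \<times> nat \<times> 'k mpoly) set" where "F = (\<lambda>m. (d, d, Poly_Mapping.single m 1)) ` mons A B d d"
      have "finite F" by (simp add: F_def finite_mons)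
      moreover have "F \<subseteq> \<Union>\<C>" using d bih_single unfolding F_def by blast
      ultimately obtain I where I: "I \<in> \<C>" "F \<subseteq> I"
        using finite_subset_Union_chain[of F \<C> \<A>] \<C> by blast
      then have "(d, d, p) \<in> I" if "p \<in> bih A B d d" for p
        using bideal_contains_bih[OF sub(1)[OF I(1)] _ that] by (auto simp: F_def)
      then show False using sub(2)[OF I(1)] unfolding relevant_def by blast
    qed
    with bid show "\<Union>\<C> \<in> \<A>" using \<C>(1) sub(3) by (auto simp: \<A>_def)
  qed
  then obtain M where M: "M \<in> \<A>" "\<forall>X\<in>\<A>. M \<subseteq> X \<longrightarrow> X = M" by blast
  have "I = M" if "bideal A B I" "relevant A B I" "M \<subseteq> I" for I
    using M that unfolding \<A>_def by (metis (mono_tags, lifting) mem_Collect_eq subset_trans)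
  then show ?thesis using M(1) unfolding \<A>_def mem_Collect_eq by (intro exI[of _ M]) simp
qed

end

section \<open>Maximal relevant ideals and their points\<close>

locale maximal_bideal = two_blocks A B for A B :: "nat set" +
  fixes M :: "(nat \<times> nat \<times> 'k::alg_closed_field mpoly) set"
  assumes bideal: "bideal A B M" and relevant: "relevant A B M"
    and maximal: "bideal A B I \<Longrightarrow> relevant A B I \<Longrightarrow> M \<subseteq> I \<Longrightarrow> I = M"
begin

lemmas M_D = bidealD[OF bideal]

text \<open>Adjoining \<open>u\<close> to M gives a strictly larger bihomogeneous ideal. By
  maximality it is irrelevant and contains all forms in some degree (d, d).\<close>

lemma extend:
  assumes u: "u \<in> bih A B a b" "(a, b, u) \<notin> M"
  shows "\<exists>d. \<forall>f\<in>bih A B d d. \<exists>p q. f = p + q * u \<and> (d, d, p) \<in> M \<and>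
    (q = 0 \<or> (\<exists>d' e'. q \<in> bih A B d' e' \<and> d' + a = d \<and> e' + b = d))"
proof -
  \<comment> \<open>The cofactor of \<open>u\<close> in degree (d, e) has degree (d - a, e - b). It
    is written additively, and the alternative \<open>q = 0\<close> covers degrees too small to
    contain multiples of \<open>u\<close>.\<close>
  define ok where "ok d e q \<longleftrightarrow> q = 0 \<or> (\<exists>d' e'. q \<in> bih A B d' e' \<and> d' + a = d \<and> e' + b = e)"
    for d e :: nat and q :: "'k mpoly"
  have ok_add: "ok d e (q + r)" if "ok d e q" "ok d e r" for d e q r
    using that unfolding ok_def by (auto intro: bih_add)
  have ok_mult: "ok (d' + d) (e' + e) (r * q)" if "ok d e q" "r \<in> bih A B d' e'" for d e d' e' q r
    using that(1)
  proof (unfold ok_def, elim disjE exE conjE)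
    fix x y assume "q \<in> bih A B x y" "x + a = d" "y + b = e"
    then show "r * q = 0 \<or> (\<exists>x y. r * q \<in> bih A B x y \<and> x + a = d' + d \<and> y + b = e' + e)"
      using bih_mult[OF that(2)] by (metis add.assoc)
  qed simp
  have ok_bih: "q * u \<in> bih A B d e" if "ok d e q" for d e q
    using that bih_mult[OF _ u(1)] unfolding ok_def by auto
  define I where "I = {(d, e, p + q * u) | d e p q. (d, e, p) \<in> M \<and> ok d e q}"
  have I_iff: "(d, e, f) \<in> I \<longleftrightarrow> (\<exists>p q. f = p + q * u \<and> (d, e, p) \<in> M \<and> ok d e q)" for d e f
    by (auto simp: I_def)
  have "bideal A B I"
    unfolding bideal_def
  proof (intro conjI allI impI)
    show "(d, e, 0) \<in> I" for d e
      unfolding I_iff using M_D(1) by (intro exI[of _ 0]) (auto simp: ok_def)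
    show "p \<in> bih A B d e" if "(d, e, p) \<in> I" for d e p
      using that M_D(2) ok_bih unfolding I_iff by (auto intro: bih_add)
    show "(d, e, f + g) \<in> I" if fg: "(d, e, f) \<in> I" "(d, e, g) \<in> I" for d e f g
    proof -
      obtain p q p' q' where "f = p + q * u" "(d, e, p) \<in> M" "ok d e q"
         "g = p' + q' * u" "(d, e, p') \<in> M" "ok d e q'" using fg unfolding I_iff by blast
      then have "f + g = (p + p') + (q + q') * u" "(d, e, p + p') \<in> M" "ok d e (q + q')"
        using M_D(3) ok_add by (auto simp: algebra_simps)
      then show ?thesis unfolding I_iff by blast
    qed
    show "(d' + d, e' + e, r * f) \<in> I" if fr: "(d, e, f) \<in> I" "r \<in> bih A B d' e'" for d e d' e' f r
    proof -
      obtain p q where "f = p + q * u" "(d, e, p) \<in> M" "ok d e q"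
        using fr(1) unfolding I_iff by blast
      moreover from this have "r * f = r * p + (r * q) * u" by (simp add: algebra_simps)
      ultimately have "r * f = r * p + (r * q) * u" "(d' + d, e' + e, r * p) \<in> M" "ok (d' + d) (e' + e) (r * q)"
        using M_D(4)[OF _ fr(2)] ok_mult[OF _ fr(2)] by blast+
      then show ?thesis unfolding I_iff by blast
    qed
  qed
  moreover have "M \<subseteq> I"
  proof
    fix x assume "x \<in> M"
    moreover obtain d e p where "x = (d, e, p)" by (cases x)
    moreover have "p = p + 0 * u" "ok d e 0" by (auto simp: ok_def)
    ultimately show "x \<in> I" unfolding I_def by blast
  qed
  moreover have "(a, b, u) \<in> I"
    unfolding I_iff ok_def using M_D(1) bih_const[of 1 A B]
    by (intro exI[of _ 0] exI[of _ 1]) auto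
  ultimately have "\<not> relevant A B I" using maximal[of I] u(2) by blast
  then show ?thesis unfolding relevant_def I_iff ok_def by blast
qed

text \<open>If neither factor were in M, then M with \<open>u\<close> would contain all forms of
  some degree (d, d) and M with \<open>v\<close> all those of some degree (e, e). The product of the
  two ideals lies in M because \<open>u * v\<close> does, so M would contain all forms of degree (d
  + e, d + e).\<close>

lemma prime:
  assumes u: "u \<in> bih A B a b" and v: "v \<in> bih A B a' b'" and uv: "(a + a', b + b', u * v) \<in> M"
  shows "(a, b, u) \<in> M \<or> (a', b', v) \<in> M"
proof (rule ccontr)
  assume "\<not> ?thesis"
  then have nu: "(a, b, u) \<notin> M" and nv: "(a', b', v) \<notin> M" by auto
  from extend[OF u nu] obtain d where d: "\<And>f. f \<in> bih A B d d \<Longrightarrow> \<exists>p q. f = p + q * u \<and> (d, d, p) \<in> M \<and>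
    (q = 0 \<or> (\<exists>d' e'. q \<in> bih A B d' e' \<and> d' + a = d \<and> e' + b = d))" by blast
  from extend[OF v nv] obtain e where e: "\<And>f. f \<in> bih A B e e \<Longrightarrow> \<exists>p q. f = p + q * v \<and> (e, e, p) \<in> M \<and>
    (q = 0 \<or> (\<exists>d' e'. q \<in> bih A B d' e' \<and> d' + a' = e \<and> e' + b' = e))" by blast
  have "(d + e, d + e, Poly_Mapping.single m 1) \<in> M" if m: "m \<in> mons A B (d + e) (d + e)" for m
  proof -
    obtain m1 m2 where m12: "m1 \<in> mons A B d d" "m2 \<in> mons A B e e" "m = m1 + m2"
      using mons_split[OF finA finB disj m] by blast
    obtain p q where pq: "Poly_Mapping.single m1 1 = p + q * u" "(d, d, p) \<in> M"
      "q = 0 \<or> (\<exists>d' e'. q \<in> bih A B d' e' \<and> d' + a = d \<and> e' + b = d)"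
      using d[OF bih_single[OF m12(1)], of 1] by blast
    obtain p' q' where pq': "Poly_Mapping.single m2 1 = p' + q' * v" "(e, e, p') \<in> M"
      "q' = 0 \<or> (\<exists>d' e'. q' \<in> bih A B d' e' \<and> d' + a' = e \<and> e' + b' = e)"
      using e[OF bih_single[OF m12(2)], of 1] by blast
    have "q * u = Poly_Mapping.single m1 1 - p" using pq(1) by simp
    then have qu: "q * u \<in> bih A B d d" using bih_diff[OF bih_single[OF m12(1)] M_D(2)[OF pq(2)]] by metis
    have "(d + e, d + e, (q * q') * (u * v)) \<in> M"
    proof (cases "q = 0 \<or> q' = 0")
      case True
      then show ?thesis using M_D(1) by auto
    next
      case False
      then obtain x y x' y' where *: "q \<in> bih A B x y" "x + a = d" "y + b = d"
         "q' \<in> bih A B x' y'" "x' + a' = e" "y' + b' = e" using pq(3) pq'(3) by blast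
      have "((x + x') + (a + a'), (y + y') + (b + b'), (q * q') * (u * v)) \<in> M"
        by (rule M_D(4)[OF uv bih_mult[OF *(1,4)]])
      moreover have "(x + x') + (a + a') = d + e" "(y + y') + (b + b') = d + e" using * by auto
      ultimately show ?thesis by metis
    qed
    moreover have "(d + e, d + e, (q * u) * p') \<in> M" by (rule M_D(4)[OF pq'(2) qu])
    moreover have "(e + d, e + d, Poly_Mapping.single m2 1 * p) \<in> M"
      by (rule M_D(4)[OF pq(2) bih_single[OF m12(2)]])
    ultimately have "(d + e, d + e, Poly_Mapping.single m2 1 * p + ((q * u) * p' + (q * q') * (u * v))) \<in> M"
      by (intro M_D(3)) (auto simp: add.commute)
    moreover have "Poly_Mapping.single m 1 = (p + q * u) * (Poly_Mapping.single m2 1 :: 'k mpoly)"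
      unfolding pq(1)[symmetric] by (simp add: m12(3) mult_single)
    then have "Poly_Mapping.single m 1 = Poly_Mapping.single m2 1 * p + ((q * u) * p' + (q * q') * (u * v))"
      using pq'(1) by (simp add: algebra_simps)
    ultimately show ?thesis by simp
  qed
  then have "(d + e, d + e, f) \<in> M" if "f \<in> bih A B (d + e) (d + e)" for f
    using bideal_contains_bih[OF bideal _ that] by blast
  then show False using relevant unfolding relevant_def by blast
qed

lemma one_notin: "(0, 0, 1) \<notin> M"
proof
  assume "(0, 0, 1) \<in> M"
  then have "(0, 0, f) \<in> M" if "f \<in> bih A B 0 0" for f
    using M_D(4)[of 0 0 1 f 0 0] that by simp
  then show False using relevant unfolding relevant_def by blast
qed

lemma const_cancel:
  assumes "c \<noteq> 0" "(d, e, const c * u) \<in> M" shows "(d, e, u) \<in> M"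
proof -
  have "const (1 / c) * (const c * u) = const (1 / c * c) * u"
    by (simp only: const_mult mult.assoc[symmetric])
  also have "\<dots> = u" using assms(1) by simp
  finally show ?thesis using M_D(5)[OF assms(2), of "1 / c"] by (simp only:)
qed

lemma power_cancel:
  assumes "u \<in> bih A B a b" "(a, b, u) \<notin> M" "v \<in> bih A B d e" "(k * a + d, k * b + e, u ^ k * v) \<in> M"
  shows "(d, e, v) \<in> M"
  using assms(4)
proof (induction k)
  case (Suc k)
  have "u ^ k * v \<in> bih A B (k * a + d) (k * b + e)" by (intro bih_mult bih_power assms)
  moreover have "(a + (k * a + d), b + (k * b + e), u * (u ^ k * v)) \<in> M"
    using Suc.prems by (simp add: mult.assoc add.assoc)
  ultimately have "(k * a + d, k * b + e, u ^ k * v) \<in> M" using prime[OF assms(1)] assms(2) by blast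
  then show ?case by (rule Suc.IH)
qed simp

end

text \<open>The homogenization of \<open>q\<close> to degree \<open>N\<close>, informally z ^ N
  times q (w / z), evaluated at two polynomials.\<close>

definition binary_form :: "nat \<Rightarrow> 'k::comm_ring_1 poly \<Rightarrow> 'k mpoly \<Rightarrow> 'k mpoly \<Rightarrow> 'k mpoly" where
  "binary_form N q w z = (\<Sum>k\<le>N. const (poly.coeff q k) * (w ^ k * z ^ (N - k)))"

lemma binary_form_factor:
  assumes "Polynomial.degree q \<le> N"
  shows "binary_form (Suc N) ([:- x, 1:] * q) w z = (w - const x * z) * binary_form N q w z"
proof -
  have "[:- x, 1:] * q = pCons 0 q - Polynomial.smult x q" by simp
  then have "binary_form (Suc N) ([:- x, 1:] * q) w z
     = (\<Sum>k\<le>Suc N. const (poly.coeff (pCons 0 q) k) * (w ^ k * z ^ (Suc N - k)))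
       - (\<Sum>k\<le>Suc N. const (x * poly.coeff q k) * (w ^ k * z ^ (Suc N - k)))"
    unfolding binary_form_def by (simp only: Polynomial.coeff_diff Polynomial.coeff_smult single_diff left_diff_distrib sum_subtractf)
  also have "(\<Sum>k\<le>Suc N. const (poly.coeff (pCons 0 q) k) * (w ^ k * z ^ (Suc N - k))) = w * binary_form N q w z"
    by (subst sum.atMost_Suc_shift) (simp add: binary_form_def sum_distrib_left mult_ac)
  also have "(\<Sum>k\<le>Suc N. const (x * poly.coeff q k) * (w ^ k * z ^ (Suc N - k)))
     = (\<Sum>k\<le>N. const (x * poly.coeff q k) * (w ^ k * z ^ (Suc N - k)))"
    using assms by (simp add: Polynomial.coeff_eq_0)
  also have "\<dots> = const x * z * binary_form N q w z"
    unfolding binary_form_def sum_distrib_left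
    by (intro sum.cong) (auto simp: Suc_diff_le mult_ac const_mult[symmetric])
  finally show ?thesis by (simp add: left_diff_distrib)
qed

lemma (in two_blocks) two_blocks_swap: "two_blocks B A"
  using disj by unfold_locales auto

text \<open>Exchanging the two degrees transfers every result about the variables of A to those of
  B.\<close>

definition swap_bideal :: "(nat \<times> nat \<times> 'a) set \<Rightarrow> (nat \<times> nat \<times> 'a) set" where
  "swap_bideal I = {(e, d, p) | d e p. (d, e, p) \<in> I}"

lemma swap_bideal_iff [simp]: "(e, d, p) \<in> swap_bideal I \<longleftrightarrow> (d, e, p) \<in> I"
  by (auto simp: swap_bideal_def)

lemma swap_swap_bideal: "swap_bideal (swap_bideal I) = I"
  by (force simp: swap_bideal_def)

lemma bideal_swap: "bideal A B I \<Longrightarrow> bideal B A (swap_bideal I)"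
  unfolding bideal_def swap_bideal_iff bih_swap[of B A] by blast

lemma relevant_swap: "relevant A B I \<Longrightarrow> relevant B A (swap_bideal I)"
  unfolding relevant_def swap_bideal_iff bih_swap[of B A] by blast

lemma (in maximal_bideal) maximal_bideal_swap: "maximal_bideal B A (swap_bideal M)"
proof (intro maximal_bideal.intro maximal_bideal_axioms.intro)
  show "two_blocks B A" by (rule two_blocks_swap)
  show "bideal B A (swap_bideal M)" "relevant B A (swap_bideal M)"
    using bideal relevant bideal_swap relevant_swap by blast+
  fix I :: "(nat \<times> nat \<times> 'k mpoly) set"
  assume I: "bideal B A I" "relevant B A I" "swap_bideal M \<subseteq> I"
  have "M \<subseteq> swap_bideal I"
  proof
    fix x assume "x \<in> M"
    then show "x \<in> swap_bideal I" using I(3) by (cases x) (auto simp: subset_iff)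
  qed
  then have "swap_bideal I = M" using maximal bideal_swap relevant_swap I by blast
  then show "I = swap_bideal M" using swap_swap_bideal by metis
qed

context maximal_bideal
begin

text \<open>A root of \<open>q\<close> splits off a factor of the form w - x z. By primality either
  this factor or the remaining form is in M, and the degree decreases. The process cannot end with a
  nonzero constant, since then a power of \<open>z\<close>, and hence 1, would be in M.\<close>

lemma binary_form_root:
  assumes w: "w \<in> bih A B 1 0" and z: "z \<in> bih A B 1 0" "(1, 0, z) \<notin> M"
    and q: "q \<noteq> 0" "Polynomial.degree q \<le> N" "(N, 0, binary_form N q w z) \<in> M"
  shows "\<exists>c. (1, 0, w - const c * z) \<in> M"
  using q
proof (induction "Polynomial.degree q" arbitrary: q N)
  case 0
  then obtain c where c: "q = [:c:]" "c \<noteq> 0" by (metis Polynomial.degree_eq_zeroE pCons_0_0)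
  have "binary_form N q w z = (\<Sum>k\<le>N. if k = 0 then const c * z ^ N else 0)"
    unfolding binary_form_def by (intro sum.cong) (auto simp: c Polynomial.coeff_pCons split: nat.splits)
  then have "binary_form N q w z = const c * z ^ N" by simp
  then have "(N, 0, z ^ N) \<in> M" using const_cancel[OF c(2)] 0 by metis
  then have "(0, 0, 1) \<in> M"
    using power_cancel[OF z, of 1 0 0 N] bih_const[of 1 A B] by simp
  with one_notin show ?case by blast
next
  case (Suc d)
  then obtain N' where N: "N = Suc N'" by (cases N) auto
  obtain x where "poly q x = 0" using alg_closed_imp_poly_has_root[of q] Suc by auto
  then obtain q' where q': "q = [:- x, 1:] * q'" by (auto simp: poly_eq_0_iff_dvd)
  with Suc have "q' \<noteq> 0" by auto
  then have deg: "Polynomial.degree q = Suc (Polynomial.degree q')" using degree_mult_eq[of "[:- x, 1:]" q'] by (simp add: q')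
  then have "Polynomial.degree q' \<le> N'" using Suc N by simp
  then have eq: "binary_form N q w z = (w - const x * z) * binary_form N' q' w z"
    unfolding N q' by (rule binary_form_factor)
  have "(1 + N', 0 + 0, (w - const x * z) * binary_form N' q' w z) \<in> M"
    using Suc.prems(3) by (simp add: N flip: eq)
  moreover have wz: "w - const x * z \<in> bih A B 1 0" using w z by (intro bih_diff bih_const_mult)
  moreover have "w ^ k * z ^ (N' - k) \<in> bih A B N' 0" if "k \<le> N'" for k
    using bih_mult[OF bih_power[OF w, of k] bih_power[OF z(1), of "N' - k"]] that by simp
  then have "binary_form N' q' w z \<in> bih A B N' 0"
    unfolding binary_form_def by (intro bih_sum bih_const_mult) auto
  ultimately have "(1, 0, w - const x * z) \<in> M \<or> (N', 0, binary_form N' q' w z) \<in> M"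
    using prime[OF wz] by blast
  then show ?case using Suc.hyps(1)[of q' N'] deg Suc.hyps(2) \<open>q' \<noteq> 0\<close> \<open>Polynomial.degree q' \<le> N'\<close> by auto
qed

text \<open>Modulo the prime ideal and the variable z everything is bounded, so the pieces of degree (D + t, D)
  are z ^ t times those of degree (D, D); hence the monomials in w and z become linearly dependent.\<close>

lemma variable_ratio:
  assumes i: "i \<in> A" "(1, 0, var i) \<notin> M" and i': "i' \<in> A" and j: "j \<in> B" "(0, 1, var j) \<notin> M"
  shows "\<exists>c. (1, 0, var i' - const c * var i) \<in> M"
proof -
  define z w y where "z = (var i :: 'k mpoly)" and "w = (var i' :: 'k mpoly)" and "y = (var j :: 'k mpoly)"
  have z: "z \<in> bih A B 1 0" "(1, 0, z) \<notin> M" and w: "w \<in> bih A B 1 0"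
    and y: "y \<in> bih A B 0 1" "(0, 1, y) \<notin> M"
    using i i' j bih_var_left[OF finA finB disj] bih_var_right[OF finA finB disj] by (auto simp: z_def w_def y_def)
  obtain D where D: "\<And>f. f \<in> bih A B D D \<Longrightarrow> \<exists>p q. f = p + q * z \<and> (D, D, p) \<in> M \<and>
    (q = 0 \<or> (\<exists>d' e'. q \<in> bih A B d' e' \<and> d' + 1 = D \<and> e' + 0 = D))"
    using extend[OF z] by blast
  \<comment> \<open>A monomial of first degree larger than \<open>D\<close> has a factor of degree
    (D, D). Modulo M this factor is a multiple of \<open>z\<close>, and one power of
    \<open>z\<close> splits off.\<close>
  have monomial: "\<exists>g\<in>bih A B (D + t) D. (Suc (D + t), D, Poly_Mapping.single m c - z * g) \<in> M"
    if m: "m \<in> mons A B (Suc (D + t)) D" for m c t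
  proof -
    have "m \<in> mons A B (D + Suc t) (D + 0)" using m by simp
    then obtain m1 m2 where m12: "m1 \<in> mons A B D D" "m2 \<in> mons A B (Suc t) 0" "m = m1 + m2"
      using mons_split[OF finA finB disj] by blast
    obtain p q where pq: "Poly_Mapping.single m1 1 = p + q * z" "(D, D, p) \<in> M"
      "q = 0 \<or> (\<exists>d' e'. q \<in> bih A B d' e' \<and> d' + 1 = D \<and> e' + 0 = D)"
      using D[OF bih_single[OF m12(1)], of 1] by blast
    let ?s = "Poly_Mapping.single m2 c"
    have s: "?s \<in> bih A B (Suc t) 0" by (rule bih_single[OF m12(2)])
    have "?s * q \<in> bih A B (D + t) D"
    proof (cases "q = 0")
      case False
      then obtain d' where "q \<in> bih A B d' D" "Suc d' = D" using pq(3) by auto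
      then have "?s * q \<in> bih A B (Suc t + d') (0 + D)" "Suc t + d' = D + t"
        using bih_mult[OF s] by auto
      then show ?thesis by (metis add_0)
    qed simp
    moreover have "Poly_Mapping.single m c = ?s * (p + q * z)"
      unfolding pq(1)[symmetric] by (simp add: m12(3) mult_single add.commute)
    then have "Poly_Mapping.single m c - z * (?s * q) = ?s * p"
      by (simp add: algebra_simps)
    moreover have "(Suc t + D, 0 + D, ?s * p) \<in> M" by (rule M_D(4)[OF pq(2) s])
    ultimately show ?thesis by (intro bexI[of _ "?s * q"]) (simp_all add: add.commute)
  qed
  have step: "\<exists>g\<in>bih A B (D + t) D. (Suc (D + t), D, h - z * g) \<in> M"
    if h: "h \<in> bih A B (Suc (D + t)) D" for h t
  proof -
    have "\<forall>m\<in>mons A B (Suc (D + t)) D. \<exists>g. g \<in> bih A B (D + t) D \<and>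
        (Suc (D + t), D, Poly_Mapping.single m (Poly_Mapping.lookup h m) - z * g) \<in> M"
      using monomial by blast
    from bchoice[OF this] obtain G where G: "\<And>m. m \<in> mons A B (Suc (D + t)) D \<Longrightarrow> G m \<in> bih A B (D + t) D"
      "\<And>m. m \<in> mons A B (Suc (D + t)) D \<Longrightarrow>
         (Suc (D + t), D, Poly_Mapping.single m (Poly_Mapping.lookup h m) - z * G m) \<in> M"
      by blast
    let ?S = "mons A B (Suc (D + t)) D"
    have "(Suc (D + t), D, \<Sum>m\<in>?S. Poly_Mapping.single m (Poly_Mapping.lookup h m) - z * G m) \<in> M"
      using G(2) by (intro bideal_sum[OF bideal])
    also have "(\<Sum>m\<in>?S. Poly_Mapping.single m (Poly_Mapping.lookup h m) - z * G m) = h - z * sum G ?S"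
      using bih_expand[OF finite_mons[OF finA finB] h] by (simp add: sum_subtractf sum_distrib_left)
    finally show ?thesis using G(1) by (intro bexI[of _ "sum G ?S"] bih_sum) auto
  qed
  have reduce: "\<exists>g\<in>bih A B D D. (D + t, D, h - z ^ t * g) \<in> M" if "h \<in> bih A B (D + t) D" for h t
    using that
  proof (induction t arbitrary: h)
    case 0
    then show ?case using M_D(1) by (intro bexI[of _ h]) auto
  next
    case (Suc t)
    then obtain g where g: "g \<in> bih A B (D + t) D" "(Suc (D + t), D, h - z * g) \<in> M"
      using step[of h t] unfolding add_Suc_right by blast
    obtain g' where g': "g' \<in> bih A B D D" "(D + t, D, g - z ^ t * g') \<in> M" using Suc.IH[OF g(1)] by blast
    have "(1 + (D + t), 0 + D, z * (g - z ^ t * g')) \<in> M" by (rule M_D(4)[OF g'(2) z(1)])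
    then have "(Suc (D + t), D, (h - z * g) + z * (g - z ^ t * g')) \<in> M" using g(2) by (intro M_D(3)) auto
    then show ?case using g'(1) by (intro bexI[of _ g']) (auto simp: algebra_simps)
  qed
  \<comment> \<open>There are \<open>N + 1\<close> forms \<open>u k\<close>, whose reductions
    \<open>g k\<close> lie in a space of dimension \<open>N\<close>. The factor \<open>y ^ D\<close>
    and the additional exponent \<open>D\<close> of \<open>z\<close> raise w ^ k z ^ (N - k) to
    degree (D + N, D), where the reduction is available.\<close>
  define N where "N = card (mons A B D D)"
  define u where "u k = w ^ k * z ^ (D + N - k) * y ^ D" for k
  have "u k \<in> bih A B (D + N) D" if "k \<le> N" for k
    using bih_mult[OF bih_mult[OF bih_power[OF w, of k] bih_power[OF z(1), of "D + N - k"]] bih_power[OF y(1), of D]] that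
    by (simp add: u_def)
  then have "\<exists>g. k \<le> N \<longrightarrow> g \<in> bih A B D D \<and> (D + N, D, u k - z ^ N * g) \<in> M" for k
    using reduce[of "u k" N] by blast
  then obtain g where g: "\<And>k. k \<le> N \<Longrightarrow> g k \<in> bih A B D D" "\<And>k. k \<le> N \<Longrightarrow> (D + N, D, u k - z ^ N * g k) \<in> M"
    by metis
  obtain c where c: "\<exists>k\<in>{..N}. c k \<noteq> 0"
      "\<forall>m\<in>mons A B D D. (\<Sum>k\<in>{..N}. c k * Poly_Mapping.lookup (g k) m) = 0"
    using nontrivial_solution[of "mons A B D D" "{..N}" "\<lambda>k m. Poly_Mapping.lookup (g k) m"]
      finite_mons[OF finA finB] by (auto simp: N_def)
  have rel: "(\<Sum>k\<le>N. const (c k) * g k) = 0"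
  proof (rule poly_mapping_eqI)
    fix m
    have "Poly_Mapping.lookup (g k) m = 0" if "m \<notin> mons A B D D" "k \<le> N" for k
      using g(1)[OF that(2)] that(1) by (auto simp: bih_def in_keys_iff)
    then show "Poly_Mapping.lookup (\<Sum>k\<le>N. const (c k) * g k) m = Poly_Mapping.lookup 0 m"
      using c(2) by (cases "m \<in> mons A B D D") (auto simp: lookup_sum lookup_const_mult)
  qed
  have "(D + N, D, \<Sum>k\<le>N. const (c k) * (u k - z ^ N * g k)) \<in> M"
    using g(2) by (intro bideal_sum[OF bideal] M_D(5)) auto
  moreover have "(\<Sum>k\<le>N. const (c k) * (u k - z ^ N * g k))
      = (\<Sum>k\<le>N. const (c k) * u k) - z ^ N * (\<Sum>k\<le>N. const (c k) * g k)"
    by (simp add: right_diff_distrib sum_subtractf sum_distrib_left mult_ac)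
  ultimately have 1: "(D + N, D, \<Sum>k\<le>N. const (c k) * u k) \<in> M" by (simp add: rel)
  define q where "q = (\<Sum>k\<le>N. Polynomial.monom (c k) k)"
  have coeff_q: "poly.coeff q k = (if k \<le> N then c k else 0)" for k
    by (auto simp: q_def Polynomial.coeff_sum Polynomial.coeff_monom)
  have q: "q \<noteq> 0" "Polynomial.degree q \<le> N"
    using c(1) coeff_q by (auto simp: poly_eq_iff intro!: Polynomial.degree_le)
  \<comment> \<open>The surplus \<open>z ^ D * y ^ D\<close> is pulled out. Since neither variable
    is in M, primality cancels it and leaves the binary form.\<close>
  have "(\<Sum>k\<le>N. const (c k) * u k) = (\<Sum>k\<le>N. z ^ D * (y ^ D * (const (poly.coeff q k) * (w ^ k * z ^ (N - k)))))"
    by (intro sum.cong) (auto simp: u_def coeff_q power_add mult_ac Nat.add_diff_assoc simp flip: power_add)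
  also have "\<dots> = z ^ D * (y ^ D * binary_form N q w z)"
    by (simp only: binary_form_def sum_distrib_left)
  finally have 2: "(D * 1 + N, D * 0 + D, z ^ D * (y ^ D * binary_form N q w z)) \<in> M" using 1 by simp
  have "w ^ k * z ^ (N - k) \<in> bih A B N 0" if "k \<le> N" for k
    using bih_mult[OF bih_power[OF w, of k] bih_power[OF z(1), of "N - k"]] that by simp
  then have bf: "binary_form N q w z \<in> bih A B N 0"
    unfolding binary_form_def by (intro bih_sum bih_const_mult) auto
  have "y ^ D * binary_form N q w z \<in> bih A B N D"
    using bih_mult[OF bih_power[OF y(1), of D] bf] by simp
  from power_cancel[OF z this 2] have "(D * 0 + N, D * 1 + 0, y ^ D * binary_form N q w z) \<in> M" by simp
  from power_cancel[OF y bf this] have "(N, 0, binary_form N q w z) \<in> M" .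
  from binary_form_root[OF w z q this] show ?thesis by (simp add: w_def z_def)
qed

text \<open>Every monomial of degree (1, 1) is divisible by a variable from A. If all of these were
  in M, so would be all forms of degree (1, 1).\<close>

lemma ex_var_notin: "\<exists>i\<in>A. (1, 0, var i) \<notin> M"
proof (rule ccontr)
  assume "\<not> ?thesis"
  then have all: "(1, 0, var i) \<in> M" if "i \<in> A" for i using that by blast
  have "(1, 1, Poly_Mapping.single m 1) \<in> M" if m: "m \<in> mons A B 1 1" for m
  proof -
    obtain i m' where i: "i \<in> A" "m' \<in> mons A B 0 1" "m = Poly_Mapping.single i 1 + m'"
      using mons_Suc_left[OF finA finB disj, of m 0 1] m by auto
    have "(0 + 1, 1 + 0, Poly_Mapping.single m' 1 * var i) \<in> M"
      by (rule M_D(4)[OF all[OF i(1)] bih_single[OF i(2)]])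
    then show ?thesis by (simp add: var_def mult_single i(3) add.commute)
  qed
  then have "(1, 1, f) \<in> M" if "f \<in> bih A B 1 1" for f
    using bideal_contains_bih[OF bideal _ that] by blast
  then show False using relevant unfolding relevant_def by blast
qed

text \<open>Modulo M each variable of A is a multiple of \<open>var i0\<close> and each variable of
  B a multiple of \<open>var j0\<close>; the ratios are the coordinates of the point. A bilinear
  form reduces to its value at the point times \<open>var i0 * var j0\<close>, and this product is
  not in M.\<close>

theorem ex_point:
  "\<exists>\<alpha> \<beta>. (\<exists>i\<in>A. \<alpha> i \<noteq> 0) \<and> (\<exists>j\<in>B. \<beta> j \<noteq> 0) \<and>
     (\<forall>t. (1, 1, \<Sum>i\<in>A. \<Sum>j\<in>B. const (t i j) * (var i * var j)) \<in> M \<longrightarrow>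
       (\<Sum>i\<in>A. \<Sum>j\<in>B. t i j * \<alpha> i * \<beta> j) = 0)"
proof -
  interpret sw: maximal_bideal B A "swap_bideal M" by (rule maximal_bideal_swap)
  obtain i0 where i0: "i0 \<in> A" "(1, 0, var i0) \<notin> M" using ex_var_notin by blast
  obtain j0 where j0: "j0 \<in> B" "(0, 1, var j0) \<notin> M" using sw.ex_var_notin by auto
  obtain \<alpha> where \<alpha>: "\<And>i. i \<in> A \<Longrightarrow> (1, 0, var i - const (\<alpha> i) * var i0) \<in> M"
    using variable_ratio[OF i0 _ j0] by metis
  obtain \<beta> where \<beta>: "\<And>j. j \<in> B \<Longrightarrow> (0, 1, var j - const (\<beta> j) * var j0) \<in> M"
    using sw.variable_ratio[OF j0(1) _ _ i0(1)] i0(2) j0(2) by simp metis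
  have \<alpha>0: "\<alpha> i0 \<noteq> 0"
  proof
    assume "\<alpha> i0 = 0"
    then show False using \<alpha>[OF i0(1)] i0(2) by simp
  qed
  have \<beta>0: "\<beta> j0 \<noteq> 0"
  proof
    assume "\<beta> j0 = 0"
    then show False using \<beta>[OF j0(1)] j0(2) by simp
  qed
  note vl = bih_var_left[OF finA finB disj] and vr = bih_var_right[OF finA finB disj]
  have prod: "(1, 1, var i * var j - const (\<alpha> i * \<beta> j) * (var i0 * var j0)) \<in> M"
    if ij: "i \<in> A" "j \<in> B" for i j
  proof -
    have "(0 + 1, 1 + 0, var j * (var i - const (\<alpha> i) * var i0)) \<in> M"
      by (rule M_D(4)[OF \<alpha>[OF ij(1)] vr[OF ij(2)]])
    moreover have "(1 + 0, 0 + 1, (const (\<alpha> i) * var i0) * (var j - const (\<beta> j) * var j0)) \<in> M"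
      by (rule M_D(4)[OF \<beta>[OF ij(2)] bih_const_mult[OF vl[OF i0(1)]]])
    ultimately have "(1, 1, var j * (var i - const (\<alpha> i) * var i0)
       + (const (\<alpha> i) * var i0) * (var j - const (\<beta> j) * var j0)) \<in> M" by (intro M_D(3)) auto
    then show ?thesis by (simp add: algebra_simps flip: const_mult)
  qed
  have "(\<Sum>i\<in>A. \<Sum>j\<in>B. t i j * \<alpha> i * \<beta> j) = 0"
    if t: "(1, 1, \<Sum>i\<in>A. \<Sum>j\<in>B. const (t i j) * (var i * var j)) \<in> M" for t
  proof (rule ccontr)
    let ?s = "\<Sum>i\<in>A. \<Sum>j\<in>B. t i j * \<alpha> i * \<beta> j"
    assume s: "?s \<noteq> 0"
    let ?f = "\<lambda>i j. const (t i j) * (var i * var j - const (\<alpha> i * \<beta> j) * (var i0 * var j0))"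
    have const_sum: "const (sum f S) = (\<Sum>x\<in>S. const (f x))" for f :: "nat \<Rightarrow> 'k" and S
      by (induction S rule: infinite_finite_induct) (auto simp: single_add)
    have "(1, 1, \<Sum>i\<in>A. \<Sum>j\<in>B. ?f i j) \<in> M"
      using prod by (intro bideal_sum[OF bideal] M_D(5))
    moreover have "(\<Sum>i\<in>A. \<Sum>j\<in>B. ?f i j)
        = (\<Sum>i\<in>A. \<Sum>j\<in>B. const (t i j) * (var i * var j)) - const ?s * (var i0 * var j0)"
      by (simp add: right_diff_distrib sum_subtractf const_sum sum_distrib_right const_mult mult.assoc
          flip: mult.assoc[of "const _" "const _" "_ * _"])
    ultimately have "(1, 1, (\<Sum>i\<in>A. \<Sum>j\<in>B. const (t i j) * (var i * var j)) - const ?s * (var i0 * var j0)) \<in> M"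
      by metis
    from M_D(6)[OF t this] have "(1, 1, const ?s * (var i0 * var j0)) \<in> M"
      by (simp only: diff_diff_eq2 add_diff_cancel_left')
    then have "(1 + 0, 0 + 1, var i0 * var j0) \<in> M" using const_cancel[OF s] by simp
    then show False using prime[OF vl[OF i0(1)] vr[OF j0(1)]] i0(2) j0(2) by blast
  qed
  then show ?thesis using \<alpha>0 \<beta>0 i0(1) j0(1) by blast
qed

end

section \<open>Common zeros of bilinear forms\<close>

context
  fixes A B :: "nat set" and K :: "'c set" and \<theta> :: "'c \<Rightarrow> 'k::field mpoly"
begin

text \<open>The generators have degree (1, 1), so in degree (d, e) their coefficients have degree (d
  - 1, e - 1). The alternative \<open>p = 0\<close> supplies the pieces with d or e equal to
  0.\<close>

definition gen_bideal :: "(nat \<times> nat \<times> 'k mpoly) set" where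
  "gen_bideal = {(d, e, p). p = 0 \<or>
     (\<exists>a b h. d = Suc a \<and> e = Suc b \<and> (\<forall>k\<in>K. h k \<in> bih A B a b) \<and> p = (\<Sum>k\<in>K. \<theta> k * h k))}"

end

lemma gen_bideal_iff:
  "(d, e, p) \<in> gen_bideal A B K \<theta> \<longleftrightarrow> p = 0 \<or>
     (\<exists>a b h. d = Suc a \<and> e = Suc b \<and> (\<forall>k\<in>K. h k \<in> bih A B a b) \<and> p = (\<Sum>k\<in>K. \<theta> k * h k))"
  by (simp add: gen_bideal_def)

interpretation mpoly_space: vector_space "\<lambda>c p. const c * p :: 'k::field mpoly"
  by unfold_locales (auto simp: algebra_simps single_add const_mult[symmetric])

section \<open>Growth of the pieces of degree (d, d)\<close>

context two_blocks
begin

lemma bideal_gen_bideal: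
  assumes "\<And>k. k \<in> K \<Longrightarrow> \<theta> k \<in> bih A B 1 1"
  shows "bideal A B (gen_bideal A B K \<theta>)"
  unfolding bideal_def
proof (intro conjI allI impI)
  show "(d, e, 0) \<in> gen_bideal A B K \<theta>" for d e by (simp add: gen_bideal_def)
  show "p \<in> bih A B d e" if "(d, e, p) \<in> gen_bideal A B K \<theta>" for d e p
    using that bih_mult[OF assms] by (force simp: gen_bideal_def intro!: bih_sum)
  show "(d, e, p + q) \<in> gen_bideal A B K \<theta>"
    if pq: "(d, e, p) \<in> gen_bideal A B K \<theta>" "(d, e, q) \<in> gen_bideal A B K \<theta>" for d e p q
  proof (cases "p = 0 \<or> q = 0")
    case False
    then obtain a b h h' where "d = Suc a" "e = Suc b"
      "\<forall>k\<in>K. h k \<in> bih A B a b" "p = (\<Sum>k\<in>K. \<theta> k * h k)"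
      "\<forall>k\<in>K. h' k \<in> bih A B a b" "q = (\<Sum>k\<in>K. \<theta> k * h' k)"
      using pq unfolding gen_bideal_iff by auto
    then have "d = Suc a \<and> e = Suc b \<and> (\<forall>k\<in>K. h k + h' k \<in> bih A B a b)
       \<and> p + q = (\<Sum>k\<in>K. \<theta> k * (h k + h' k))"
      by (simp add: bih_add distrib_left sum.distrib)
    then show ?thesis
      unfolding gen_bideal_iff by (intro disjI2 exI[of _ a] exI[of _ b] exI[of _ "\<lambda>k. h k + h' k"])
  qed (use pq in auto)
  show "(d' + d, e' + e, r * p) \<in> gen_bideal A B K \<theta>"
    if pr: "(d, e, p) \<in> gen_bideal A B K \<theta>" "r \<in> bih A B d' e'" for d e d' e' p r
  proof (cases "p = 0")
    case True
    then show ?thesis by (simp add: gen_bideal_def)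
  next
    case False
    then obtain a b h where "d = Suc a" "e = Suc b"
      "\<forall>k\<in>K. h k \<in> bih A B a b" "p = (\<Sum>k\<in>K. \<theta> k * h k)"
      using pr(1) unfolding gen_bideal_iff by auto
    then have "d' + d = Suc (d' + a) \<and> e' + e = Suc (e' + b) \<and> (\<forall>k\<in>K. r * h k \<in> bih A B (d' + a) (e' + b))
       \<and> r * p = (\<Sum>k\<in>K. \<theta> k * (r * h k))"
      using bih_mult[OF pr(2)] by (simp add: sum_distrib_left mult.left_commute)
    then show ?thesis
      unfolding gen_bideal_iff by (intro disjI2 exI[of _ "d' + a"] exI[of _ "e' + b"] exI[of _ "\<lambda>k. r * h k"])
  qed
qed

text \<open>If the ideal contains everything in degree (D, D), the ring formed by the pieces of
  degrees (d, d) is a finite module over the algebra generated by the \<theta>, with the monomials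
  of degree below (D, D) as generators. The set collects the resulting products of degree (d,
  d).\<close>

definition spanning :: "'c set \<Rightarrow> ('c \<Rightarrow> 'k::field mpoly) \<Rightarrow> nat \<Rightarrow> nat \<Rightarrow> 'k mpoly set" where
  "spanning K \<theta> D d = {(\<Prod>k\<in>K. \<theta> k ^ \<mu> k) * Poly_Mapping.single m 1 | \<mu> m j.
     j < D \<and> m \<in> mons A B j j \<and> sum \<mu> K + j = d}"

lemma spanning_mult:
  assumes "finite K" "k \<in> K" "p \<in> spanning K \<theta> D d"
  shows "\<theta> k * p \<in> spanning K \<theta> D (Suc d)"
proof -
  obtain \<mu> m j where p: "p = (\<Prod>k\<in>K. \<theta> k ^ \<mu> k) * Poly_Mapping.single m 1"
    "j < D" "m \<in> mons A B j j" "sum \<mu> K + j = d" using assms(3) by (auto simp: spanning_def)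
  let ?\<nu> = "\<mu>(k := Suc (\<mu> k))"
  have "(\<Prod>x\<in>K. \<theta> x ^ ?\<nu> x) = \<theta> k ^ Suc (\<mu> k) * (\<Prod>x\<in>K - {k}. \<theta> x ^ ?\<nu> x)"
    using assms by (subst prod.remove[of _ k]) auto
  also have "(\<Prod>x\<in>K - {k}. \<theta> x ^ ?\<nu> x) = (\<Prod>x\<in>K - {k}. \<theta> x ^ \<mu> x)"
    by (intro prod.cong) auto
  also have "\<theta> k ^ Suc (\<mu> k) * (\<Prod>x\<in>K - {k}. \<theta> x ^ \<mu> x) = \<theta> k * (\<Prod>x\<in>K. \<theta> x ^ \<mu> x)"
    using assms by (subst (2) prod.remove[of _ k]) (auto simp: mult_ac)
  finally have 1: "\<theta> k * p = (\<Prod>x\<in>K. \<theta> x ^ ?\<nu> x) * Poly_Mapping.single m 1" by (simp add: p mult_ac)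
  have "sum ?\<nu> K = Suc (\<mu> k) + sum \<mu> (K - {k})"
    using assms by (subst sum.remove[of _ k]) (auto intro: sum.cong)
  then have "sum ?\<nu> K + j = Suc d" using assms p(4) by (simp add: sum.remove[of K k \<mu>])
  with 1 p(2,3) show ?thesis unfolding spanning_def by blast
qed

text \<open>From degree (D, D) on, every form is a combination of the \<theta> with coefficients one
  degree lower, to which the induction applies. Below that degree the monomials themselves belong to
  the spanning set.\<close>

lemma bih_subset_span:
  fixes \<theta> :: "'c \<Rightarrow> 'k::field mpoly"
  assumes K: "finite K"
    and D: "\<And>p. p \<in> bih A B D D \<Longrightarrow> (D, D, p) \<in> gen_bideal A B K \<theta>"
    and bid: "bideal A B (gen_bideal A B K \<theta>)"
    and p: "p \<in> bih A B d d"
  shows "p \<in> mpoly_space.span (spanning K \<theta> D d)"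
  using p
proof (induction d arbitrary: p rule: less_induct)
  case (less d)
  show ?case
  proof (cases "d < D")
    case True
    have "const (Poly_Mapping.lookup p m) * Poly_Mapping.single m 1 \<in> mpoly_space.span (spanning K \<theta> D d)"
      if m: "m \<in> mons A B d d" for m
    proof (intro mpoly_space.span_scale mpoly_space.span_base)
      have "Poly_Mapping.single m 1 = (\<Prod>k\<in>K. \<theta> k ^ (\<lambda>_. 0) k) * Poly_Mapping.single m (1::'k)" by simp
      then show "Poly_Mapping.single m 1 \<in> spanning K \<theta> D d"
        unfolding spanning_def using True m by (intro CollectI exI[of _ "\<lambda>_. 0"] exI[of _ m] exI[of _ d]) simp
    qed
    then have "(\<Sum>m\<in>mons A B d d. const (Poly_Mapping.lookup p m) * Poly_Mapping.single m 1)
       \<in> mpoly_space.span (spanning K \<theta> D d)" by (rule mpoly_space.span_sum)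
    then show ?thesis using bih_expand[OF finite_mons[OF finA finB] less.prems] by (simp add: mult_single)
  next
    case False
    have "(d, d, Poly_Mapping.single m 1) \<in> gen_bideal A B K \<theta>" if m: "m \<in> mons A B d d" for m
    proof -
      obtain m1 m2 where m12: "m1 \<in> mons A B D D" "m2 \<in> mons A B (d - D) (d - D)" "m = m1 + m2"
        using mons_split[OF finA finB disj, of m D "d - D" D "d - D"] m False by auto
      have "(d - D + D, d - D + D, Poly_Mapping.single m2 1 * Poly_Mapping.single m1 1) \<in> gen_bideal A B K \<theta>"
        by (rule bidealD(4)[OF bid D[OF bih_single[OF m12(1)]] bih_single[OF m12(2)]])
      then show ?thesis using False by (simp add: mult_single m12(3) add.commute)
    qed
    then have "(d, d, p) \<in> gen_bideal A B K \<theta>" using bideal_contains_bih[OF bid _ less.prems] by blast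
    then consider "p = 0" | a h where "d = Suc a" "\<forall>k\<in>K. h k \<in> bih A B a a" "p = (\<Sum>k\<in>K. \<theta> k * h k)"
      unfolding gen_bideal_def by auto
    then show ?thesis
    proof cases
      case 1
      then show ?thesis by (simp add: mpoly_space.span_zero)
    next
      case 2
      have "\<theta> k * h k \<in> mpoly_space.span (spanning K \<theta> D d)" if k: "k \<in> K" for k
      proof -
        have "h k \<in> mpoly_space.span (spanning K \<theta> D a)" using less.IH 2 k by auto
        then show ?thesis
        proof (induction rule: mpoly_space.span_induct_alt)
          case base
          then show ?case by (simp add: mpoly_space.span_zero)
        next
          case (step c x y)
          have "\<theta> k * x \<in> spanning K \<theta> D d" using spanning_mult[OF K k step(1)] 2 by simp
          then have "const c * (\<theta> k * x) + \<theta> k * y \<in> mpoly_space.span (spanning K \<theta> D d)"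
            by (intro mpoly_space.span_add[OF mpoly_space.span_scale[OF mpoly_space.span_base] step(2)])
          then show ?case by (simp add: algebra_simps)
        qed
      qed
      then show ?thesis unfolding 2 by (intro mpoly_space.span_sum) (use 2 in auto)
    qed
  qed
qed

text \<open>A product is determined by its monomial and the exponents of all \<theta> but one: the
  exponent at \<open>k0\<close> is what is missing to the total \<open>d\<close>. Hence the power is
  \<open>card K - 1\<close> rather than \<open>card K\<close>.\<close>

lemma card_spanning:
  fixes \<theta> :: "'c \<Rightarrow> 'k::field mpoly"
  assumes K: "finite K" "K \<noteq> {}"
  shows "finite (spanning K \<theta> D d) \<and>
    card (spanning K \<theta> D d) \<le> Suc d ^ (card K - 1) * card (\<Union>j<D. mons A B j j)"
proof -
  obtain k0 where k0: "k0 \<in> K" using K by blast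
  let ?F = "PiE (K - {k0}) (\<lambda>_. {..d})" and ?M = "\<Union>j<D. mons A B j j"
  define \<Phi> where "\<Phi> = (\<lambda>(\<nu>, m). \<theta> k0 ^ (d - sum \<nu> (K - {k0}) - deg_on A m) * (\<Prod>k\<in>K - {k0}. \<theta> k ^ \<nu> k)
       * Poly_Mapping.single m (1::'k))"
  have fin: "finite ?F" "finite ?M" using K finite_mons by (auto intro!: finite_PiE)
  have "spanning K \<theta> D d \<subseteq> \<Phi> ` (?F \<times> ?M)"
  proof
    fix p assume "p \<in> spanning K \<theta> D d"
    then obtain \<mu> m j where p: "p = (\<Prod>k\<in>K. \<theta> k ^ \<mu> k) * Poly_Mapping.single m 1"
      "j < D" "m \<in> mons A B j j" "sum \<mu> K + j = d" by (auto simp: spanning_def)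
    define \<nu> where "\<nu> = restrict \<mu> (K - {k0})"
    have s: "sum \<mu> K = \<mu> k0 + sum \<mu> (K - {k0})" using K k0 by (intro sum.remove)
    have \<nu>: "sum \<nu> (K - {k0}) = sum \<mu> (K - {k0})" by (intro sum.cong) (auto simp: \<nu>_def)
    have "\<mu> k \<le> d" if "k \<in> K" for k
      using member_le_sum[of k K \<mu>] that K p(4) by simp
    then have "\<nu> \<in> ?F" by (auto simp: \<nu>_def)
    moreover have "m \<in> ?M" using p by auto
    moreover have "p = \<Phi> (\<nu>, m)"
    proof -
      have "d - sum \<nu> (K - {k0}) - deg_on A m = \<mu> k0" using p(3,4) s \<nu> by (simp add: mons_def)
      moreover have "(\<Prod>k\<in>K - {k0}. \<theta> k ^ \<nu> k) = (\<Prod>k\<in>K - {k0}. \<theta> k ^ \<mu> k)"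
        by (intro prod.cong) (auto simp: \<nu>_def)
      moreover have "(\<Prod>k\<in>K. \<theta> k ^ \<mu> k) = \<theta> k0 ^ \<mu> k0 * (\<Prod>k\<in>K - {k0}. \<theta> k ^ \<mu> k)"
        using K k0 by (intro prod.remove)
      ultimately show ?thesis by (simp add: \<Phi>_def p(1))
    qed
    ultimately show "p \<in> \<Phi> ` (?F \<times> ?M)" by blast
  qed
  moreover have "card (\<Phi> ` (?F \<times> ?M)) \<le> card ?F * card ?M"
    using card_image_le[of "?F \<times> ?M" \<Phi>] fin by (simp add: card_cartesian_product)
  moreover have "card ?F = Suc d ^ (card K - 1)"
    using K k0 by (simp add: card_PiE)
  moreover have "finite (\<Phi> ` (?F \<times> ?M))" using fin by blast
  ultimately show ?thesis
    using card_mono[of "\<Phi> ` (?F \<times> ?M)" "spanning K \<theta> D d"] finite_subset[of "spanning K \<theta> D d" "\<Phi> ` (?F \<times> ?M)"]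
    by simp
qed

lemma card_mons_le_span:
  assumes "finite E" "bih A B d d \<subseteq> mpoly_space.span (E :: 'k::field mpoly set)"
  shows "card (mons A B d d) \<le> card E"
proof -
  let ?X = "(\<lambda>m. Poly_Mapping.single m (1::'k)) ` mons A B d d"
  have inj: "inj_on (\<lambda>m. Poly_Mapping.single m (1::'k)) (mons A B d d)"
    by (intro inj_onI) (metis keys_single singleton_inject zero_neq_one)
  have "\<not> mpoly_space.dependent ?X"
  proof (rule mpoly_space.independent_if_scalars_zero)
    show "finite ?X" using finite_mons by simp
    fix f x assume f: "(\<Sum>x\<in>?X. const (f x) * x) = 0" and "x \<in> ?X"
    then obtain m where m: "m \<in> mons A B d d" "x = Poly_Mapping.single m 1" by blast
    have "0 = Poly_Mapping.lookup (\<Sum>m'\<in>mons A B d d. const (f (Poly_Mapping.single m' 1)) * Poly_Mapping.single m' 1) m"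
      using f by (simp add: sum.reindex[OF inj])
    also have "\<dots> = (\<Sum>m'\<in>mons A B d d. if m' = m then f (Poly_Mapping.single m' 1) else 0)"
      by (simp add: lookup_sum mult_single lookup_single when_def)
    also have "\<dots> = f x" using m finite_mons by simp
    finally show "f x = 0" by simp
  qed
  moreover have "?X \<subseteq> mpoly_space.span E" using assms(2) bih_single by blast
  ultimately have "card ?X \<le> card E" using mpoly_space.independent_span_bound[OF assms(1)] by blast
  then show ?thesis by (simp add: card_image[OF inj])
qed

text \<open>The exponents of all variables except \<open>i0\<close> and \<open>j0\<close> range
  freely over the numbers below \<open>T\<close>, and these two variables fill up the degree. The
  factor \<open>card A + card B\<close> leaves enough room for that.\<close>

lemma card_mons_ge:
  assumes "i0 \<in> A" "j0 \<in> B"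
  shows "T ^ (card A - 1 + (card B - 1)) \<le> card (mons A B ((card A + card B) * T) ((card A + card B) * T))"
proof -
  let ?d = "(card A + card B) * T" and ?A = "A - {i0}" and ?B = "B - {j0}"
  let ?F = "PiE (?A \<union> ?B) (\<lambda>_. {..<T})"
  define mm where "mm g = (\<Sum>i\<in>?A \<union> ?B. Poly_Mapping.single i (g i)) + Poly_Mapping.single i0 (?d - sum g ?A)
      + Poly_Mapping.single j0 (?d - sum g ?B)" for g :: "nat \<Rightarrow> nat"
  have ij: "i0 \<notin> B" "j0 \<notin> A" "i0 \<noteq> j0" using assms disj by auto
  have look: "Poly_Mapping.lookup (mm g) x = (if x \<in> ?A \<union> ?B then g x else if x = i0 then ?d - sum g ?A
      else if x = j0 then ?d - sum g ?B else 0)" for g x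
  proof -
    have "Poly_Mapping.lookup (\<Sum>i\<in>?A \<union> ?B. Poly_Mapping.single i (g i)) x = (\<Sum>i\<in>?A \<union> ?B. if i = x then g x else 0)"
      unfolding lookup_sum by (intro sum.cong) (auto simp: lookup_single when_def)
    also have "\<dots> = (if x \<in> ?A \<union> ?B then g x else 0)" by simp
    finally show ?thesis using ij by (auto simp: mm_def lookup_add lookup_single when_def)
  qed
  have le: "sum g S \<le> ?d" if "g \<in> ?F" "S \<subseteq> ?A \<union> ?B" "card S \<le> card A + card B" for g S
  proof -
    have "sum g S \<le> of_nat (card S) * T"
      by (rule sum_bounded_above) (use that in \<open>auto simp: PiE_iff intro: less_imp_le\<close>)
    also have "\<dots> \<le> ?d" using that by simp
    finally show ?thesis .
  qed
  have "mm g \<in> mons A B ?d ?d" if g: "g \<in> ?F" for g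
  proof -
    have "sum g ?A \<le> ?d" "sum g ?B \<le> ?d"
      using le[OF g, of ?A] le[OF g, of ?B] card_mono[OF finA, of ?A] card_mono[OF finB, of ?B] by auto
    moreover have "deg_on A (mm g) = (?d - sum g ?A) + sum g ?A"
      unfolding deg_on_def using assms ij disj
      by (subst sum.remove[OF finA assms(1)]) (auto simp: look intro!: sum.cong)
    moreover have "deg_on B (mm g) = (?d - sum g ?B) + sum g ?B"
      unfolding deg_on_def using assms ij disj
      by (subst sum.remove[OF finB assms(2)]) (auto simp: look intro!: sum.cong)
    moreover have "x \<in> A \<union> B" if "x \<in> Poly_Mapping.keys (mm g)" for x
    proof (rule ccontr)
      assume "x \<notin> A \<union> B"
      then have "Poly_Mapping.lookup (mm g) x = 0" using assms look[of g x] by auto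
      with that show False by (simp add: in_keys_iff)
    qed
    ultimately show ?thesis by (simp add: mons_def subset_iff)
  qed
  then have "mm ` ?F \<subseteq> mons A B ?d ?d" by blast
  moreover have "inj_on mm ?F"
  proof (rule inj_onI)
    fix g h assume gh: "g \<in> ?F" "h \<in> ?F" "mm g = mm h"
    show "g = h"
    proof (rule PiE_ext[OF gh(1,2)])
      fix x assume "x \<in> ?A \<union> ?B"
      then show "g x = h x" using look[of g x] look[of h x] gh(3) by simp
    qed
  qed
  ultimately have "card ?F \<le> card (mons A B ?d ?d)"
    using card_mono[OF finite_mons[OF finA finB]] card_image by metis
  moreover have "card ?F = T ^ card (?A \<union> ?B)" by (simp add: card_PiE)
  moreover have "card (?A \<union> ?B) = card A - 1 + (card B - 1)"
    using assms disj by (subst card_Un_disjoint) auto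
  ultimately show ?thesis by simp
qed

text \<open>If some power of the irrelevant ideal were contained in the ideal of the forms, the dimension of
  the part of degree (d, d) would grow like the power card K - 1 of d; it grows like card A + card B - 2.\<close>

lemma relevant_gen_bideal:
  assumes "A \<noteq> {}" "B \<noteq> {}" and K: "finite K" "K \<noteq> {}" "card K \<le> card A - 1 + (card B - 1)"
    and \<theta>: "\<And>k. k \<in> K \<Longrightarrow> \<theta> k \<in> bih A B 1 1"
  shows "relevant A B (gen_bideal A B K \<theta>)"
proof (rule ccontr)
  assume "\<not> ?thesis"
  then obtain D where D: "\<And>p. p \<in> bih A B D D \<Longrightarrow> (D, D, p) \<in> gen_bideal A B K \<theta>"
    unfolding relevant_def by blast
  obtain i0 j0 where ij: "i0 \<in> A" "j0 \<in> B" using assms by blast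
  define s c r where "s = card A + card B" and "c = card (\<Union>j<D. mons A B j j)" and "r = card K - 1"
  \<comment> \<open>\<open>T\<close> exceeds the constant that stands before \<open>T ^ r\<close> in
    the upper bound, so that \<open>T ^ Suc r\<close> contradicts it.\<close>
  define T where "T = Suc (Suc s ^ r * c)"
  have "T ^ (card A - 1 + (card B - 1)) \<le> card (mons A B (s * T) (s * T))"
    using card_mons_ge[OF ij] by (simp add: s_def)
  also have "\<dots> \<le> card (spanning K \<theta> D (s * T))"
  proof (rule card_mons_le_span)
    show "finite (spanning K \<theta> D (s * T))" using card_spanning[OF K(1,2), of \<theta>] by blast
    show "bih A B (s * T) (s * T) \<subseteq> mpoly_space.span (spanning K \<theta> D (s * T))"
      using bih_subset_span[OF K(1) D bideal_gen_bideal[OF \<theta>]] by blast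
  qed
  also have "\<dots> \<le> Suc (s * T) ^ r * c"
    using card_spanning[OF K(1,2), of \<theta> D "s * T"] by (simp add: r_def c_def)
  also have "\<dots> \<le> (Suc s * T) ^ r * c"
    by (intro mult_right_mono power_mono) (auto simp: T_def)
  also have "\<dots> = T ^ r * (Suc s ^ r * c)" by (simp only: power_mult_distrib mult_ac)
  also have "\<dots> < T ^ r * T" by (simp add: T_def)
  also have "\<dots> \<le> T ^ (card A - 1 + (card B - 1))"
  proof -
    have "card K \<noteq> 0" using K by auto
    then have "Suc r \<le> card A - 1 + (card B - 1)" using K(3) by (simp add: r_def)
    then have "T ^ Suc r \<le> T ^ (card A - 1 + (card B - 1))" by (intro power_increasing) (auto simp: T_def)
    then show ?thesis by (simp add: mult.commute)
  qed
  finally show False by simp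
qed

end

theorem bilinear_forms_common_zero:
  fixes t :: "'c \<Rightarrow> nat \<Rightarrow> nat \<Rightarrow> 'k::alg_closed_field"
  assumes "n > 0" "finite K" "card K \<le> 2 * n - 2"
  shows "\<exists>\<alpha> \<beta>. (\<exists>i<n. \<alpha> i \<noteq> 0) \<and> (\<exists>j<n. \<beta> j \<noteq> 0) \<and>
    (\<forall>k\<in>K. (\<Sum>i<n. \<Sum>j<n. t k i j * \<alpha> i * \<beta> j) = 0)"
proof (cases "K = {}")
  case True
  with assms(1) show ?thesis by (intro exI[of _ "\<lambda>_. 1"]) auto
next
  case False
  \<comment> \<open>The second group of variables is a copy shifted by \<open>n\<close> to make the
    blocks disjoint; \<beta> is shifted back at the end.\<close>
  define A B where "A = {..<n}" and "B = {n..<n + n}"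
  interpret two_blocks A B by unfold_locales (auto simp: A_def B_def)
  define T where "T k i j = t k i (j - n)" for k i j
  define \<theta> where "\<theta> k = (\<Sum>i\<in>A. \<Sum>j\<in>B. const (T k i j) * (var i * var j))" for k
  have \<theta>: "\<theta> k \<in> bih A B 1 1" for k
    unfolding \<theta>_def
    using bih_mult[OF bih_var_left[OF finA finB disj] bih_var_right[OF finA finB disj]]
    by (intro bih_sum bih_const_mult) auto
  let ?J = "gen_bideal A B K \<theta>"
  have "bideal A B ?J" by (rule bideal_gen_bideal) (rule \<theta>)
  moreover have "relevant A B ?J"
    by (rule relevant_gen_bideal) (use assms False \<theta> in \<open>auto simp: A_def B_def\<close>)
  ultimately obtain M where M: "bideal A B M" "relevant A B M" "?J \<subseteq> M"
    "\<forall>I. bideal A B I \<longrightarrow> relevant A B I \<longrightarrow> M \<subseteq> I \<longrightarrow> I = M"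
    using ex_maximal by blast
  interpret maximal_bideal A B M by unfold_locales (use M in auto)
  obtain \<alpha> \<beta> where ab: "\<exists>i\<in>A. \<alpha> i \<noteq> 0" "\<exists>j\<in>B. \<beta> j \<noteq> 0"
    "\<And>t. (1, 1, \<Sum>i\<in>A. \<Sum>j\<in>B. const (t i j) * (var i * var j)) \<in> M \<Longrightarrow>
       (\<Sum>i\<in>A. \<Sum>j\<in>B. t i j * \<alpha> i * \<beta> j) = 0"
    using ex_point by blast
  have "(\<Sum>i<n. \<Sum>j<n. t k i j * \<alpha> i * \<beta> (n + j)) = 0" if k: "k \<in> K" for k
  proof -
    have "\<theta> k = (\<Sum>l\<in>K. \<theta> l * const (if l = k then 1 else 0))"
      using k assms(2) by (subst sum.remove[of _ k]) auto
    then have "(1, 1, \<theta> k) \<in> ?J"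
      unfolding gen_bideal_def
      by (auto intro!: exI[of _ "\<lambda>l. const (if l = k then 1 else 0)"])
    then have "(1, 1, \<theta> k) \<in> M" using M(3) by blast
    then have "(\<Sum>i\<in>A. \<Sum>j\<in>B. T k i j * \<alpha> i * \<beta> j) = 0" using ab(3) unfolding \<theta>_def by blast
    moreover have "(\<Sum>j\<in>B. T k i j * \<alpha> i * \<beta> j) = (\<Sum>j<n. t k i j * \<alpha> i * \<beta> (n + j))" for i
      unfolding B_def T_def
      by (rule sum.reindex_bij_witness[of _ "\<lambda>j. n + j" "\<lambda>j. j - n"]) auto
    ultimately show ?thesis by (simp add: A_def)
  qed
  moreover obtain j where "j \<in> B" "\<beta> j \<noteq> 0" using ab(2) by blast
  then have "\<exists>j<n. \<beta> (n + j) \<noteq> 0" by (intro exI[of _ "j - n"]) (auto simp: B_def)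
  moreover have "\<exists>i<n. \<alpha> i \<noteq> 0" using ab(1) by (auto simp: A_def)
  ultimately show ?thesis
    by (intro exI[of _ \<alpha>] exI[of _ "\<lambda>j. \<beta> (n + j)"] conjI ballI)
qed

text \<open>The products of linear forms lying in the span are cut out by the coordinates with respect to a basis
  of all quadratic forms extending the given ones; there are n (n - 1) / 2 of them.\<close>

lemma ex_product_in_kspan:
  fixes fs :: "'k::alg_closed_field mpoly list"
  assumes n: "1 \<le> n" "n \<le> 4" and len: "length fs = n" and quad: "\<forall>f\<in>set fs. quadratic_form n f"
    and rs: "regular_sequence (poly_ring n) fs"
  shows "\<exists>l r. linear_form n l \<and> l \<noteq> 0 \<and> linear_form n r \<and> r \<noteq> 0 \<and> l * r \<in> kspan fs"
proof -
  note rsD = regular_sequenceD[OF rs]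
  \<comment> \<open>One product of variables for each pair of indices without order, n (n + 1) / 2
    at most.\<close>
  define Q :: "'k mpoly set" where "Q = (\<lambda>(i, j). var i * var j) ` (SIGMA j:{..<n}. {..j})"
  have Qin: "var i * var j \<in> Q" if "i < n" "j < n" for i j
  proof (cases "j \<le> i")
    case True
    then show ?thesis using that unfolding Q_def by (intro image_eqI[of _ _ "(i, j)"]) auto
  next
    case False
    then show ?thesis using that unfolding Q_def by (intro image_eqI[of _ _ "(j, i)"]) (auto simp: mult.commute)
  qed
  have "card Q \<le> card (SIGMA j:{..<n}. {..j})" unfolding Q_def by (rule card_image_le) auto
  also have "\<dots> = (\<Sum>j<n. Suc j)" by simp
  \<comment> \<open>This is where the bound on n enters: n (n + 1) / 2 <= 3 n - 2 amounts to (n - 1)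
    (n - 4) <= 0. After removing the n given forms from a basis, at most 2 n - 2 equations
    remain.\<close>
  also have "\<dots> \<le> 3 * n - 2"
  proof -
    have "n \<in> {1, 2, 3, 4}" using n by auto
    then show ?thesis by (auto simp: lessThan_Suc numeral_eq_Suc)
  qed
  finally have card_Q: "card Q \<le> 3 * n - 2" .
  have "finite Q" by (simp add: Q_def)
  have quad_span: "f \<in> mpoly_space.span Q" if f: "quadratic_form n f" for f :: "'k mpoly"
  proof -
    have "Poly_Mapping.single m (Poly_Mapping.lookup f m) \<in> mpoly_space.span Q"
      if m: "m \<in> Poly_Mapping.keys f" for m
    proof -
      have deg: "total_deg m = 2" "Poly_Mapping.keys m \<subseteq> {..<n}"
        using f m by (auto simp: quadratic_form_def homogeneous_def polys_iff)
      have "deg_on {..<n} m = 2" using total_deg_superset[OF _ deg(2)] deg(1) by (simp add: deg_on_def)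
      then have "m \<in> mons {..<n} {} (Suc (Suc 0)) 0" using deg(2) by (auto simp: mons_def deg_on_def)
      then obtain i m' where i: "i < n" "m' \<in> mons {..<n} {} (Suc 0) 0" "m = Poly_Mapping.single i 1 + m'"
        using mons_Suc_left[of "{..<n}" "{}" m "Suc 0" 0] by auto
      then obtain j m'' where j: "j < n" "m'' \<in> mons {..<n} {} 0 0" "m' = Poly_Mapping.single j 1 + m''"
        using mons_Suc_left[of "{..<n}" "{}" m' 0 0] by auto
      have "Poly_Mapping.lookup m'' x = 0" for x
        using j(2) by (cases "x < n") (auto simp: mons_def deg_on_def in_keys_iff)
      then have "m'' = 0" by (intro poly_mapping_eqI) simp
      then have "Poly_Mapping.single m (Poly_Mapping.lookup f m) = const (Poly_Mapping.lookup f m) * (var i * var j)"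
        by (simp add: var_def mult_single i j)
      also have "\<dots> \<in> mpoly_space.span Q"
        by (intro mpoly_space.span_scale mpoly_space.span_base Qin i j)
      finally show ?thesis .
    qed
    then have "(\<Sum>m\<in>Poly_Mapping.keys f. Poly_Mapping.single m (Poly_Mapping.lookup f m)) \<in> mpoly_space.span Q"
      by (rule mpoly_space.span_sum)
    then show ?thesis by (simp add: poly_mapping_sum_single)
  qed
  have indep: "c i = 0" if c: "(\<Sum>i<n. const (c i) * fs ! i) = 0" and i: "i < n" for c i
  proof -
    let ?cs = "rev (map c [0..<n])"
    have "(\<Sum>(f, c)\<leftarrow>zip (rev fs) ?cs. f * const c) = (\<Sum>(f, c)\<leftarrow>rev (zip fs (map c [0..<n])). f * const c)"
      using len by (simp add: zip_rev)
    also have "\<dots> = (\<Sum>(f, c)\<leftarrow>zip fs (map c [0..<n]). f * const c)"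
      by (subst rev_map[symmetric]) (rule sum_list_rev)
    also have "\<dots> = (\<Sum>i<n. const (c i) * fs ! i)"
      using len by (simp add: sum_list_sum_nth atLeast0LessThan mult.commute)
    finally have "(\<Sum>(f, c)\<leftarrow>zip (rev fs) ?cs. f * const c) = 0" using c by simp
    moreover have "1 \<notin> lin (polys n) (rev fs)" using rsD(3) lin_cong_set[of "rev fs" fs n] by simp
    moreover have "c i \<in> set ?cs" using i by simp
    ultimately show ?thesis using reg_independent[OF rsD(2), of ?cs "c i"] len by simp
  qed
  \<comment> \<open>A repetition would be a relation with coefficients 1 and -1. Distinctness
    identifies sums over positions, as in \<open>kspan\<close>, with sums over the set, as needed
    for bases.\<close>
  have "distinct fs"
    unfolding distinct_conv_nth
  proof (intro allI impI notI)
    fix i j assume ij: "i < length fs" "j < length fs" "i \<noteq> j" "fs ! i = fs ! j"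
    define c where "c k = (if k = i then 1 else if k = j then - 1 else (0::'k))" for k
    have "(\<Sum>k<n. const (c k) * fs ! k) = (\<Sum>k<n. (if k = i then fs ! i else 0) - (if k = j then fs ! j else 0))"
      using ij by (intro sum.cong) (auto simp: c_def single_uminus)
    also have "\<dots> = 0" using ij len by (simp add: sum_subtractf)
    finally have "c i = 0" using indep ij len by blast
    then show False by (simp add: c_def)
  qed
  have nth_bij: "bij_betw ((!) fs) {..<n} (set fs)" using bij_betw_nth[OF \<open>distinct fs\<close>] len by simp
  have "\<not> mpoly_space.dependent (set fs)"
  proof (rule mpoly_space.independent_if_scalars_zero)
    fix c f assume c: "(\<Sum>x\<in>set fs. const (c x) * x) = 0" and f: "f \<in> set fs"
    have "(\<Sum>i<n. const (c (fs ! i)) * fs ! i) = 0"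
      using c by (simp add: sum.reindex_bij_betw[OF nth_bij, symmetric])
    moreover obtain i where "i < n" "f = fs ! i" using f len by (auto simp: in_set_conv_nth)
    ultimately show "c f = 0" using indep[of "\<lambda>i. c (fs ! i)"] by blast
  qed simp
  moreover have "set fs \<subseteq> mpoly_space.span Q" using quad quad_span by blast
  ultimately obtain C where C: "set fs \<subseteq> C" "C \<subseteq> mpoly_space.span Q" "\<not> mpoly_space.dependent C"
      "mpoly_space.span Q \<subseteq> mpoly_space.span C"
    using mpoly_space.maximal_independent_subset_extend[of "set fs" "mpoly_space.span Q"] by auto
  have fin_C: "finite C" "card C \<le> card Q"
    using mpoly_space.independent_span_bound[OF \<open>finite Q\<close> C(3,2)] by auto
  have "card (set fs) = n" using \<open>distinct fs\<close> len distinct_card by blast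
  then have "card (C - set fs) \<le> 2 * n - 2"
    using fin_C card_Q C(1) by (simp add: card_Diff_subset)
  \<comment> \<open>The bilinear form attached to a basis element \<open>g\<close> is the coordinate
    of the product of the two linear forms at \<open>g\<close>. At a common zero, only coordinates
    at the members of \<open>fs\<close> remain.\<close>
  define t where "t g i j = mpoly_space.representation C (var i * var j) g" for g i j
  obtain \<alpha> \<beta> where ab: "\<exists>i<n. \<alpha> i \<noteq> 0" "\<exists>j<n. \<beta> j \<noteq> 0"
    "\<And>g. g \<in> C - set fs \<Longrightarrow> (\<Sum>i<n. \<Sum>j<n. t g i j * \<alpha> i * \<beta> j) = 0"
    using bilinear_forms_common_zero[of n "C - set fs" t] n fin_C \<open>card (C - set fs) \<le> 2 * n - 2\<close> by auto
  define L where "L a = (\<Sum>i<n. const (a i) * var i)" for a :: "nat \<Rightarrow> 'k"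
  have L: "linear_form n (L a)" for a
    unfolding linear_form_def L_def
    using homogeneous_mult[OF homogeneous_const homogeneous_var]
    by (auto intro!: polys.sum_closed homogeneous_sum var_polys)
  have L0: "L a \<noteq> 0" if a: "\<exists>i<n. a i \<noteq> 0" for a
  proof
    assume "L a = 0"
    obtain i where i: "i < n" "a i \<noteq> 0" using a by blast
    have "Poly_Mapping.lookup (L a) (Poly_Mapping.single i 1) = (\<Sum>k<n. if k = i then a k else 0)"
      unfolding L_def lookup_sum lookup_const_mult
    proof (intro sum.cong refl)
      fix k
      have "Poly_Mapping.single k (1::nat) = Poly_Mapping.single i 1 \<longleftrightarrow> k = i"
        by (metis keys_single singleton_inject zero_neq_one)
      then show "a k * Poly_Mapping.lookup (var k) (Poly_Mapping.single i 1) = (if k = i then a k else 0)"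
        unfolding var_def lookup_single when_def by simp
    qed
    then show False using i \<open>L a = 0\<close> by simp
  qed
  have prod: "L \<alpha> * L \<beta> = (\<Sum>i<n. \<Sum>j<n. const (\<alpha> i * \<beta> j) * (var i * var j))"
    unfolding L_def sum_product by (simp add: const_mult[symmetric] mult_ac)
  have inC: "var i * var j \<in> mpoly_space.span C" if "i < n" "j < n" for i j
    using Qin[OF that] mpoly_space.span_base C(4) by blast
  have rep: "mpoly_space.representation C (L \<alpha> * L \<beta>) g = (\<Sum>i<n. \<Sum>j<n. t g i j * \<alpha> i * \<beta> j)" for g
  proof -
    have "mpoly_space.representation C (const (\<alpha> i * \<beta> j) * (var i * var j)) g = t g i j * \<alpha> i * \<beta> j"
      if "i < n" "j < n" for i j
      using mpoly_space.representation_scale[OF C(3) inC[OF that]] by (simp add: t_def mult_ac)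
    moreover have s: "const (\<alpha> i * \<beta> j) * (var i * var j) \<in> mpoly_space.span C" if "i < n" "j < n" for i j
      by (rule mpoly_space.span_scale[OF inC[OF that]])
    ultimately have "mpoly_space.representation C (\<Sum>j<n. const (\<alpha> i * \<beta> j) * (var i * var j)) g
        = (\<Sum>j<n. t g i j * \<alpha> i * \<beta> j)" if "i < n" for i
      using that by (subst mpoly_space.representation_sum[OF C(3)]) auto
    moreover have "(\<Sum>j<n. const (\<alpha> i * \<beta> j) * (var i * var j)) \<in> mpoly_space.span C" if "i < n" for i
      using s that by (intro mpoly_space.span_sum) auto
    ultimately show ?thesis unfolding prod
      by (subst mpoly_space.representation_sum[OF C(3)]) auto
  qed
  have LC: "L \<alpha> * L \<beta> \<in> mpoly_space.span C"
    unfolding prod using inC by (intro mpoly_space.span_sum mpoly_space.span_scale) auto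
  have "L \<alpha> * L \<beta> = (\<Sum>g\<in>C. const (mpoly_space.representation C (L \<alpha> * L \<beta>) g) * g)"
    using mpoly_space.sum_representation_eq[OF C(3) LC fin_C(1)] by simp
  also have "\<dots> = (\<Sum>g\<in>set fs. const (mpoly_space.representation C (L \<alpha> * L \<beta>) g) * g)"
    using ab(3) C(1) fin_C by (intro sum.mono_neutral_right) (auto simp: rep)
  also have "\<dots> = (\<Sum>i<length fs. const (mpoly_space.representation C (L \<alpha> * L \<beta>) (fs ! i)) * fs ! i)"
    by (simp add: sum.reindex_bij_betw[OF nth_bij, symmetric] len)
  finally have "L \<alpha> * L \<beta> \<in> kspan fs" unfolding kspan_def
    by (intro CollectI exI[of _ "\<lambda>i. mpoly_space.representation C (L \<alpha> * L \<beta>) (fs ! i)"] conjI TrueI)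
  then show ?thesis using L L0 ab(1,2) by blast
qed

theorem theorem5p1:
  fixes n :: nat and fs :: "'k::alg_closed_field mpoly list"
  assumes char_not_2: "(2::'k) \<noteq> 0"
  shows "(1 \<le> n \<and> n \<le> 4 \<and> length fs = n \<and> (\<forall>f\<in>set fs. quadratic_form n f)
            \<and> regular_sequence (poly_ring n) fs
          \<longrightarrow> (\<exists>l. linear_form n l \<and>
                 exact_zero_divisor (quot_alg n fs)
                   (a_r_coset (poly_ring n) (genideal (poly_ring n) (set fs)) l)))
       \<and> (5 \<le> n \<and> generic n fs
          \<longrightarrow> \<not> (\<exists>x\<in>carrier (quot_alg n fs). exact_zero_divisor (quot_alg n fs) x))"
proof (intro conjI impI)
  assume *: "1 \<le> n \<and> n \<le> 4 \<and> length fs = n \<and> (\<forall>f\<in>set fs. quadratic_form n f)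
            \<and> regular_sequence (poly_ring n) fs"
  then obtain l r where lr: "linear_form n l" "l \<noteq> 0" "linear_form n r" "r \<noteq> 0" "l * r \<in> kspan fs"
    using ex_product_in_kspan[of n fs] by blast
  moreover have "\<forall>f\<in>set fs. homogeneous 2 f" using * by (auto simp: quadratic_form_def)
  ultimately show "\<exists>l. linear_form n l \<and>
                 exact_zero_divisor (quot_alg n fs)
                   (a_r_coset (poly_ring n) (genideal (poly_ring n) (set fs)) l)"
    using exact_zero_divisor_of_product[of n fs l r] * by blast
next
  assume "5 \<le> n \<and> generic n fs"
  then show "\<not> (\<exists>x\<in>carrier (quot_alg n fs). exact_zero_divisor (quot_alg n fs) x)"
    using generic_no_exact_zero_divisor by blast
qed

end
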